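(* Let $T>0$ and let $(\Omega,(\mathcal{F}_t)_{t\in[0,T]},P)$ be a filtered probability space satisfying the usual conditions, with $\mathcal{F}_0$ trivial and $\mathcal{F}=\mathcal{F}_T$. Let $\mathcal{O}\subset\mathbb{R}^n$ be an open set and $(S(t))_{t\in[0,T]}$ an $\mathcal{O}$-valued continuous adapted process having conditional full support in $\mathcal{O}$. Let $(\varepsilon_t)_{t\in[0,T]}$ be a continuous positive process such that \[ |\varepsilon_t-\varepsilon_s|\le L_s\sup_{s\le u\le t}|S(u)-S(s)|\quad\text{for all }0\le s\le t\le T, \] for some progressively measurable finite-valued process $(L_s)_{s\in[0,T]}$. Then there exist a probability measure $Q$ on $\mathcal{F}_T$ equivalent to $P$ and a process $(\tilde S(t))_{t\in[0,T]}$ taking values in $\mathcal{O}$ such that $\tilde S$ is a $Q$-martingale (in the filtration $(\mathcal{F}_t)$), bounded in $L^2(Q)$, and $|S(t)-\tilde S(t)|\le\varepsilon_t$ almost surely for all $t\in[0,T]$.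
   Context: Conditional full support: the process $S$ has conditional full support in $\mathcal{O}$ if for all $t\in[0,T]$ and every open set $G\subset C([0,T],\mathcal{O})$ (topology of uniform convergence), $P(S\in G\mid\mathcal{F}_t)>0$ almost surely on the event $\{S|_{[0,t]}\in\{g|_{[0,t]}: g\in G\}\}$.
   Formalization: The process ε is additionally assumed adapted; without this the claim fails (e.g. S fractional Brownian motion, ε_t = exp(-|S(T)|) for all t, L = 0). The final bound is stated as: for each t, almost surely. *)

theory Defs
  imports "HOL-Probability.Probability"
begin

definition filtration_on :: "'a measure \<Rightarrow> real \<Rightarrow> (real \<Rightarrow> 'a measure) \<Rightarrow> bool" where
  "filtration_on M T F \<longleftrightarrow>
     (\<forall>t\<in>{0..T}. subalgebra M (F t)) \<and>
     (\<forall>s t. 0 \<le> s \<and> s \<le> t \<and> t \<le> T \<longrightarrow> sets (F s) \<subseteq> sets (F t)) \<and>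
     sets (F T) = sets M"

definition usual_conditions :: "'a measure \<Rightarrow> real \<Rightarrow> (real \<Rightarrow> 'a measure) \<Rightarrow> bool" where
  "usual_conditions M T F \<longleftrightarrow>
     (\<forall>A B. A \<in> null_sets M \<and> B \<subseteq> A \<longrightarrow> B \<in> sets M) \<and>
     null_sets M \<subseteq> sets (F 0) \<and>
     (\<forall>t\<in>{0..<T}. sets (F t) = (\<Inter>u\<in>{t<..T}. sets (F u)))"

definition trivial_initial :: "'a measure \<Rightarrow> (real \<Rightarrow> 'a measure) \<Rightarrow> bool" where
  "trivial_initial M F \<longleftrightarrow> (\<forall>A\<in>sets (F 0). measure M A = 0 \<or> measure M A = 1)"

definition adapted_on :: "real \<Rightarrow> (real \<Rightarrow> 'a measure) \<Rightarrow> (real \<Rightarrow> 'a \<Rightarrow> 'b::topological_space) \<Rightarrow> bool" where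
  "adapted_on T F X \<longleftrightarrow> (\<forall>t\<in>{0..T}. X t \<in> borel_measurable (F t))"

definition progressive_on :: "real \<Rightarrow> (real \<Rightarrow> 'a measure) \<Rightarrow> (real \<Rightarrow> 'a \<Rightarrow> 'b::topological_space) \<Rightarrow> bool" where
  "progressive_on T F X \<longleftrightarrow>
     (\<forall>t\<in>{0..T}. (\<lambda>(s, \<omega>). X s \<omega>) \<in> borel_measurable (restrict_space borel {0..t} \<Otimes>\<^sub>M F t))"

definition cpath_in :: "real \<Rightarrow> (real^'n) set \<Rightarrow> (real \<Rightarrow> real^'n) \<Rightarrow> bool" where
  "cpath_in T U g \<longleftrightarrow> continuous_on {0..T} g \<and> g ` {0..T} \<subseteq> U"

definition uniformly_open :: "real \<Rightarrow> (real^'n) set \<Rightarrow> (real \<Rightarrow> real^'n) set \<Rightarrow> bool" where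
  "uniformly_open T U G \<longleftrightarrow>
     (\<forall>g\<in>G. cpath_in T U g) \<and>
     (\<forall>g\<in>G. \<exists>e>0. \<forall>h. cpath_in T U h \<and> (\<forall>t\<in>{0..T}. dist (h t) (g t) < e) \<longrightarrow> h \<in> G)"

definition cond_full_support ::
  "'a measure \<Rightarrow> real \<Rightarrow> (real \<Rightarrow> 'a measure) \<Rightarrow> (real^'n) set \<Rightarrow> (real \<Rightarrow> 'a \<Rightarrow> real^'n) \<Rightarrow> bool" where
  "cond_full_support M T F U S \<longleftrightarrow>
     (\<forall>t\<in>{0..T}. \<forall>G. uniformly_open T U G \<longrightarrow>
        (AE \<omega> in M. (\<exists>g\<in>G. \<forall>u\<in>{0..t}. S u \<omega> = g u) \<longrightarrow>
           real_cond_exp M (F t)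
             (indicator {\<omega>' \<in> space M. \<exists>g\<in>G. \<forall>u\<in>{0..T}. S u \<omega>' = g u}) \<omega> > 0))"

definition martingale_on ::
  "'a measure \<Rightarrow> real \<Rightarrow> (real \<Rightarrow> 'a measure) \<Rightarrow> (real \<Rightarrow> 'a \<Rightarrow> real^'n) \<Rightarrow> bool" where
  "martingale_on Q T F X \<longleftrightarrow>
     adapted_on T F X \<and>
     (\<forall>t\<in>{0..T}. integrable Q (X t)) \<and>
     (\<forall>s t i. 0 \<le> s \<and> s \<le> t \<and> t \<le> T \<longrightarrow>
        (AE \<omega> in Q. real_cond_exp Q (F s) (\<lambda>\<omega>'. X t \<omega>' $ i) \<omega> = X s \<omega> $ i))"

definition bounded_L2 :: "'a measure \<Rightarrow> real \<Rightarrow> (real \<Rightarrow> 'a \<Rightarrow> real^'n) \<Rightarrow> bool" where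
  "bounded_L2 Q T X \<longleftrightarrow>
     (\<forall>t\<in>{0..T}. X t \<in> borel_measurable Q) \<and>
     (SUP t\<in>{0..T}. \<integral>\<^sup>+ \<omega>. ennreal ((norm (X t \<omega>))\<^sup>2) \<partial>Q) < \<infinity>"

definition equivalent_measures :: "'a measure \<Rightarrow> 'a measure \<Rightarrow> bool" where
  "equivalent_measures Q M \<longleftrightarrow> sets Q = sets M \<and> null_sets Q = null_sets M"

end

theory Submission
  imports Defs
begin

text \<open>
  Let \<tau>(0) = 0 and let \<tau>(k+1) be the first time after \<tau>(k) at which S has moved by more than
  H(\<tau>(k)), where H is a small multiple of min(1, \<epsilon>, distance to the complement of U), or \<epsilon> has
  dropped below half of its value at \<tau>(k), capped at T. Continuity of S and \<epsilon> makes every path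
  reach T after finitely many steps. The process L is deliberately kept out of these stopping times:
  it may be unbounded along a path, and step sizes depending on it could accumulate before T.
  It enters only as follows: while S stays in a tube of radius of order \<epsilon> / (1 + |L|) around
  S(\<tau>(k)), no exit occurs. By conditional full support, given the stopped sigma-algebra, S has a
  positive conditional probability of staying in this tube up to T and ending in any prescribed
  orthant around S(\<tau>(k)). Putting most of the mass on these 2^n events, with weights that make the
  conditional mean of the increment vanish, gives an equivalent measure under which the increment
  from \<tau>(k) to \<tau>(k+1) is a martingale difference, and \<tau>(k+1) < T has at most 1/8 of the mass of
  \<tau>(k) < T. Under iteration the densities become constant along every path and the number of steps
  has geometric tails. The conditional expectation of S(T) given F(t) under the limit measure is the
  required martingale: between \<tau>(k) and \<tau>(k+1) it is a conditional mean of S(\<tau>(k+1)), which lies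
  within H(\<tau>(k)) of S(\<tau>(k)) in each coordinate.
\<close>

section \<open>The one-step change of measure\<close>

text \<open>Conditional full support speaks about deterministic times and fixed open sets of paths,
  while the construction needs it at random times with random radii. The bridge is countable:
  shortly after \<tau>(k), before S has moved appreciably, there is a rational time q, and the
  random radius is comparable to a rational one; some such pair occurs on a non-null event known at
  time q.

  Orthants serve two purposes. The conditional means on the 2^n events stay in their orthants when
  shifted by a small drift, so the drift of the remaining mass can be cancelled, and the weights are
  explicit, which avoids a measurable selection.

  Martingale differences are expressed by vanishing integrals over sets of the stopped
  sigma-algebra, because such statements pass between measures that agree on a suitable
  sigma-algebra.

  The ratio 1/8 pays for the L2 bound. Increments have norm at most 1, so S(\<tau>(k)) is controlled
  by the number N of steps, and the mean of N^2 is the sum of (2k+1) Q(\<tau>(k) < T), dominated by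
  the sum of 4^k / 8^k. The same tails ensure that the limit of the densities loses no mass.\<close>

lemma restr_to_subalg_eq:
  assumes "subalgebra A G" "subalgebra B G" "\<And>X. X \<in> sets G \<Longrightarrow> emeasure A X = emeasure B X"
  shows "restr_to_subalg A G = restr_to_subalg B G"
  using assms by (intro measure_eqI) (auto simp: sets_restr_to_subalg emeasure_restr_to_subalg)

lemma null_sets_density_pos:
  fixes Z :: "'a \<Rightarrow> real"
  assumes "Z \<in> borel_measurable M" "\<And>\<omega>. \<omega> \<in> space M \<Longrightarrow> 0 < Z \<omega>"
  shows "null_sets (density M Z) = null_sets M"
proof (intro set_eqI)
  fix A
  have "A \<in> null_sets (density M Z) \<longleftrightarrow> A \<in> sets M \<and> (AE \<omega> in M. \<omega> \<in> A \<longrightarrow> ennreal (Z \<omega>) = 0)"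
    using assms(1) by (subst null_sets_density_iff) auto
  also have "\<dots> \<longleftrightarrow> A \<in> sets M \<and> (AE \<omega> in M. \<omega> \<notin> A)"
  proof (intro conj_cong refl AE_cong)
    fix \<omega> assume "\<omega> \<in> space M"
    from assms(2)[OF this] show "(\<omega> \<in> A \<longrightarrow> ennreal (Z \<omega>) = 0) = (\<omega> \<notin> A)"
      by (simp add: ennreal_eq_0_iff not_le)
  qed
  also have "\<dots> \<longleftrightarrow> A \<in> null_sets M"
    using AE_iff_null_sets[of A M] by auto
  finally show "A \<in> null_sets (density M Z) \<longleftrightarrow> A \<in> null_sets M" .
qed

lemma borel_measurable_vec_nth [measurable (raw)]:
  fixes f :: "'a \<Rightarrow> real^'n"
  assumes "f \<in> borel_measurable N"
  shows "(\<lambda>\<omega>. f \<omega> $ i) \<in> borel_measurable N"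
  by (rule borel_measurable_continuous_on[OF _ assms]) (intro continuous_intros)

lemma borel_measurable_vec:
  fixes f :: "'a \<Rightarrow> real^'n"
  assumes "\<And>i. (\<lambda>\<omega>. f \<omega> $ i) \<in> borel_measurable N"
  shows "f \<in> borel_measurable N"
  unfolding borel_measurable_euclidean_space[of f]
  using assms by (auto simp: Basis_vec_def inner_axis)

text \<open>
  Vectors indexed by the orthants they lie in have 0 as a convex combination: mixing the two vectors whose
  indices differ only in one coordinate kills that coordinate and preserves the other signs. Doing this one
  coordinate at a time gives weights that are explicit, hence measurable, in the vectors.
\<close>

lemma orthant_weights:
  fixes v :: "'i set \<Rightarrow> 'a \<Rightarrow> 'i \<Rightarrow> real"
  assumes "finite I"
    and "\<And>\<sigma> i. \<sigma> \<subseteq> I \<Longrightarrow> (\<lambda>\<omega>. v \<sigma> \<omega> i) \<in> borel_measurable N"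
  shows "\<exists>w. (\<forall>\<sigma>. \<sigma> \<subseteq> I \<longrightarrow> w \<sigma> \<in> borel_measurable N) \<and>
    (\<forall>\<omega>. (\<forall>\<sigma>. \<sigma> \<subseteq> I \<longrightarrow> (\<forall>i\<in>I. if i \<in> \<sigma> then 0 < v \<sigma> \<omega> i else v \<sigma> \<omega> i < 0)) \<longrightarrow>
       (\<forall>\<sigma>. \<sigma> \<subseteq> I \<longrightarrow> 0 < w \<sigma> \<omega>) \<and> (\<Sum>\<sigma>\<in>Pow I. w \<sigma> \<omega>) = (1::real) \<and>
       (\<forall>i\<in>I. (\<Sum>\<sigma>\<in>Pow I. w \<sigma> \<omega> * v \<sigma> \<omega> i) = 0))"
  using assms
proof (induction I arbitrary: v rule: finite_induct)
  case empty
  show ?case by (rule exI[of _ "\<lambda>_ _. 1"]) auto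
next
  case (insert a I)
  \<comment> \<open>The segment from \<open>v \<sigma>\<close> to
    \<open>v (insert a \<sigma>)\<close> crosses the hyperplane on which coordinate \<open>a\<close>
    vanishes. \<open>\<alpha>\<close> is the weight of the first endpoint at the crossing point, and
    \<open>v'\<close> is that point.\<close>
  define \<alpha> where "\<alpha> \<sigma> \<omega> = v (insert a \<sigma>) \<omega> a / (v (insert a \<sigma>) \<omega> a - v \<sigma> \<omega> a)" for \<sigma> \<omega>
  define v' where "v' \<sigma> \<omega> i = \<alpha> \<sigma> \<omega> * v \<sigma> \<omega> i + (1 - \<alpha> \<sigma> \<omega>) * v (insert a \<sigma>) \<omega> i" for \<sigma> \<omega> i
  have meas: "(\<lambda>\<omega>. v \<sigma> \<omega> i) \<in> borel_measurable N" "(\<lambda>\<omega>. v (insert a \<sigma>) \<omega> i) \<in> borel_measurable N"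
    if "\<sigma> \<subseteq> I" for \<sigma> i
    using that by (auto intro!: insert.prems)
  have a_meas: "\<alpha> \<sigma> \<in> borel_measurable N" if "\<sigma> \<subseteq> I" for \<sigma>
    unfolding \<alpha>_def[abs_def] using meas[OF that] by measurable
  have v'_meas: "(\<lambda>\<omega>. v' \<sigma> \<omega> i) \<in> borel_measurable N" if "\<sigma> \<subseteq> I" for \<sigma> i
    unfolding v'_def[abs_def] using meas[OF that] a_meas[OF that] by measurable
  obtain w
    where w_meas: "\<forall>\<sigma>. \<sigma> \<subseteq> I \<longrightarrow> w \<sigma> \<in> borel_measurable N"
    and w: "\<forall>\<omega>. (\<forall>\<sigma>. \<sigma> \<subseteq> I \<longrightarrow> (\<forall>i\<in>I. if i \<in> \<sigma> then 0 < v' \<sigma> \<omega> i else v' \<sigma> \<omega> i < 0)) \<longrightarrow>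
       (\<forall>\<sigma>. \<sigma> \<subseteq> I \<longrightarrow> 0 < w \<sigma> \<omega>) \<and> (\<Sum>\<sigma>\<in>Pow I. w \<sigma> \<omega>) = (1::real) \<and>
       (\<forall>i\<in>I. (\<Sum>\<sigma>\<in>Pow I. w \<sigma> \<omega> * v' \<sigma> \<omega> i) = 0)"
    by (rule exE[OF insert.IH[of v']]) (rule v'_meas, assumption, elim conjE, rule that, assumption+)
  \<comment> \<open>The weight of each mixed vector is divided between its two endpoints in the
    ratio \<alpha> : 1 - \<alpha>, which leaves the total weight and the weighted sum
    unchanged.\<close>
  define W where "W \<sigma> \<omega> = (if a \<in> \<sigma> then (1 - \<alpha> (\<sigma> - {a}) \<omega>) * w (\<sigma> - {a}) \<omega> else \<alpha> \<sigma> \<omega> * w \<sigma> \<omega>)" for \<sigma> \<omega>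
  have split: "(\<Sum>\<sigma>\<in>Pow (insert a I). f \<sigma>) = (\<Sum>\<sigma>\<in>Pow I. f \<sigma> + f (insert a \<sigma>))" for f :: "'i set \<Rightarrow> real"
  proof -
    have "inj_on (insert a) (Pow I)"
      using insert.hyps by (auto simp: inj_on_def)
    moreover have "Pow I \<inter> insert a ` Pow I = {}"
      using insert.hyps by auto
    ultimately show ?thesis
      unfolding Pow_insert using insert.hyps
      by (subst sum.union_disjoint) (auto simp: sum.reindex sum.distrib)
  qed
  have W0: "W \<sigma> \<omega> = \<alpha> \<sigma> \<omega> * w \<sigma> \<omega>" "W (insert a \<sigma>) \<omega> = (1 - \<alpha> \<sigma> \<omega>) * w \<sigma> \<omega>" if "\<sigma> \<subseteq> I" for \<sigma> \<omega>
  proof -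
    have "a \<notin> \<sigma>" using that insert.hyps by auto
    then show "W \<sigma> \<omega> = \<alpha> \<sigma> \<omega> * w \<sigma> \<omega>" "W (insert a \<sigma>) \<omega> = (1 - \<alpha> \<sigma> \<omega>) * w \<sigma> \<omega>" by (auto simp: W_def)
  qed
  show ?case
  proof (intro exI[of _ W] conjI allI impI)
    fix \<sigma> assume "\<sigma> \<subseteq> insert a I"
    then have s: "\<sigma> - {a} \<subseteq> I" by auto
    show "W \<sigma> \<in> borel_measurable N"
    proof (cases "a \<in> \<sigma>")
      case True
      then show ?thesis
        unfolding W_def[abs_def] using a_meas[OF s] w_meas[rule_format, OF s] by simp
    next
      case False
      then have "\<sigma> - {a} = \<sigma>" by auto
      with False show ?thesis
        unfolding W_def[abs_def] using a_meas[OF s] w_meas[rule_format, OF s] by simp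
    qed
  next
    fix \<omega>
    assume "\<forall>\<sigma>. \<sigma> \<subseteq> insert a I \<longrightarrow> (\<forall>i\<in>insert a I. if i \<in> \<sigma> then 0 < v \<sigma> \<omega> i else v \<sigma> \<omega> i < 0)"
    then have orth: "if i \<in> \<sigma> then 0 < v \<sigma> \<omega> i else v \<sigma> \<omega> i < 0"
      if "\<sigma> \<subseteq> insert a I" "i \<in> insert a I" for \<sigma> i
      using that by blast
    have va: "v \<sigma> \<omega> a < 0" "0 < v (insert a \<sigma>) \<omega> a" if "\<sigma> \<subseteq> I" for \<sigma>
    proof -
      have "a \<notin> \<sigma>" "\<sigma> \<subseteq> insert a I" using that insert.hyps by auto
      then show "v \<sigma> \<omega> a < 0" using orth[of \<sigma> a] by auto
      show "0 < v (insert a \<sigma>) \<omega> a" using orth[of "insert a \<sigma>" a] that by auto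
    qed
    have a01: "0 < \<alpha> \<sigma> \<omega>" "\<alpha> \<sigma> \<omega> < 1" if "\<sigma> \<subseteq> I" for \<sigma>
      using va[OF that] by (auto simp: \<alpha>_def divide_simps)
    have v'a: "v' \<sigma> \<omega> a = 0" if "\<sigma> \<subseteq> I" for \<sigma>
      using va[OF that] by (auto simp: v'_def \<alpha>_def field_simps)
    have "\<forall>\<sigma>. \<sigma> \<subseteq> I \<longrightarrow> (\<forall>i\<in>I. if i \<in> \<sigma> then 0 < v' \<sigma> \<omega> i else v' \<sigma> \<omega> i < 0)"
    proof (intro allI impI ballI)
      fix \<sigma> i assume that: "\<sigma> \<subseteq> I" "i \<in> I"
      have "i \<noteq> a" "\<sigma> \<subseteq> insert a I" using that insert.hyps by auto
      with orth[of \<sigma> i] orth[of "insert a \<sigma>" i] that a01[OF that(1)]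
      show "if i \<in> \<sigma> then 0 < v' \<sigma> \<omega> i else v' \<sigma> \<omega> i < 0"
        unfolding v'_def
        by (auto intro!: add_pos_pos add_neg_neg mult_pos_pos mult_pos_neg split: if_splits)
    qed
    from w[rule_format, OF this[rule_format]] have w: "\<And>\<sigma>. \<sigma> \<subseteq> I \<Longrightarrow> 0 < w \<sigma> \<omega>" "(\<Sum>\<sigma>\<in>Pow I. w \<sigma> \<omega>) = 1"
      "\<And>i. i \<in> I \<Longrightarrow> (\<Sum>\<sigma>\<in>Pow I. w \<sigma> \<omega> * v' \<sigma> \<omega> i) = 0" by auto
    show "0 < W \<sigma> \<omega>" if "\<sigma> \<subseteq> insert a I" for \<sigma>
    proof (cases "a \<in> \<sigma>")
      case True
      have "\<sigma> - {a} \<subseteq> I" using that by auto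
      with True show ?thesis using a01[of "\<sigma> - {a}"] w(1)[of "\<sigma> - {a}"] by (auto simp: W_def)
    next
      case False
      then have "\<sigma> \<subseteq> I" using that by auto
      with False show ?thesis using a01[of \<sigma>] w(1)[of \<sigma>] by (auto simp: W_def)
    qed
    have "(\<Sum>\<sigma>\<in>Pow (insert a I). W \<sigma> \<omega>) = (\<Sum>\<sigma>\<in>Pow I. w \<sigma> \<omega>)"
      unfolding split by (rule sum.cong) (auto simp: W0 algebra_simps)
    with w show "(\<Sum>\<sigma>\<in>Pow (insert a I). W \<sigma> \<omega>) = 1" by simp
    have *: "(\<Sum>\<sigma>\<in>Pow (insert a I). W \<sigma> \<omega> * v \<sigma> \<omega> i) = (\<Sum>\<sigma>\<in>Pow I. w \<sigma> \<omega> * v' \<sigma> \<omega> i)" for i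
      unfolding split by (rule sum.cong) (auto simp: W0 v'_def algebra_simps)
    show "\<forall>i\<in>insert a I. (\<Sum>\<sigma>\<in>Pow (insert a I). W \<sigma> \<omega> * v \<sigma> \<omega> i) = 0"
      unfolding * using w(3) v'a by auto
  qed
qed

text \<open>For nonnegative functions the integrals of \<open>f * g\<close> and of \<open>f\<close>
  times the conditional expectation of \<open>g\<close> agree in [0, \<infinity>] without any
  integrability assumption, so finiteness of the second gives integrability of the product. This is
  needed for coefficients that contain the reciprocal of a conditional probability and are therefore
  unbounded.\<close>

lemma (in finite_measure) cond_exp_mult_integrable:
  fixes f g :: "'a \<Rightarrow> real"
  assumes sub: "subalgebra M G" and f: "f \<in> borel_measurable G" "\<And>\<omega>. 0 \<le> f \<omega>"
    and g: "integrable M g" "\<And>\<omega>. 0 \<le> g \<omega>"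
    and int: "integrable M (\<lambda>\<omega>. f \<omega> * real_cond_exp M G g \<omega>)"
  shows "integrable M (\<lambda>\<omega>. f \<omega> * g \<omega>)"
proof -
  interpret G: finite_measure_subalgebra M G
    by unfold_locales (rule sub)
  have [measurable]: "f \<in> borel_measurable M" "g \<in> borel_measurable M"
    using measurable_from_subalg[OF sub f(1)] g by auto
  note f(1)[measurable]
  have pos: "AE \<omega> in M. 0 \<le> real_cond_exp M G g \<omega>"
    by (rule G.real_cond_exp_pos) (auto simp: g)
  have "AE \<omega> in M. ennreal (real_cond_exp M G g \<omega>) = nn_cond_exp M G (\<lambda>\<omega>. ennreal (g \<omega>)) \<omega>"
  proof (rule G.nn_cond_exp_charact)
    fix B assume B: "B \<in> sets G"
    then have BM: "B \<in> sets M" using sub by (auto simp: subalgebra_def)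
    have 1: "integrable M (\<lambda>\<omega>. g \<omega> * indicator B \<omega>)" "integrable M (\<lambda>\<omega>. real_cond_exp M G g \<omega> * indicator B
        \<omega>)"
      using g(1) G.real_cond_exp_int(1)[OF g(1)] BM by (auto intro: integrable_real_mult_indicator)
    have "(\<integral>\<^sup>+\<omega>\<in>B. ennreal (g \<omega>) \<partial>M) = (\<integral>\<^sup>+\<omega>. ennreal (g \<omega> * indicator B \<omega>) \<partial>M)"
      by (rule nn_integral_cong) (auto split: split_indicator)
    also have "\<dots> = ennreal (LINT \<omega>|M. g \<omega> * indicator B \<omega>)"
      by (rule nn_integral_eq_integral[OF 1(1)]) (auto simp: g)
    also have "(LINT \<omega>|M. g \<omega> * indicator B \<omega>) = (LINT \<omega>|M. real_cond_exp M G g \<omega> * indicator B \<omega>)"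
      using G.real_cond_exp_intA[OF g(1) B] by (simp add: set_lebesgue_integral_def mult.commute)
    also have "ennreal \<dots> = (\<integral>\<^sup>+\<omega>. ennreal (real_cond_exp M G g \<omega> * indicator B \<omega>) \<partial>M)"
      by (rule nn_integral_eq_integral[OF 1(2), symmetric]) (use pos in \<open>auto split: split_indicator\<close>)
    also have "\<dots> = (\<integral>\<^sup>+\<omega>\<in>B. ennreal (real_cond_exp M G g \<omega>) \<partial>M)"
      by (rule nn_integral_cong) (auto split: split_indicator)
    finally show "(\<integral>\<^sup>+\<omega>\<in>B. ennreal (g \<omega>) \<partial>M) = (\<integral>\<^sup>+\<omega>\<in>B. ennreal (real_cond_exp M G g \<omega>) \<partial>M)" .
  qed auto
  then have "(\<integral>\<^sup>+\<omega>. ennreal (f \<omega>) * ennreal (real_cond_exp M G g \<omega>) \<partial>M)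
      = (\<integral>\<^sup>+\<omega>. ennreal (f \<omega>) * nn_cond_exp M G (\<lambda>\<omega>. ennreal (g \<omega>)) \<omega> \<partial>M)"
    by (intro nn_integral_cong_AE) auto
  also have "\<dots> = (\<integral>\<^sup>+\<omega>. ennreal (f \<omega>) * ennreal (g \<omega>) \<partial>M)"
    by (rule G.nn_cond_exp_intg) auto
  finally have "(\<integral>\<^sup>+\<omega>. ennreal (f \<omega> * g \<omega>) \<partial>M) = (\<integral>\<^sup>+\<omega>. ennreal (f \<omega> * real_cond_exp M G g \<omega>) \<partial>M)"
    using f(2) g(2) by (simp add: ennreal_mult')
  also have "\<dots> < \<infinity>"
    using integrableD(2)[OF int] by (simp add: less_top)
  finally show ?thesis
    using f(2) g(2) by (intro integrableI_nonneg) auto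
qed

text \<open>\<open>A\<close> is divided into cells \<open>D \<sigma>\<close>, contained in
  \<open>E\<close> and lying in the orthant \<open>\<sigma>\<close> with margin \<open>r\<close>,
  and a remainder \<open>R\<close>. Conditionally on \<open>G\<close>, the remainder is given little
  mass and causes only a small drift, while the conditional means on the cells lie at depth at least
  \<open>r\<close> in all orthants, so a convex combination of them cancels the drift. The
  hypothesis \<open>supp\<close> expresses by sets alone that each cell has positive conditional
  probability on \<open>A\<close>.\<close>

lemma martingale_step:
  fixes Q G :: "'a measure" and \<Delta> :: "'a \<Rightarrow> real^'n" and r :: "'a \<Rightarrow> real"
  assumes "prob_space Q" and sub: "subalgebra Q G" and A: "A \<in> sets G" and E: "E \<in> sets Q"
    and \<Delta>_meas: "\<Delta> \<in> borel_measurable Q" and r_meas: "r \<in> borel_measurable G"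
    and r: "\<And>\<omega>. \<omega> \<in> space Q \<Longrightarrow> 0 < r \<omega> \<and> r \<omega> \<le> 1"
    and \<Delta>1: "\<And>\<omega>. \<omega> \<in> space Q \<Longrightarrow> norm (\<Delta> \<omega>) \<le> 1"
    and \<Delta>0: "\<And>\<omega>. \<omega> \<in> space Q - A \<Longrightarrow> \<Delta> \<omega> = 0"
    and supp: "\<And>\<sigma> B. B \<in> sets G \<Longrightarrow> B \<subseteq> A \<Longrightarrow> emeasure Q B \<noteq> 0 \<Longrightarrow>
      emeasure Q {\<omega> \<in> B \<inter> E. \<forall>i. if i \<in> \<sigma> then r \<omega> \<le> \<Delta> \<omega> $ i else \<Delta> \<omega> $ i \<le> - r \<omega>} \<noteq> 0"
  shows "\<exists>\<rho>. \<rho> \<in> borel_measurable Q \<and> (\<forall>\<omega>\<in>space Q. 0 < \<rho> \<omega>) \<and> (\<forall>\<omega>. \<omega> \<notin> A \<longrightarrow> \<rho> \<omega> = (1::real)) \<and>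
     (\<forall>B\<in>sets G. emeasure (density Q \<rho>) B = emeasure Q B) \<and>
     (\<forall>B\<in>sets G. \<forall>i. (LINT \<omega>:B|density Q \<rho>. \<Delta> \<omega> $ i) = 0) \<and>
     emeasure (density Q \<rho>) (A - E) \<le> ennreal (1/8) * emeasure Q A"
proof -
  interpret prob_space Q by fact
  interpret G: finite_measure_subalgebra Q G
    by unfold_locales (rule sub)
  have GQ: "B \<in> sets Q" if "B \<in> sets G" for B
    using sub that by (auto simp: subalgebra_def)
  have fromG: "f \<in> borel_measurable Q" if "f \<in> borel_measurable G" for f :: "'a \<Rightarrow> real"
    using measurable_from_subalg[OF sub that] .
  have spG: "space G = space Q" using sub by (simp add: subalgebra_def)
  have [measurable]: "A \<in> sets Q" "A \<in> sets G" using A GQ by auto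
  have [measurable]: "r \<in> borel_measurable Q" "r \<in> borel_measurable G"
      by (rule fromG[OF r_meas]) (rule r_meas)
  note E[measurable] \<Delta>_meas[measurable]
  have \<Delta>i: "\<bar>\<Delta> \<omega> $ i\<bar> \<le> 1" if "\<omega> \<in> space Q" for \<omega> i
    using component_le_norm_cart[of "\<Delta> \<omega>" i] \<Delta>1[OF that] by linarith
  define D where "D \<sigma> = {\<omega> \<in> A \<inter> E. \<forall>i. if i \<in> \<sigma> then r \<omega> \<le> \<Delta> \<omega> $ i else \<Delta> \<omega> $ i \<le> - r \<omega>}" for \<sigma>
  have [measurable]: "D \<sigma> \<in> sets Q" for \<sigma>
  proof -
    have 1: "{\<omega> \<in> space Q. if i \<in> \<sigma> then r \<omega> \<le> \<Delta> \<omega> $ i else \<Delta> \<omega> $ i \<le> - r \<omega>} \<in> sets Q" for i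
      by (cases "i \<in> \<sigma>") (simp, measurable)+
    have "D \<sigma> = A \<inter> E \<inter> (\<Inter>i. {\<omega> \<in> space Q. if i \<in> \<sigma> then r \<omega> \<le> \<Delta> \<omega> $ i else \<Delta> \<omega> $ i \<le> - r \<omega>})"
      unfolding D_def using sets.sets_into_space[OF E] by auto
    also have "\<dots> \<in> sets Q"
      by (intro sets.Int sets.finite_INT 1) auto
    finally show ?thesis .
  qed
  define R where "R = A - (\<Union>\<sigma>. D \<sigma>)"
  have [measurable]: "R \<in> sets Q" unfolding R_def by measurable
  have int1: "integrable Q g" if "g \<in> borel_measurable Q" "\<And>\<omega>. \<omega> \<in> space Q \<Longrightarrow> \<bar>g \<omega>\<bar> \<le> 1" for g :: "'a \<Rightarrow> real"
    by (rule integrable_const_bound[of _ 1]) (use that in auto)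
  define p where "p \<sigma> = real_cond_exp Q G (indicator (D \<sigma>))" for \<sigma>
  define y where "y \<sigma> i = real_cond_exp Q G (\<lambda>\<omega>. indicator (D \<sigma>) \<omega> * \<Delta> \<omega> $ i)" for \<sigma> i
  define \<beta> where "\<beta> = real_cond_exp Q G (indicator R)"
  define b where "b i = real_cond_exp Q G (\<lambda>\<omega>. indicator R \<omega> * \<Delta> \<omega> $ i)" for i
  \<comment> \<open>The new density is \<open>\<gamma>\<close> on \<open>R\<close>. This is so small that the resulting drift \<open>\<gamma> b\<close> can be absorbed by the
    conditional means on the cells \<open>D \<sigma>\<close> without leaving the orthants.\<close>
  define \<gamma> where "\<gamma> \<omega> = r \<omega> / 8" for \<omega>
  define \<kappa> where "\<kappa> \<omega> = 1 - \<gamma> \<omega> * \<beta> \<omega>" for \<omega>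
  have [measurable]: "p \<sigma> \<in> borel_measurable G" "y \<sigma> i \<in> borel_measurable G" "\<beta> \<in> borel_measurable G"
    "b i \<in> borel_measurable G" "\<gamma> \<in> borel_measurable G" "\<kappa> \<in> borel_measurable G" for \<sigma> i
    unfolding p_def y_def \<beta>_def b_def \<kappa>_def[abs_def] \<gamma>_def[abs_def] by measurable
  have intD: "integrable Q (indicat_real (D \<sigma>))" "integrable Q (\<lambda>\<omega>. indicator (D \<sigma>) \<omega> * \<Delta> \<omega> $ i)"
    "integrable Q (\<lambda>\<omega>. r \<omega> * indicator (D \<sigma>) \<omega>)" "integrable Q (\<lambda>\<omega>. - r \<omega> * indicator (D \<sigma>) \<omega>)" for \<sigma> i
    by (auto intro!: int1 split: split_indicator simp: \<Delta>i) (use r in force)+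
  have intR: "integrable Q (indicat_real R)" "integrable Q (\<lambda>\<omega>. indicator R \<omega> * \<Delta> \<omega> $ i)" for i
    by (auto intro!: int1 split: split_indicator simp: \<Delta>i)
  have p_pos: "AE \<omega> in Q. \<omega> \<in> A \<longrightarrow> 0 < p \<sigma> \<omega>" for \<sigma>
  proof -
    \<comment> \<open>If \<open>B\<close> were not null, \<open>supp\<close> would give
      \<open>D \<sigma>\<close> positive mass in \<open>B\<close>, but the integral of
      \<open>p \<sigma>\<close> over \<open>B\<close>, which is that mass, is at most 0.\<close>
    define B where "B = {\<omega> \<in> space G. \<omega> \<in> A \<and> p \<sigma> \<omega> \<le> 0}"
    have BG [measurable]: "B \<in> sets G" unfolding B_def by measurable
    have "measure Q (D \<sigma> \<inter> B) = (LINT \<omega>:B|Q. indicator (D \<sigma>) \<omega>)"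
      using GQ[OF BG] by (simp add: set_lebesgue_integral_def indicator_inter_arith[symmetric] Int_commute)
    also have "\<dots> = (LINT \<omega>:B|Q. p \<sigma> \<omega>)"
      unfolding p_def by (rule G.real_cond_exp_intA[OF intD(1) BG])
    also have "\<dots> \<le> 0"
    proof -
      have "0 \<le> (LINT \<omega>|Q. - (indicator B \<omega> *\<^sub>R p \<sigma> \<omega>))"
        by (rule integral_nonneg_AE) (auto simp: B_def split: split_indicator)
      then show ?thesis by (simp add: set_lebesgue_integral_def)
    qed
    finally have "measure Q (D \<sigma> \<inter> B) = 0" by (simp add: measure_le_0_iff)
    then have "emeasure Q (D \<sigma> \<inter> B) = 0" by (simp add: emeasure_eq_measure)
    also have "D \<sigma> \<inter> B = {\<omega> \<in> B \<inter> E. \<forall>i. if i \<in> \<sigma> then r \<omega> \<le> \<Delta> \<omega> $ i else \<Delta> \<omega> $ i \<le> - r \<omega>}"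
      unfolding D_def B_def by auto
    finally have "emeasure Q B = 0"
      using supp[OF BG, of \<sigma>] by (auto simp: B_def)
    then have "AE \<omega> in Q. \<omega> \<notin> B"
      by (intro AE_not_in) (auto simp: null_sets_def GQ)
    then show ?thesis
      using AE_space by eventually_elim (auto simp: B_def spG)
  qed
  have y_bd: "AE \<omega> in Q. if i \<in> \<sigma> then r \<omega> * p \<sigma> \<omega> \<le> y \<sigma> i \<omega> else y \<sigma> i \<omega> \<le> - r \<omega> * p \<sigma> \<omega>" for i \<sigma>
  proof (cases "i \<in> \<sigma>")
    case True
    have "AE \<omega> in Q. real_cond_exp Q G (\<lambda>\<omega>. r \<omega> * indicator (D \<sigma>) \<omega>) \<omega> \<le> y \<sigma> i \<omega>"
      unfolding y_def by (rule G.real_cond_exp_mono[OF _ intD(3) intD(2)]) (use True in \<open>auto simp: D_def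
          split: split_indicator\<close>)
    moreover have "AE \<omega> in Q. real_cond_exp Q G (\<lambda>\<omega>. r \<omega> * indicator (D \<sigma>) \<omega>) \<omega> = r \<omega> * p \<sigma> \<omega>"
      unfolding p_def by (rule G.real_cond_exp_mult[OF _ _ intD(3)]) auto
    ultimately show ?thesis using True by auto
  next
    case False
    have "AE \<omega> in Q. y \<sigma> i \<omega> \<le> real_cond_exp Q G (\<lambda>\<omega>. - r \<omega> * indicator (D \<sigma>) \<omega>) \<omega>"
      unfolding y_def by (rule G.real_cond_exp_mono[OF _ intD(2) intD(4)]) (use False in \<open>auto simp: D_def
          split: split_indicator\<close>)
    moreover have "AE \<omega> in Q. real_cond_exp Q G (\<lambda>\<omega>. - r \<omega> * indicator (D \<sigma>) \<omega>) \<omega> = - r \<omega> * p \<sigma> \<omega>"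
      unfolding p_def by (rule G.real_cond_exp_mult[OF _ _ intD(4)]) auto
    ultimately show ?thesis using False by auto
  qed
  have \<beta>_bd: "AE \<omega> in Q. 0 \<le> \<beta> \<omega> \<and> \<beta> \<omega> \<le> 1"
    unfolding \<beta>_def using G.real_cond_exp_ge_c[OF intR(1), of 0] G.real_cond_exp_le_c[OF intR(1), of 1]
    by (auto split: split_indicator)
  have b_bd: "AE \<omega> in Q. - 1 \<le> b i \<omega> \<and> b i \<omega> \<le> 1" for i
  proof -
    have "\<bar>indicator R \<omega> * \<Delta> \<omega> $ i\<bar> \<le> 1" if "\<omega> \<in> space Q" for \<omega>
      using \<Delta>i[OF that, of i] by (auto split: split_indicator)
    then have "AE \<omega> in Q. - 1 \<le> indicator R \<omega> * \<Delta> \<omega> $ i" "AE \<omega> in Q. indicator R \<omega> * \<Delta> \<omega> $ i \<le> 1"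
      by (auto intro!: AE_I2 simp: abs_le_iff)
    then show ?thesis
      unfolding b_def using G.real_cond_exp_ge_c[OF intR(2), of "-1"] G.real_cond_exp_le_c[OF intR(2), of _ 1]
      by auto
  qed
  \<comment> \<open>\<open>y \<sigma> i / p \<sigma>\<close> is the conditional mean on a cell. The
    remainder will have conditional mass \<open>\<gamma> \<beta>\<close>, so the cells share the
    mass \<open>\<kappa>\<close> and the drift \<open>\<gamma> b\<close> amounts to
    \<open>\<gamma> b / \<kappa>\<close> per unit of it. Weights with sum 1 that annihilate
    \<open>v\<close> make the total conditional mean 0.\<close>
  define v where "v \<sigma> \<omega> i = y \<sigma> i \<omega> / p \<sigma> \<omega> + \<gamma> \<omega> * b i \<omega> / \<kappa> \<omega>" for \<sigma> \<omega> i
  have v_meas: "(\<lambda>\<omega>. v \<sigma> \<omega> i) \<in> borel_measurable G" for \<sigma> i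
    unfolding v_def[abs_def] by measurable
  obtain w where w_meas: "\<forall>\<sigma>. \<sigma> \<subseteq> UNIV \<longrightarrow> w \<sigma> \<in> borel_measurable G"
    and w: "\<forall>\<omega>. (\<forall>\<sigma>. \<sigma> \<subseteq> UNIV \<longrightarrow> (\<forall>i\<in>UNIV. if i \<in> \<sigma> then 0 < v \<sigma> \<omega> i else v \<sigma> \<omega> i < 0)) \<longrightarrow>
       (\<forall>\<sigma>. \<sigma> \<subseteq> UNIV \<longrightarrow> 0 < w \<sigma> \<omega>) \<and> (\<Sum>\<sigma>\<in>Pow (UNIV::'n set). w \<sigma> \<omega>) = (1::real) \<and>
       (\<forall>i\<in>UNIV. (\<Sum>\<sigma>\<in>Pow UNIV. w \<sigma> \<omega> * v \<sigma> \<omega> i) = 0)"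
    by (rule exE[OF orthant_weights[of UNIV v G]]) (simp, rule v_meas, elim conjE, rule that, assumption+)
  have [measurable]: "w \<sigma> \<in> borel_measurable G" for \<sigma> using w_meas by auto
  \<comment> \<open>The almost sure inequalities are collected in a \<open>G\<close>-measurable
    subset of \<open>A\<close> of full measure in \<open>A\<close>. The density is changed only
    there, so that the algebra below holds pointwise.\<close>
  define C where "C = {\<omega> \<in> space G. \<omega> \<in> A \<and> (\<forall>\<sigma>. 0 < p \<sigma> \<omega> \<and> 0 < w \<sigma> \<omega>) \<and> 0 < \<kappa> \<omega> \<and> \<kappa> \<omega> \<le> 1 \<and>
    (\<Sum>\<sigma>\<in>UNIV. w \<sigma> \<omega>) = 1 \<and> (\<forall>i. (\<Sum>\<sigma>\<in>UNIV. w \<sigma> \<omega> * v \<sigma> \<omega> i) = 0)}"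
  have CG [measurable]: "C \<in> sets G"
    unfolding C_def using v_meas by measurable
  have [measurable]: "C \<in> sets Q" using GQ CG by auto
  have AC: "AE \<omega> in Q. \<omega> \<in> A \<longrightarrow> \<omega> \<in> C"
  proof -
    have ae: "AE \<omega> in Q. (\<forall>\<sigma>\<in>UNIV. \<omega> \<in> A \<longrightarrow> 0 < p \<sigma> \<omega>) \<and> (\<forall>i\<in>UNIV. \<forall>\<sigma>\<in>UNIV. if i \<in> \<sigma> then r \<omega> * p \<sigma> \<omega>
        \<le> y \<sigma> i \<omega> else y \<sigma> i \<omega> \<le> - r \<omega> * p \<sigma> \<omega>)
       \<and> (0 \<le> \<beta> \<omega> \<and> \<beta> \<omega> \<le> 1) \<and> (\<forall>i\<in>UNIV. - 1 \<le> b i \<omega> \<and> b i \<omega> \<le> 1)"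
      by (intro AE_conjI AE_finite_allI finite p_pos y_bd \<beta>_bd b_bd)
    show ?thesis
      using ae AE_space
    proof eventually_elim
      case (elim \<omega>)
      show ?case
      proof
        assume "\<omega> \<in> A"
        have r01: "0 < r \<omega>" "r \<omega> \<le> 1" using r elim by auto
        have p0: "0 < p \<sigma> \<omega>" for \<sigma> using elim \<open>\<omega> \<in> A\<close> by auto
        have \<beta>01: "0 \<le> \<beta> \<omega>" "\<beta> \<omega> \<le> 1" and b1: "\<bar>b i \<omega>\<bar> \<le> 1" for i
          using elim by (auto simp: abs_le_iff)
        have y: "if i \<in> \<sigma> then r \<omega> * p \<sigma> \<omega> \<le> y \<sigma> i \<omega> else y \<sigma> i \<omega> \<le> - r \<omega> * p \<sigma> \<omega>" for i \<sigma>
          using elim by blast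
        have "0 \<le> \<gamma> \<omega> * \<beta> \<omega>" "\<gamma> \<omega> * \<beta> \<omega> \<le> 1/8 * 1"
          using \<beta>01 r01 by (auto simp: \<gamma>_def intro!: mult_le_one)
        then have k: "7/8 \<le> \<kappa> \<omega>" "\<kappa> \<omega> \<le> 1" by (auto simp: \<kappa>_def)
        \<comment> \<open>The shift is at most (r/8) / (7/8) = r/7 in absolute value, less than the
          depth r of the cell means, so no coordinate changes its sign.\<close>
        have small: "\<bar>\<gamma> \<omega> * b i \<omega> / \<kappa> \<omega>\<bar> < r \<omega>" for i
        proof -
          have "\<bar>\<gamma> \<omega> * b i \<omega>\<bar> \<le> r \<omega> / 8 * 1"
            unfolding abs_mult using b1[of i] r01 by (intro mult_mono) (auto simp: \<gamma>_def)
          also have "\<dots> < r \<omega> * (7/8)" using r01 by simp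
          also have "\<dots> \<le> r \<omega> * \<kappa> \<omega>" using r01 k by (intro mult_left_mono) auto
          finally show ?thesis using k by (simp add: abs_divide divide_less_eq)
        qed
        have small': "- r \<omega> < \<gamma> \<omega> * b i \<omega> / \<kappa> \<omega>" "\<gamma> \<omega> * b i \<omega> / \<kappa> \<omega> < r \<omega>" for i
          using small[of i] by linarith+
        have "if i \<in> \<sigma> then 0 < v \<sigma> \<omega> i else v \<sigma> \<omega> i < 0" for \<sigma> i
        proof (cases "i \<in> \<sigma>")
          case True
          then have "r \<omega> * p \<sigma> \<omega> \<le> y \<sigma> i \<omega>" using y[of i \<sigma>] by simp
          then have "r \<omega> \<le> y \<sigma> i \<omega> / p \<sigma> \<omega>" using p0[of \<sigma>] by (simp add: field_simps)
          with small'[of i] True show ?thesis by (simp add: v_def)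
        next
          case False
          then have "y \<sigma> i \<omega> \<le> - r \<omega> * p \<sigma> \<omega>" using y[of i \<sigma>] by simp
          then have "y \<sigma> i \<omega> / p \<sigma> \<omega> \<le> - r \<omega>" using p0[of \<sigma>] by (simp add: field_simps)
          with small'[of i] False show ?thesis by (simp add: v_def)
        qed
        with w[rule_format, of \<omega>] p0 k \<open>\<omega> \<in> A\<close> elim show "\<omega> \<in> C"
          unfolding C_def spG by auto
      qed
    qed
  qed
  \<comment> \<open>With this density the cell \<open>D \<sigma>\<close> receives conditional mass
    \<open>c \<sigma> * p \<sigma>\<close>, that is \<open>\<kappa> * w \<sigma>\<close>.\<close>
  define c where "c \<sigma> \<omega> = \<kappa> \<omega> * w \<sigma> \<omega> / p \<sigma> \<omega>" for \<sigma> \<omega>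
  have [measurable]: "c \<sigma> \<in> borel_measurable G" for \<sigma>
    unfolding c_def[abs_def] by measurable
  have [measurable]: "c \<sigma> \<in> borel_measurable Q" "\<gamma> \<in> borel_measurable Q" "w \<sigma> \<in> borel_measurable Q"
    "\<kappa> \<in> borel_measurable Q" "p \<sigma> \<in> borel_measurable Q" for \<sigma>
    by (rule fromG; measurable)+
  have c_pos: "0 < c \<sigma> \<omega>" if "\<omega> \<in> C" for \<omega> \<sigma>
    using that by (auto simp: C_def c_def)
  define \<rho> where "\<rho> \<omega> = (if \<omega> \<in> C then \<gamma> \<omega> * indicator R \<omega> + (\<Sum>\<sigma>\<in>UNIV. c \<sigma> \<omega> * indicator (D \<sigma>) \<omega>) else 1)"
      for \<omega>
  have \<rho>_meas [measurable]: "\<rho> \<in> borel_measurable Q"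
    unfolding \<rho>_def[abs_def] by measurable
  have \<rho>_pos: "0 < \<rho> \<omega>" if "\<omega> \<in> space Q" for \<omega>
  proof (cases "\<omega> \<in> C")
    case True
    then have c0: "0 < c \<sigma> \<omega>" for \<sigma> by (auto simp: C_def c_def)
    have g0: "0 < \<gamma> \<omega>" using r[OF that] by (auto simp: \<gamma>_def)
    consider "\<omega> \<in> R" | \<sigma> where "\<omega> \<in> D \<sigma>" using True by (auto simp: C_def R_def)
    then show ?thesis
    proof cases
      case 1
      have "0 \<le> (\<Sum>\<sigma>\<in>UNIV. c \<sigma> \<omega> * indicator (D \<sigma>) \<omega>)"
        by (intro sum_nonneg mult_nonneg_nonneg) (auto simp: less_imp_le[OF c0])
      then show ?thesis using 1 g0 True by (auto simp: \<rho>_def)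
    next
      case (2 \<sigma>)
      have "c \<sigma> \<omega> * indicator (D \<sigma>) \<omega> \<le> (\<Sum>\<sigma>\<in>UNIV. c \<sigma> \<omega> * indicator (D \<sigma>) \<omega>)"
        by (rule member_le_sum) (auto simp: less_imp_le[OF c0])
      then have "0 < (\<Sum>\<sigma>\<in>UNIV. c \<sigma> \<omega> * indicator (D \<sigma>) \<omega>)" using 2 c0[of \<sigma>] by simp
      then show ?thesis using g0 True by (auto simp: \<rho>_def intro!: add_nonneg_pos)
    qed
  qed (auto simp: \<rho>_def)
  \<comment> \<open>\<open>c \<sigma>\<close> has no bound, since \<open>p \<sigma>\<close> may be
    arbitrarily small, but the product with \<open>p \<sigma>\<close> is at most 1 on
    \<open>C\<close>. This is the integrability required by
    \<open>cond_exp_mult_integrable\<close>.\<close>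
  have int_wk: "integrable Q (\<lambda>\<omega>. indicator (B \<inter> C) \<omega> * c \<sigma> \<omega> * p \<sigma> \<omega>)" if B: "B \<in> sets G" for B \<sigma>
  proof (rule int1)
    note GQ[OF B, measurable]
    show "(\<lambda>\<omega>. indicator (B \<inter> C) \<omega> * c \<sigma> \<omega> * p \<sigma> \<omega>) \<in> borel_measurable Q" by measurable
    fix \<omega>
    show "\<bar>indicator (B \<inter> C) \<omega> * c \<sigma> \<omega> * p \<sigma> \<omega>\<bar> \<le> 1"
    proof (cases "\<omega> \<in> B \<inter> C")
      case True
      then have *: "0 < p \<sigma> \<omega>" "0 < w \<sigma> \<omega>" "0 < \<kappa> \<omega>" "\<kappa> \<omega> \<le> 1" "(\<Sum>\<sigma>\<in>UNIV. w \<sigma> \<omega>) = 1" "\<And>\<sigma>. 0 < w \<sigma> \<omega>"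
        by (auto simp: C_def)
      have "w \<sigma> \<omega> \<le> (\<Sum>\<sigma>\<in>UNIV. w \<sigma> \<omega>)" by (rule member_le_sum) (auto simp: less_imp_le[OF *(6)])
      with * have "w \<sigma> \<omega> \<le> 1" by simp
      then have "\<bar>\<kappa> \<omega> * w \<sigma> \<omega>\<bar> \<le> 1" using *(2,3,4) by (simp add: abs_mult mult_le_one)
      then show ?thesis using True *(1) by (simp add: c_def)
    qed auto
  qed
  \<comment> \<open>Since the coefficients of \<open>\<rho>\<close> are \<open>G\<close>-measurable,
    integrals against \<open>\<rho>\<close> over sets of \<open>G\<close> reduce to conditional
    expectations on \<open>R\<close> and on the cells. The choice \<open>g = 1\<close> yields
    preservation of mass, and a coordinate of \<open>\<Delta>\<close> yields zero drift.\<close>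
  have key: "integrable Q (\<lambda>\<omega>. \<rho> \<omega> * (indicator B \<omega> * g \<omega>)) \<and>
      (LINT \<omega>|Q. \<rho> \<omega> * (indicator B \<omega> * g \<omega>)) = (LINT \<omega>|Q. indicator (B - C) \<omega> * g \<omega>) +
        (LINT \<omega>|Q. indicator (B \<inter> C) \<omega> * (\<gamma> \<omega> * real_cond_exp Q G (\<lambda>\<omega>. indicator R \<omega> * g \<omega>) \<omega> +
           (\<Sum>\<sigma>\<in>UNIV. c \<sigma> \<omega> * real_cond_exp Q G (\<lambda>\<omega>. indicator (D \<sigma>) \<omega> * g \<omega>) \<omega>)))"
    if B: "B \<in> sets G" and g: "g \<in> borel_measurable Q" "\<And>\<omega>. \<omega> \<in> space Q \<Longrightarrow> \<bar>g \<omega>\<bar> \<le> 1" for B and g ::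
        "'a \<Rightarrow> real"
  proof -
    note [measurable] = B GQ[OF B] g(1)
    have i0: "integrable Q (\<lambda>\<omega>. indicator (B - C) \<omega> * g \<omega>)"
      by (rule int1) (auto split: split_indicator simp: g)
    have i1: "integrable Q (\<lambda>\<omega>. (indicator (B \<inter> C) \<omega> * \<gamma> \<omega>) * (indicator R \<omega> * g \<omega>))"
    proof (rule int1)
      fix \<omega> assume "\<omega> \<in> space Q"
      then have "\<bar>\<gamma> \<omega>\<bar> \<le> 1" "\<bar>g \<omega>\<bar> \<le> 1" using r[of \<omega>] g(2) by (auto simp: \<gamma>_def)
      then show "\<bar>indicator (B \<inter> C) \<omega> * \<gamma> \<omega> * (indicator R \<omega> * g \<omega>)\<bar> \<le> 1"
        by (auto simp: abs_mult intro!: mult_le_one split: split_indicator)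
    qed measurable
    have i2': "integrable Q (\<lambda>\<omega>. (indicator (B \<inter> C) \<omega> * c \<sigma> \<omega>) * indicator (D \<sigma>) \<omega>)" for \<sigma>
    proof (rule cond_exp_mult_integrable[OF sub])
      show "integrable Q (\<lambda>\<omega>. indicator (B \<inter> C) \<omega> * c \<sigma> \<omega> * real_cond_exp Q G (indicator (D \<sigma>)) \<omega>)"
        using int_wk[OF B, of \<sigma>] unfolding p_def .
      show "(\<lambda>\<omega>. indicator (B \<inter> C) \<omega> * c \<sigma> \<omega>) \<in> borel_measurable G" by measurable
      show "0 \<le> indicator (B \<inter> C) \<omega> * c \<sigma> \<omega>" for \<omega>
        using c_pos[of \<omega> \<sigma>] by (cases "\<omega> \<in> C") auto
    qed (simp_all add: intD)
    have i2: "integrable Q (\<lambda>\<omega>. (indicator (B \<inter> C) \<omega> * c \<sigma> \<omega>) * (indicator (D \<sigma>) \<omega> * g \<omega>))" for \<sigma>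
    proof (rule Bochner_Integration.integrable_bound[OF i2'[of \<sigma>]])
      show "AE \<omega> in Q. norm (indicator (B \<inter> C) \<omega> * c \<sigma> \<omega> * (indicator (D \<sigma>) \<omega> * g \<omega>)) \<le> norm (indicator (B
          \<inter> C) \<omega> * c \<sigma> \<omega> * indicator (D \<sigma>) \<omega>)"
        using g(2) by (intro AE_I2) (auto simp: abs_mult mult_left_le split: split_indicator)
    qed measurable
    have eq: "\<rho> \<omega> * (indicator B \<omega> * g \<omega>) = indicator (B - C) \<omega> * g \<omega> + (indicator (B \<inter> C) \<omega> * \<gamma> \<omega>) *
        (indicator R \<omega> * g \<omega>)
        + (\<Sum>\<sigma>\<in>UNIV. (indicator (B \<inter> C) \<omega> * c \<sigma> \<omega>) * (indicator (D \<sigma>) \<omega> * g \<omega>))" for \<omega>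
    proof (cases "\<omega> \<in> B")
      case True
      then show ?thesis
        by (cases "\<omega> \<in> C")
          (simp_all add: \<rho>_def distrib_right sum_distrib_right mult.assoc del: sum_mult_indicator)
    qed auto
    have c1: "integrable Q (\<lambda>\<omega>. (indicator (B \<inter> C) \<omega> * \<gamma> \<omega>) * real_cond_exp Q G (\<lambda>\<omega>. indicator R \<omega> * g \<omega>) \<omega>)"
       "(LINT \<omega>|Q. (indicator (B \<inter> C) \<omega> * \<gamma> \<omega>) * real_cond_exp Q G (\<lambda>\<omega>. indicator R \<omega> * g \<omega>) \<omega>)
           = (LINT \<omega>|Q. (indicator (B \<inter> C) \<omega> * \<gamma> \<omega>) * (indicator R \<omega> * g \<omega>))"
      by (rule G.real_cond_exp_intg[OF i1]; measurable)+
    have c2: "integrable Q (\<lambda>\<omega>. (indicator (B \<inter> C) \<omega> * c \<sigma> \<omega>) * real_cond_exp Q G (\<lambda>\<omega>. indicator (D \<sigma>) \<omega> * g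
        \<omega>) \<omega>)"
       "(LINT \<omega>|Q. (indicator (B \<inter> C) \<omega> * c \<sigma> \<omega>) * real_cond_exp Q G (\<lambda>\<omega>. indicator (D \<sigma>) \<omega> * g \<omega>) \<omega>)
           = (LINT \<omega>|Q. (indicator (B \<inter> C) \<omega> * c \<sigma> \<omega>) * (indicator (D \<sigma>) \<omega> * g \<omega>))" for \<sigma>
      by (rule G.real_cond_exp_intg[OF i2]; measurable)+
    have "(\<lambda>\<omega>. indicator (B \<inter> C) \<omega> * (\<gamma> \<omega> * real_cond_exp Q G (\<lambda>\<omega>. indicator R \<omega> * g \<omega>) \<omega> +
           (\<Sum>\<sigma>\<in>UNIV. c \<sigma> \<omega> * real_cond_exp Q G (\<lambda>\<omega>. indicator (D \<sigma>) \<omega> * g \<omega>) \<omega>))) =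
        (\<lambda>\<omega>. (indicator (B \<inter> C) \<omega> * \<gamma> \<omega>) * real_cond_exp Q G (\<lambda>\<omega>. indicator R \<omega> * g \<omega>) \<omega> +
        (\<Sum>\<sigma>\<in>UNIV. (indicator (B \<inter> C) \<omega> * c \<sigma> \<omega>) * real_cond_exp Q G (\<lambda>\<omega>. indicator (D \<sigma>) \<omega> * g \<omega>) \<omega>))"
      by (auto simp: algebra_simps sum_distrib_left)
    then show ?thesis
      unfolding eq using i0 i1 i2 c1 c2 by simp
  qed
  have mass: "emeasure (density Q \<rho>) B = emeasure Q B" if B: "B \<in> sets G" for B
  proof -
    note [measurable] = B GQ[OF B]
    have k: "integrable Q (\<lambda>\<omega>. \<rho> \<omega> * indicator B \<omega>)"
      "(LINT \<omega>|Q. \<rho> \<omega> * indicator B \<omega>) = (LINT \<omega>|Q. indicator (B - C) \<omega>) +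
        (LINT \<omega>|Q. indicator (B \<inter> C) \<omega> * (\<gamma> \<omega> * \<beta> \<omega> + (\<Sum>\<sigma>\<in>UNIV. c \<sigma> \<omega> * p \<sigma> \<omega>)))"
      using key[OF B, of "\<lambda>_. 1"] unfolding \<beta>_def p_def by auto
    have "indicator (B \<inter> C) \<omega> * (\<gamma> \<omega> * \<beta> \<omega> + (\<Sum>\<sigma>\<in>UNIV. c \<sigma> \<omega> * p \<sigma> \<omega>)) = indicat_real (B \<inter> C) \<omega>" for \<omega>
    proof (cases "\<omega> \<in> C")
      case True
      then have "p \<sigma> \<omega> \<noteq> 0" for \<sigma> by (auto simp: C_def less_imp_neq[symmetric])
      then have "(\<Sum>\<sigma>\<in>UNIV. c \<sigma> \<omega> * p \<sigma> \<omega>) = \<kappa> \<omega> * (\<Sum>\<sigma>\<in>UNIV. w \<sigma> \<omega>)"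
        by (simp add: c_def sum_distrib_left)
      also have "\<dots> = \<kappa> \<omega>" using True by (simp add: C_def)
      finally show ?thesis by (simp add: \<kappa>_def)
    qed auto
    with k(2) have "(LINT \<omega>|Q. \<rho> \<omega> * indicator B \<omega>) = measure Q (B - C) + measure Q (B \<inter> C)"
      by simp
    also have "\<dots> = measure Q B"
      by (subst finite_measure_Union[symmetric]) (auto intro!: arg_cong[of _ _ "measure Q"])
    finally have m: "(LINT \<omega>|Q. \<rho> \<omega> * indicator B \<omega>) = measure Q B" .
    have "emeasure (density Q \<rho>) B = (\<integral>\<^sup>+\<omega>. ennreal (\<rho> \<omega> * indicator B \<omega>) \<partial>Q)"
      by (subst emeasure_density) (auto intro!: nn_integral_cong split: split_indicator)
    also have "\<dots> = ennreal (LINT \<omega>|Q. \<rho> \<omega> * indicator B \<omega>)"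
      by (rule nn_integral_eq_integral[OF k(1)]) (auto intro!: AE_I2 mult_nonneg_nonneg less_imp_le[OF \<rho>_pos])
    finally show ?thesis using m by (simp add: emeasure_eq_measure)
  qed
  have mart: "(LINT \<omega>:B|density Q \<rho>. \<Delta> \<omega> $ i) = 0" if B: "B \<in> sets G" for B i
  proof -
    note [measurable] = B GQ[OF B]
    have z: "indicator (B \<inter> C) \<omega> * (\<gamma> \<omega> * b i \<omega> + (\<Sum>\<sigma>\<in>UNIV. c \<sigma> \<omega> * y \<sigma> i \<omega>)) = 0" for \<omega>
    proof (cases "\<omega> \<in> C")
      case True
      then have *: "0 < \<kappa> \<omega>" "(\<Sum>\<sigma>\<in>UNIV. w \<sigma> \<omega>) = 1" "(\<Sum>\<sigma>\<in>UNIV. w \<sigma> \<omega> * v \<sigma> \<omega> i) = 0"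
        by (auto simp: C_def)
      have "0 = \<kappa> \<omega> * (\<Sum>\<sigma>\<in>UNIV. w \<sigma> \<omega> * v \<sigma> \<omega> i)" using * by simp
      also have "\<dots> = (\<Sum>\<sigma>\<in>UNIV. c \<sigma> \<omega> * y \<sigma> i \<omega> + w \<sigma> \<omega> * (\<gamma> \<omega> * b i \<omega>))"
        unfolding sum_distrib_left using *(1) by (intro sum.cong) (auto simp: v_def c_def field_simps)
      also have "\<dots> = (\<Sum>\<sigma>\<in>UNIV. c \<sigma> \<omega> * y \<sigma> i \<omega>) + \<gamma> \<omega> * b i \<omega>"
        by (simp add: sum.distrib sum_distrib_right[symmetric] *)
      finally show ?thesis by simp
    qed auto
    have "(LINT \<omega>:B|density Q \<rho>. \<Delta> \<omega> $ i) = (LINT \<omega>|Q. \<rho> \<omega> * (indicator B \<omega> * \<Delta> \<omega> $ i))"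
      unfolding set_lebesgue_integral_def
      by (subst integral_density) (auto intro!: AE_I2 less_imp_le[OF \<rho>_pos])
    also have "\<dots> = (LINT \<omega>|Q. indicator (B - C) \<omega> * \<Delta> \<omega> $ i) +
        (LINT \<omega>|Q. indicator (B \<inter> C) \<omega> * (\<gamma> \<omega> * b i \<omega> + (\<Sum>\<sigma>\<in>UNIV. c \<sigma> \<omega> * y \<sigma> i \<omega>)))"
      using key[OF B, of "\<lambda>\<omega>. \<Delta> \<omega> $ i"] \<Delta>i unfolding b_def y_def by auto
    \<comment> \<open>Outside \<open>C\<close> almost every point lies outside \<open>A\<close>,
      where \<open>\<Delta>\<close> vanishes.\<close>
    also have "(LINT \<omega>|Q. indicator (B - C) \<omega> * \<Delta> \<omega> $ i) = 0"
      by (rule integral_eq_zero_AE) (use AC \<Delta>0 in \<open>auto split: split_indicator\<close>)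
    finally show ?thesis by (simp add: z)
  qed
  have "emeasure (density Q \<rho>) (A - E) = (\<integral>\<^sup>+\<omega>. ennreal (\<rho> \<omega>) * indicator (A - E) \<omega> \<partial>Q)"
    by (rule emeasure_density) auto
  also have "\<dots> \<le> (\<integral>\<^sup>+\<omega>. ennreal (1/8) * indicator A \<omega> \<partial>Q)"
  proof (rule nn_integral_mono_AE)
    show "AE \<omega> in Q. ennreal (\<rho> \<omega>) * indicator (A - E) \<omega> \<le> ennreal (1/8) * indicator A \<omega>"
      using AC AE_space
    proof eventually_elim
      case (elim \<omega>)
      show ?case
      proof (cases "\<omega> \<in> A - E")
        case True
        \<comment> \<open>All cells lie inside \<open>E\<close>, so on \<open>A - E\<close> only the
          remainder contributes and the density is \<open>\<gamma>\<close>, at most 1/8.\<close>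
        then have "\<omega> \<in> C" "\<omega> \<in> R" "\<And>\<sigma>. \<omega> \<notin> D \<sigma>" using elim by (auto simp: R_def D_def)
        then have "\<rho> \<omega> = \<gamma> \<omega>" by (simp add: \<rho>_def)
        also have "\<dots> \<le> 1/8" using r elim by (simp add: \<gamma>_def)
        finally show ?thesis using True by (auto intro!: ennreal_leI)
      qed auto
    qed
  qed
  also have "\<dots> = ennreal (1/8) * emeasure Q A"
    by (rule nn_integral_cmult_indicator) auto
  finally have "emeasure (density Q \<rho>) (A - E) \<le> ennreal (1/8) * emeasure Q A" .
  then show ?thesis
    using \<rho>_meas \<rho>_pos mass mart by (intro exI[of _ \<rho>]) (auto simp: \<rho>_def C_def)
qed

section \<open>Stopping times\<close>

text \<open>\<open>insert b\<close> caps the time and keeps the infimum over a nonempty set. Strict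
  positivity allows a reduction to rational times for continuous \<open>f\<close>, but only events
  of the form {\<tau> < t} are obtained directly; right continuity of the filtration compensates for
  this in \<open>stoppingI_less\<close>.\<close>

definition first_pos :: "real \<Rightarrow> real \<Rightarrow> (real \<Rightarrow> real) \<Rightarrow> real" where
  "first_pos a b f = Inf (insert b {u \<in> {a..b}. 0 < f u})"

lemma first_pos_bounds:
  assumes "a \<le> b"
  shows "a \<le> first_pos a b f" "first_pos a b f \<le> b"
proof -
  have "bdd_below (insert b {u \<in> {a..b}. 0 < f u})"
    by (rule bdd_belowI[of _ a]) (use assms in auto)
  then show "a \<le> first_pos a b f" "first_pos a b f \<le> b"
    unfolding first_pos_def using assms by (auto intro!: cInf_greatest cInf_lower)
qed

lemma first_pos_less_iff:
  assumes "a \<le> b" "c \<le> b"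
  shows "first_pos a b f < c \<longleftrightarrow> (\<exists>u. a \<le> u \<and> u < c \<and> 0 < f u)"
proof -
  have "bdd_below (insert b {u \<in> {a..b}. 0 < f u})"
    by (rule bdd_belowI[of _ a]) (use assms in auto)
  then have "first_pos a b f < c \<longleftrightarrow> (\<exists>u\<in>insert b {u \<in> {a..b}. 0 < f u}. u < c)"
    unfolding first_pos_def by (intro cInf_less_iff) auto
  with assms show ?thesis by auto
qed

text \<open>Positivity of a continuous function persists on a short interval to the right of
  \<open>u\<close>, which contains a rational. This turns existence of a time into a countable
  union.\<close>

lemma rational_between_pos:
  fixes f :: "real \<Rightarrow> real"
  assumes f: "continuous_on {a..b} f" and u: "a \<le> u" "u < c" "c \<le> b" "0 < f u"
  shows "\<exists>q\<in>\<rat>. u < q \<and> q < c \<and> 0 < f q"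
proof -
  have "continuous (at u within {a..b}) f"
    using f u by (auto simp: continuous_on_eq_continuous_within)
  then have "\<forall>\<^sub>F x in at u within {a..b}. 0 < f x"
    using u(4) by (auto simp: continuous_within intro: order_tendstoD)
  then obtain d where d: "0 < d" "\<And>x. x \<in> {a..b} \<Longrightarrow> x \<noteq> u \<Longrightarrow> dist x u < d \<Longrightarrow> 0 < f x"
    by (auto simp: eventually_at)
  obtain q where "q \<in> \<rat>" "u < q" "q < min c (u + d)"
    using Rats_dense_in_real[of u "min c (u + d)"] u d by auto
  with d(2)[of q] u show ?thesis by (intro bexI[of _ q]) (auto simp: dist_real_def)
qed

text \<open>A positive value at \<open>u > a\<close> would be preceded by positive values shortly
  before \<open>u\<close>, so even the endpoint \<open>first_pos a b f\<close> is covered. The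
  hypothesis at \<open>a\<close> handles the case that the infimum is \<open>a\<close>
  itself.\<close>

lemma first_pos_nonpos:
  assumes "a \<le> b" and f: "continuous_on {a..b} f" and "f a \<le> 0" and u: "a \<le> u" "u \<le> first_pos a b f"
  shows "f u \<le> 0"
proof (rule ccontr)
  assume pos: "\<not> f u \<le> 0"
  have ub: "u \<le> b" using first_pos_bounds(2)[OF assms(1), of f] u by linarith
  have "a < u" using assms(3) pos u(1) by (cases "a = u") auto
  have "continuous (at u within {a..b}) f"
    using f u ub by (auto simp: continuous_on_eq_continuous_within)
  then have "\<forall>\<^sub>F x in at u within {a..b}. 0 < f x"
    using pos by (auto simp: continuous_within intro: order_tendstoD)
  then obtain d where d: "0 < d" "\<And>x. x \<in> {a..b} \<Longrightarrow> x \<noteq> u \<Longrightarrow> dist x u < d \<Longrightarrow> 0 < f x"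
    by (auto simp: eventually_at)
  define x where "x = max a (u - d/2)"
  have "0 < f x" "a \<le> x" "x < u" using \<open>a < u\<close> d(1) ub by (auto simp: x_def dist_real_def intro!: d(2))
  then have "first_pos a b f < u"
    using first_pos_less_iff[OF assms(1) ub] by auto
  with u show False by simp
qed

text \<open>Below \<open>b\<close> the infimum is a limit of points with positive values or such a
  point itself, so \<open>f\<close> cannot be negative there. This is what keeps the exit times from
  accumulating in \<open>tau_reaches\<close>.\<close>

lemma first_pos_nonneg:
  assumes "a \<le> b" and f: "continuous_on {a..b} f" and "first_pos a b f < b"
  shows "0 \<le> f (first_pos a b f)"
proof (rule ccontr)
  let ?s = "first_pos a b f"
  assume neg: "\<not> 0 \<le> f ?s"
  have s: "a \<le> ?s" using first_pos_bounds[OF assms(1)] by auto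
  have "continuous (at ?s within {a..b}) f"
    using f s assms(3) by (auto simp: continuous_on_eq_continuous_within)
  then have "\<forall>\<^sub>F x in at ?s within {a..b}. f x < 0"
    using neg by (auto simp: continuous_within intro: order_tendstoD)
  then obtain d where d: "0 < d" "\<And>x. x \<in> {a..b} \<Longrightarrow> x \<noteq> ?s \<Longrightarrow> dist x ?s < d \<Longrightarrow> f x < 0"
    by (auto simp: eventually_at)
  have "?s < min b (?s + d)" using assms(3) d by auto
  then obtain u where u: "a \<le> u" "u < min b (?s + d)" "0 < f u"
    using first_pos_less_iff[OF assms(1), of "min b (?s + d)" f] by auto
  have "\<not> u < ?s"
    using first_pos_less_iff[OF assms(1), of ?s f] first_pos_bounds(2)[OF assms(1), of f] u(1,3) by auto
  moreover have "u \<noteq> ?s" using u(3) neg by auto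
  ultimately show False using d(2)[of u] u by (auto simp: dist_real_def)
qed

section \<open>Stopping times, stopped sigma-algebras and measurability of sampled processes\<close>

locale filtered_space = prob_space M for M :: "'a measure" +
  fixes T :: real and F :: "real \<Rightarrow> 'a measure"
  assumes T_pos: "0 < T" and filtration: "filtration_on M T F" and usual: "usual_conditions M T F"
begin

lemma subalgebra_F: "t \<in> {0..T} \<Longrightarrow> subalgebra M (F t)"
  using filtration by (auto simp: filtration_on_def)

lemma space_F: "t \<in> {0..T} \<Longrightarrow> space (F t) = space M"
  using subalgebra_F by (auto simp: subalgebra_def)

lemma sets_F_subset: "t \<in> {0..T} \<Longrightarrow> A \<in> sets (F t) \<Longrightarrow> A \<in> sets M"
  using subalgebra_F by (auto simp: subalgebra_def)

lemma sets_F_mono: "0 \<le> s \<Longrightarrow> s \<le> t \<Longrightarrow> t \<le> T \<Longrightarrow> A \<in> sets (F s) \<Longrightarrow> A \<in> sets (F t)"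
  using filtration by (auto simp: filtration_on_def)

lemma sets_F_T: "sets (F T) = sets M"
  using filtration by (auto simp: filtration_on_def)

lemma subalgebra_F_F: "0 \<le> s \<Longrightarrow> s \<le> t \<Longrightarrow> t \<le> T \<Longrightarrow> subalgebra (F t) (F s)"
  using sets_F_mono space_F[of s] space_F[of t] by (auto simp: subalgebra_def)

lemma measurable_F_mono: "0 \<le> s \<Longrightarrow> s \<le> t \<Longrightarrow> t \<le> T \<Longrightarrow> f \<in> measurable (F s) N \<Longrightarrow> f \<in> measurable (F t) N"
  by (rule measurable_from_subalg[OF subalgebra_F_F])

definition stopping :: "('a \<Rightarrow> real) \<Rightarrow> bool" where
  "stopping \<tau> \<longleftrightarrow> (\<forall>\<omega>\<in>space M. 0 \<le> \<tau> \<omega> \<and> \<tau> \<omega> \<le> T) \<and> (\<forall>t\<in>{0..T}. {\<omega>\<in>space M. \<tau> \<omega> \<le> t} \<in> sets (F t))"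

text \<open>The generating family is itself a sigma-algebra when \<open>\<tau>\<close> is a stopping
  time (\<open>sets_F_at\<close>); \<open>sigma\<close> only packages it as a measure.\<close>

definition F_at :: "('a \<Rightarrow> real) \<Rightarrow> 'a measure" where
  "F_at \<tau> = sigma (space M) {A \<in> sets M. \<forall>t\<in>{0..T}. {\<omega>\<in>A. \<tau> \<omega> \<le> t} \<in> sets (F t)}"

lemma stopping_bounds: "stopping \<tau> \<Longrightarrow> \<omega> \<in> space M \<Longrightarrow> 0 \<le> \<tau> \<omega> \<and> \<tau> \<omega> \<le> T"
  by (auto simp: stopping_def)

lemma stopping_le_sets: "stopping \<tau> \<Longrightarrow> 0 \<le> t \<Longrightarrow> t \<le> T \<Longrightarrow> {\<omega>\<in>space M. \<tau> \<omega> \<le> t} \<in> sets (F t)"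
  by (auto simp: stopping_def)

lemma stopping_zero: "stopping (\<lambda>_. 0)"
  unfolding stopping_def
proof (intro conjI ballI)
  fix t assume t: "t \<in> {0..T}"
  then have "{\<omega> \<in> space M. 0 \<le> t} = space (F t)" using space_F[OF t] by auto
  then show "{\<omega> \<in> space M. 0 \<le> t} \<in> sets (F t)" by simp
qed (use T_pos in auto)

text \<open>For every u > t the event {\<tau> \<le> t} is the intersection of the events {\<tau> < s
  m} for times \<open>s m\<close> in (t, u] tending to t, so it lies in \<open>F u\<close>; right
  continuity then puts it into \<open>F t\<close>.\<close>

lemma stoppingI_less:
  assumes bd: "\<And>\<omega>. \<omega> \<in> space M \<Longrightarrow> 0 \<le> \<tau> \<omega> \<and> \<tau> \<omega> \<le> T"
    and less: "\<And>t. 0 < t \<Longrightarrow> t \<le> T \<Longrightarrow> {\<omega>\<in>space M. \<tau> \<omega> < t} \<in> sets (F t)"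
  shows "stopping \<tau>"
  unfolding stopping_def
proof (intro conjI ballI)
  fix t assume t: "t \<in> {0..T}"
  show "{\<omega>\<in>space M. \<tau> \<omega> \<le> t} \<in> sets (F t)"
  proof (cases "t = T")
    case True
    then have "{\<omega>\<in>space M. \<tau> \<omega> \<le> t} = space (F t)" using bd space_F[OF t] by auto
    then show ?thesis by simp
  next
    case False
    with t have tT: "0 \<le> t" "t < T" by auto
    have "{\<omega>\<in>space M. \<tau> \<omega> \<le> t} \<in> sets (F u)" if u: "u \<in> {t<..T}" for u
    proof -
      define s where "s m = t + (u - t) / Suc m" for m :: nat
      have s: "t < s m" "s m \<le> u" for m
        using u mult_left_mono[of 1 "1 + real m" "u - t"] by (auto simp: s_def field_simps)
      have lim: "s \<longlonglongrightarrow> t"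
        unfolding s_def by (rule tendsto_eq_intros lim_const_over_n[THEN LIMSEQ_Suc] refl | simp)+
      have "{\<omega>\<in>space M. \<tau> \<omega> \<le> t} = (\<Inter>m. {\<omega>\<in>space M. \<tau> \<omega> < s m})"
      proof (intro equalityI subsetI)
        fix \<omega> assume "\<omega> \<in> (\<Inter>m. {\<omega>\<in>space M. \<tau> \<omega> < s m})"
        then have "\<omega> \<in> space M" "\<And>m. \<tau> \<omega> \<le> s m" by (auto simp: less_imp_le)
        then show "\<omega> \<in> {\<omega>\<in>space M. \<tau> \<omega> \<le> t}" using LIMSEQ_le_const[OF lim, of "\<tau> \<omega>"] by auto
      qed (use s in \<open>auto intro: le_less_trans\<close>)
      also have "\<dots> \<in> sets (F u)"
      proof (intro sets.countable_INT)
        show "range (\<lambda>m. {\<omega>\<in>space M. \<tau> \<omega> < s m}) \<subseteq> sets (F u)"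
        proof safe
          fix m
          have "0 < s m" using s(1)[of m] tT by simp
          then show "{\<omega>\<in>space M. \<tau> \<omega> < s m} \<in> sets (F u)"
            using s[of m] u by (intro sets_F_mono[of "s m" u] less) auto
        qed
      qed auto
      finally show ?thesis .
    qed
    then show ?thesis using usual tT by (auto simp: usual_conditions_def)
  qed
qed (use bd in auto)

lemma sets_F_at:
  assumes "stopping \<tau>"
  shows "sets (F_at \<tau>) = {A \<in> sets M. \<forall>t\<in>{0..T}. {\<omega>\<in>A. \<tau> \<omega> \<le> t} \<in> sets (F t)}" (is "_ = ?S")
proof -
  have "sigma_algebra (space M) ?S"
  proof (rule sigma_algebra_iff2[THEN iffD2], intro conjI ballI allI impI)
    show "?S \<subseteq> Pow (space M)" using sets.sets_into_space by auto
    show "{} \<in> ?S" by auto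
    fix A assume A: "A \<in> ?S"
    have "{\<omega> \<in> space M - A. \<tau> \<omega> \<le> t} = {\<omega>\<in>space M. \<tau> \<omega> \<le> t} - {\<omega>\<in>A. \<tau> \<omega> \<le> t}" for t by auto
    then show "space M - A \<in> ?S"
      using A stopping_le_sets[OF assms] by (auto intro!: sets.Diff)
  next
    fix A :: "nat \<Rightarrow> 'a set" assume A: "range A \<subseteq> ?S"
    have "{\<omega> \<in> (\<Union>i. A i). \<tau> \<omega> \<le> t} = (\<Union>i. {\<omega> \<in> A i. \<tau> \<omega> \<le> t})" for t by auto
    then show "(\<Union>i. A i) \<in> ?S" using A by (auto intro!: sets.countable_UN)
  qed
  then show ?thesis
    unfolding F_at_def by (simp add: sigma_algebra.sets_measure_of_eq)
qed

lemma space_F_at: "space (F_at \<tau>) = space M"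
  by (simp add: F_at_def space_measure_of_conv)

lemma subalgebra_F_at: "stopping \<tau> \<Longrightarrow> subalgebra M (F_at \<tau>)"
  by (auto simp: subalgebra_def space_F_at sets_F_at)

lemma F_at_le_sets: "stopping \<tau> \<Longrightarrow> A \<in> sets (F_at \<tau>) \<Longrightarrow> 0 \<le> t \<Longrightarrow> t \<le> T \<Longrightarrow> {\<omega>\<in>A. \<tau> \<omega> \<le> t} \<in> sets (F t)"
  by (auto simp: sets_F_at)

lemma sets_F_at_mono:
  assumes "stopping \<sigma>" "stopping \<tau>" and le: "\<And>\<omega>. \<omega> \<in> space M \<Longrightarrow> \<sigma> \<omega> \<le> \<tau> \<omega>" and A: "A \<in> sets (F_at \<sigma>)"
  shows "A \<in> sets (F_at \<tau>)"
  unfolding sets_F_at[OF assms(2)]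
proof (safe)
  show AM: "A \<in> sets M" using A by (auto simp: sets_F_at[OF assms(1)])
  fix t assume t: "t \<in> {0..T}"
  have "{\<omega>\<in>A. \<tau> \<omega> \<le> t} = {\<omega>\<in>A. \<sigma> \<omega> \<le> t} \<inter> {\<omega>\<in>space M. \<tau> \<omega> \<le> t}"
    using le sets.sets_into_space[OF AM] by (auto intro: order_trans)
  also have "\<dots> \<in> sets (F t)"
    using t by (auto intro!: sets.Int F_at_le_sets[OF assms(1) A] stopping_le_sets[OF assms(2)])
  finally show "{\<omega>\<in>A. \<tau> \<omega> \<le> t} \<in> sets (F t)" .
qed

text \<open>Up to time s \<le> t nothing of the event has {\<tau> \<le> s}, and after t both
  constituents are known. It brings events of a deterministic time into the stopped sigma-algebra,
  as needed for the intermediate times in \<open>Y_near\<close>.\<close>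

lemma F_at_greaterI:
  assumes "stopping \<tau>" and t: "0 \<le> t" "t \<le> T" and A: "A \<in> sets (F t)"
  shows "{\<omega>\<in>A. t < \<tau> \<omega>} \<in> sets (F_at \<tau>)"
proof -
  have AM: "A \<subseteq> space M" using A t sets.sets_into_space[OF sets_F_subset[of t A]] by auto
  have 1: "{\<omega>\<in>A. t < \<tau> \<omega>} = A - {\<omega>\<in>space M. \<tau> \<omega> \<le> t}" using AM by auto
  have 2: "{\<omega>\<in>A. t < \<tau> \<omega>} \<in> sets (F t)"
    unfolding 1 using A stopping_le_sets[OF assms(1) t] by auto
  show ?thesis
    unfolding sets_F_at[OF assms(1)]
  proof safe
    show "{\<omega>\<in>A. t < \<tau> \<omega>} \<in> sets M" using 2 t by (auto intro: sets_F_subset[of t])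
    fix s assume s: "s \<in> {0..T}"
    show "{\<omega>\<in>{\<omega>\<in>A. t < \<tau> \<omega>}. \<tau> \<omega> \<le> s} \<in> sets (F s)"
    proof (cases "s \<le> t")
      case True
      then have "{\<omega>\<in>{\<omega>\<in>A. t < \<tau> \<omega>}. \<tau> \<omega> \<le> s} = {}" by auto
      then show ?thesis by (metis sets.empty_sets)
    next
      case False
      have "{\<omega>\<in>{\<omega>\<in>A. t < \<tau> \<omega>}. \<tau> \<omega> \<le> s} = {\<omega>\<in>A. t < \<tau> \<omega>} \<inter> {\<omega>\<in>space M. \<tau> \<omega> \<le> s}"
        using AM by auto
      also have "\<dots> \<in> sets (F s)"
        using False s t 2 by (auto intro!: sets.Int sets_F_mono[of t s] stopping_le_sets[OF assms(1)])
      finally show ?thesis .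
    qed
  qed
qed

lemma min_stopping_measurable:
  assumes "stopping \<tau>" "0 \<le> t" "t \<le> T"
  shows "(\<lambda>\<omega>. min (\<tau> \<omega>) t) \<in> borel_measurable (F t)"
  unfolding borel_measurable_iff_le
proof
  fix a :: real
  have sp: "space (F t) = space M" using assms by (intro space_F) auto
  consider "t \<le> a" | "a < 0" | "0 \<le> a" "a < t" by linarith
  then show "{\<omega>\<in>space (F t). min (\<tau> \<omega>) t \<le> a} \<in> sets (F t)"
  proof cases
    case 1
    then have "{\<omega>\<in>space (F t). min (\<tau> \<omega>) t \<le> a} = space (F t)" by auto
    then show ?thesis by simp
  next
    case 2
    then have "{\<omega>\<in>space (F t). min (\<tau> \<omega>) t \<le> a} = {}"
      using assms(2) stopping_bounds[OF assms(1)] by (force simp: sp)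
    then show ?thesis by (metis sets.empty_sets)
  next
    case 3
    then have "{\<omega>\<in>space (F t). min (\<tau> \<omega>) t \<le> a} = {\<omega>\<in>space M. \<tau> \<omega> \<le> a}" by (auto simp: sp)
    then show ?thesis
      using sets_F_mono[of a t, OF 3(1) less_imp_le[OF 3(2)] assms(3) stopping_le_sets[OF assms(1), of a]] 3
          assms(3)
      by simp
  qed
qed

text \<open>On {\<tau> \<le> t} the sampled value is that at \<open>min (\<tau> \<omega>) t\<close>,
  so it suffices that the latter be known at time t.\<close>

lemma measurable_F_at:
  fixes X :: "real \<Rightarrow> 'a \<Rightarrow> 'b::topological_space"
  assumes "stopping \<tau>"
    and X: "\<And>t. 0 \<le> t \<Longrightarrow> t \<le> T \<Longrightarrow> (\<lambda>\<omega>. X (min (\<tau> \<omega>) t) \<omega>) \<in> borel_measurable (F t)"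
  shows "(\<lambda>\<omega>. X (\<tau> \<omega>) \<omega>) \<in> borel_measurable (F_at \<tau>)"
proof (rule measurableI)
  fix B :: "'b set" assume B: "B \<in> sets borel"
  have 1: "{\<omega> \<in> (\<lambda>\<omega>. X (\<tau> \<omega>) \<omega>) -` B \<inter> space M. \<tau> \<omega> \<le> t} \<in> sets (F t)" if t: "0 \<le> t" "t \<le> T" for t
  proof -
    have "{\<omega> \<in> (\<lambda>\<omega>. X (\<tau> \<omega>) \<omega>) -` B \<inter> space M. \<tau> \<omega> \<le> t} =
       (\<lambda>\<omega>. X (min (\<tau> \<omega>) t) \<omega>) -` B \<inter> space (F t) \<inter> {\<omega>\<in>space M. \<tau> \<omega> \<le> t}"
      using t space_F[of t] by (auto simp: min_def)
    also have "\<dots> \<in> sets (F t)"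
      by (intro sets.Int measurable_sets[OF X[OF t] B] stopping_le_sets[OF assms(1) t])
    finally show ?thesis .
  qed
  have "{\<omega> \<in> (\<lambda>\<omega>. X (\<tau> \<omega>) \<omega>) -` B \<inter> space M. \<tau> \<omega> \<le> T} = (\<lambda>\<omega>. X (\<tau> \<omega>) \<omega>) -` B \<inter> space M"
    using stopping_bounds[OF assms(1)] by auto
  with 1[of T] T_pos have "(\<lambda>\<omega>. X (\<tau> \<omega>) \<omega>) -` B \<inter> space M \<in> sets M"
    by (simp add: sets_F_T)
  with 1 show "(\<lambda>\<omega>. X (\<tau> \<omega>) \<omega>) -` B \<inter> space (F_at \<tau>) \<in> sets (F_at \<tau>)"
    by (auto simp: sets_F_at[OF assms(1)] space_F_at)
qed auto

lemma stopping_measurable: "stopping \<tau> \<Longrightarrow> \<tau> \<in> borel_measurable (F_at \<tau>)"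
  by (rule measurable_F_at[of \<tau> "\<lambda>s _. s"]) (auto intro: min_stopping_measurable)

text \<open>The random time is approximated from above by times with countably many values, and
  continuity of the paths gives the limit.\<close>

lemma measurable_continuous_min_stopping:
  fixes X :: "real \<Rightarrow> 'a \<Rightarrow> 'b::metric_space"
  assumes "stopping \<tau>" and X: "adapted_on T F X"
    and cont: "\<And>\<omega>. \<omega> \<in> space M \<Longrightarrow> continuous_on {0..T} (\<lambda>t. X t \<omega>)"
    and t: "0 \<le> t" "t \<le> T"
  shows "(\<lambda>\<omega>. X (min (\<tau> \<omega>) t) \<omega>) \<in> borel_measurable (F t)"
proof -
  \<comment> \<open>Rounding up to the grid of mesh 1/(m+1) approximates the time; the outer minimum
    prevents looking beyond t.\<close>
  define c where "c m \<omega> = min t (real_of_int \<lceil>real (Suc m) * min (\<tau> \<omega>) t\<rceil> / real (Suc m))" for m \<omega>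
  note mt[measurable] = min_stopping_measurable[OF assms(1) t]
  have sp: "space (F t) = space M" using t by (intro space_F) auto
  show ?thesis
  proof (rule borel_measurable_LIMSEQ_metric)
    fix m
    \<comment> \<open>The two clamps produce a time in [0, t] for every integer \<open>k\<close>, as
      composition over all integers requires. At the values that occur, the lower clamp has no
      effect.\<close>
    have 1: "X (min t (max 0 (real_of_int k / real (Suc m)))) \<in> borel_measurable (F t)" for k :: int
    proof -
      let ?s = "min t (max 0 (real_of_int k / real (Suc m)))"
      have s: "0 \<le> ?s" "?s \<le> t" using t by auto
      then have "X ?s \<in> borel_measurable (F ?s)" using X t by (auto simp: adapted_on_def)
      then show ?thesis using s t by (intro measurable_F_mono[of ?s t]) auto
    qed
    have "(\<lambda>\<omega>. X (min t (max 0 (real_of_int \<lceil>real (Suc m) * min (\<tau> \<omega>) t\<rceil> / real (Suc m)))) \<omega>) \<in>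
        borel_measurable (F t)"
      by (rule measurable_compose_countable[OF 1]) measurable
    moreover have "max 0 (real_of_int \<lceil>real (Suc m) * min (\<tau> \<omega>) t\<rceil> / real (Suc m)) = real_of_int \<lceil>real (Suc m)
        * min (\<tau> \<omega>) t\<rceil> / real (Suc m)"
      if "\<omega> \<in> space M" for \<omega>
    proof -
      have "0 \<le> real (Suc m) * min (\<tau> \<omega>) t" using stopping_bounds[OF assms(1) that] t by auto
      then have "0 \<le> \<lceil>real (Suc m) * min (\<tau> \<omega>) t\<rceil>" by linarith
      then show ?thesis by (simp add: max_absorb2)
    qed
    ultimately show "(\<lambda>\<omega>. X (c m \<omega>) \<omega>) \<in> borel_measurable (F t)"
      unfolding c_def by (subst measurable_cong[where g="\<lambda>\<omega>. X (min t (max 0 (real_of_int \<lceil>real (Suc m) * min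
          (\<tau> \<omega>) t\<rceil> / real (Suc m)))) \<omega>"]) (auto simp: sp)
  next
    fix \<omega> assume "\<omega> \<in> space (F t)"
    then have w: "\<omega> \<in> space M" by (simp add: sp)
    let ?s = "min (\<tau> \<omega>) t"
    have s: "0 \<le> ?s" "?s \<le> t" using stopping_bounds[OF assms(1) w] t by auto
    have c: "?s \<le> c m \<omega>" "c m \<omega> \<le> ?s + 1 / real (Suc m)" "c m \<omega> \<le> t" for m
    proof -
      have "real (Suc m) * ?s \<le> real_of_int \<lceil>real (Suc m) * ?s\<rceil>" by linarith
      then have "?s \<le> real_of_int \<lceil>real (Suc m) * ?s\<rceil> / real (Suc m)" by (simp add: field_simps)
      then show "?s \<le> c m \<omega>" using s by (simp add: c_def)
      have "real_of_int \<lceil>real (Suc m) * ?s\<rceil> \<le> real (Suc m) * ?s + 1" by linarith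
      then have "real_of_int \<lceil>real (Suc m) * ?s\<rceil> / real (Suc m) \<le> (real (Suc m) * ?s + 1) / real (Suc m)"
        by (rule divide_right_mono) simp
      also have "\<dots> = ?s + 1 / real (Suc m)" by (simp add: add_divide_distrib)
      finally show "c m \<omega> \<le> ?s + 1 / real (Suc m)" by (auto simp: c_def)
      show "c m \<omega> \<le> t" by (simp add: c_def)
    qed
    have "(\<lambda>m. c m \<omega>) \<longlonglongrightarrow> ?s"
    proof (rule tendsto_sandwich[of "\<lambda>_. ?s" _ _ "\<lambda>m. ?s + 1 / real (Suc m)"])
      show "(\<lambda>m. ?s + 1 / real (Suc m)) \<longlonglongrightarrow> ?s"
        by (rule tendsto_eq_intros lim_const_over_n[THEN LIMSEQ_Suc] refl | simp)+
    qed (use c in auto)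
    moreover have "c m \<omega> \<in> {0..T}" for m
      using c(1)[of m] c(3)[of m] s(1) t by auto
    moreover have "?s \<in> {0..T}" using s t by auto
    ultimately show "(\<lambda>m. X (c m \<omega>) \<omega>) \<longlonglongrightarrow> X ?s \<omega>"
      by (intro continuous_on_tendsto_compose[OF cont[OF w]]) auto
  qed
qed

lemma measurable_progressive_min_stopping:
  assumes "stopping \<tau>" and X: "progressive_on T F X" and t: "0 \<le> t" "t \<le> T"
  shows "(\<lambda>\<omega>. X (min (\<tau> \<omega>) t) \<omega>) \<in> borel_measurable (F t)"
proof -
  have 1: "(\<lambda>(s, \<omega>). X s \<omega>) \<in> borel_measurable (restrict_space borel {0..t} \<Otimes>\<^sub>M F t)"
    using X t by (auto simp: progressive_on_def)
  have "(\<lambda>\<omega>. min (\<tau> \<omega>) t) \<in> measurable (F t) (restrict_space borel {0..t})"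
    using min_stopping_measurable[OF assms(1) t] stopping_bounds[OF assms(1)] t space_F[of t]
    by (intro measurable_restrict_space2) auto
  then have "(\<lambda>\<omega>. (min (\<tau> \<omega>) t, \<omega>)) \<in> measurable (F t) (restrict_space borel {0..t} \<Otimes>\<^sub>M F t)"
    by (intro measurable_Pair) auto
  from measurable_compose[OF this 1] show ?thesis by simp
qed

text \<open>The function \<open>f \<omega>\<close> may depend on the state at time
  \<open>\<tau> \<omega>\<close>, so the measurability hypothesis is restricted to {\<tau> \<le> u},
  where that state is already known. Continuity reduces being below t to rational times before
  t.\<close>

lemma stopping_first_pos:
  fixes f :: "'a \<Rightarrow> real \<Rightarrow> real"
  assumes "stopping \<tau>" and cont: "\<And>\<omega>. \<omega> \<in> space M \<Longrightarrow> continuous_on {0..T} (f \<omega>)"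
    and meas: "\<And>u. 0 \<le> u \<Longrightarrow> u \<le> T \<Longrightarrow> {\<omega>\<in>space M. \<tau> \<omega> \<le> u \<and> 0 < f \<omega> u} \<in> sets (F u)"
  shows "stopping (\<lambda>\<omega>. first_pos (\<tau> \<omega>) T (f \<omega>))"
proof (rule stoppingI_less)
  fix \<omega> assume "\<omega> \<in> space M"
  then show "0 \<le> first_pos (\<tau> \<omega>) T (f \<omega>) \<and> first_pos (\<tau> \<omega>) T (f \<omega>) \<le> T"
    using stopping_bounds[OF assms(1)] first_pos_bounds[of "\<tau> \<omega>" T "f \<omega>"] by (auto intro: order_trans)
next
  fix t assume t: "0 < t" "t \<le> T"
  have "{\<omega>\<in>space M. first_pos (\<tau> \<omega>) T (f \<omega>) < t} = (\<Union>q\<in>\<rat> \<inter> {0..<t}. {\<omega>\<in>space M. \<tau> \<omega> \<le> q \<and> 0 < f \<omega> q})"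
  proof (intro set_eqI iffI)
    fix \<omega> assume "\<omega> \<in> {\<omega>\<in>space M. first_pos (\<tau> \<omega>) T (f \<omega>) < t}"
    then have w: "\<omega> \<in> space M" "first_pos (\<tau> \<omega>) T (f \<omega>) < t" by auto
    then obtain u where u: "\<tau> \<omega> \<le> u" "u < t" "0 < f \<omega> u"
      using first_pos_less_iff[of "\<tau> \<omega>" T t "f \<omega>"] stopping_bounds[OF assms(1) w(1)] t by auto
    obtain q where "q \<in> \<rat>" "u < q" "q < t" "0 < f \<omega> q"
      using rational_between_pos[OF cont[OF w(1)], of u t] u t stopping_bounds[OF assms(1) w(1)] by auto
    then show "\<omega> \<in> (\<Union>q\<in>\<rat> \<inter> {0..<t}. {\<omega>\<in>space M. \<tau> \<omega> \<le> q \<and> 0 < f \<omega> q})"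
      using u w(1) stopping_bounds[OF assms(1) w(1)] by (intro UN_I[of q]) auto
  next
    fix \<omega> assume "\<omega> \<in> (\<Union>q\<in>\<rat> \<inter> {0..<t}. {\<omega>\<in>space M. \<tau> \<omega> \<le> q \<and> 0 < f \<omega> q})"
    then show "\<omega> \<in> {\<omega>\<in>space M. first_pos (\<tau> \<omega>) T (f \<omega>) < t}"
      using first_pos_less_iff[of "\<tau> \<omega>" T t "f \<omega>"] stopping_bounds[OF assms(1)] t by auto
  qed
  also have "\<dots> \<in> sets (F t)"
  proof (rule sets.countable_UN'')
    show "countable (\<rat> \<inter> {0..<t})" by (rule countable_subset[OF _ countable_rat]) auto
    fix q assume "q \<in> \<rat> \<inter> {0..<t}"
    then show "{\<omega>\<in>space M. \<tau> \<omega> \<le> q \<and> 0 < f \<omega> q} \<in> sets (F t)"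
      using t meas[of q] by (intro sets_F_mono[of q t]) auto
  qed
  finally show "{\<omega>\<in>space M. first_pos (\<tau> \<omega>) T (f \<omega>) < t} \<in> sets (F t)" .
qed

end

section \<open>Conditional full support at stopping times\<close>

locale cfs_process = filtered_space M T F for M :: "'a measure" and T F +
  fixes U :: "(real^'n) set" and S :: "real \<Rightarrow> 'a \<Rightarrow> real^'n"
    and \<epsilon> :: "real \<Rightarrow> 'a \<Rightarrow> real" and L :: "real \<Rightarrow> 'a \<Rightarrow> real"
  assumes U_open: "open U"
    and S_in: "\<And>t \<omega>. 0 \<le> t \<Longrightarrow> t \<le> T \<Longrightarrow> \<omega> \<in> space M \<Longrightarrow> S t \<omega> \<in> U"
    and S_cont: "\<And>\<omega>. \<omega> \<in> space M \<Longrightarrow> continuous_on {0..T} (\<lambda>t. S t \<omega>)"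
    and S_adapted: "adapted_on T F S"
    and cfs: "cond_full_support M T F U S"
    and eps_adapted: "adapted_on T F \<epsilon>"
    and eps_cont: "\<And>\<omega>. \<omega> \<in> space M \<Longrightarrow> continuous_on {0..T} (\<lambda>t. \<epsilon> t \<omega>)"
    and eps_pos: "\<And>t \<omega>. 0 \<le> t \<Longrightarrow> t \<le> T \<Longrightarrow> \<omega> \<in> space M \<Longrightarrow> 0 < \<epsilon> t \<omega>"
    and L_prog: "progressive_on T F L"
    and L_bound: "\<And>\<omega> s t. \<omega> \<in> space M \<Longrightarrow> 0 \<le> s \<Longrightarrow> s \<le> t \<Longrightarrow> t \<le> T \<Longrightarrow>
           \<bar>\<epsilon> t \<omega> - \<epsilon> s \<omega>\<bar> \<le> L s \<omega> * (SUP u\<in>{s..t}. norm (S u \<omega> - S s \<omega>))"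
begin

section \<open>Step sizes and tube radii\<close>

lemma one_le_card: "1 \<le> real CARD('n)"
  by (simp add: Suc_le_eq)

text \<open>The case distinction is needed because the distance to the empty set is 0 by convention.\<close>

definition boundary_dist :: "real^'n \<Rightarrow> real" where
  "boundary_dist x = (if U = UNIV then 1 else infdist x (- U))"

lemma boundary_dist_cont: "continuous_on A boundary_dist"
  unfolding boundary_dist_def[abs_def] by (cases "U = UNIV") (auto intro!: continuous_intros)

lemma boundary_dist_pos: "x \<in> U \<Longrightarrow> 0 < boundary_dist x"
  unfolding boundary_dist_def using U_open in_closed_iff_infdist_zero[of "- U" x] infdist_nonneg[of x "- U"]
  by (auto simp: less_le)

lemma boundary_dist_ball: "norm (y - x) < boundary_dist x \<Longrightarrow> y \<in> U"
proof (rule ccontr)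
  assume a: "norm (y - x) < boundary_dist x" "y \<notin> U"
  then have "infdist x (- U) \<le> dist x y" by (intro infdist_le) auto
  moreover have "U \<noteq> UNIV" using a by auto
  ultimately show False using a by (simp add: boundary_dist_def dist_norm norm_minus_commute)
qed

text \<open>With n = \<open>CARD('n)\<close>, coordinate errors of at most H amount to a norm error
  of at most n H; adding the displacement H of S itself gives at most 2 n H, which is at most half
  of the old \<open>\<epsilon>\<close> and hence at most the current one. The distance term keeps a
  point with error n H inside \<open>U\<close>, and the term 1 bounds the increments.\<close>

definition H :: "real \<Rightarrow> 'a \<Rightarrow> real" where
  "H t \<omega> = min 1 (min (\<epsilon> t \<omega>) (boundary_dist (S t \<omega>))) / (4 * real CARD('n))"

lemma H_cont: "\<omega> \<in> space M \<Longrightarrow> continuous_on {0..T} (\<lambda>t. H t \<omega>)"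
  unfolding H_def by (intro continuous_intros eps_cont continuous_on_compose2[OF boundary_dist_cont S_cont])
      auto

lemma H_adapted: "adapted_on T F H"
  unfolding adapted_on_def
proof
  fix t assume t: "t \<in> {0..T}"
  have [measurable]: "\<epsilon> t \<in> borel_measurable (F t)" "S t \<in> borel_measurable (F t)"
    using t S_adapted eps_adapted by (auto simp: adapted_on_def)
  have [measurable]: "boundary_dist \<in> borel_measurable borel"
    by (rule borel_measurable_continuous_onI[OF boundary_dist_cont])
  show "H t \<in> borel_measurable (F t)"
    unfolding H_def[abs_def] by measurable
qed

context
  fixes t \<omega> assumes t: "0 \<le> t" "t \<le> T" and \<omega>: "\<omega> \<in> space M"
begin

lemma H_pos: "0 < H t \<omega>"
  unfolding H_def using eps_pos[OF t \<omega>] boundary_dist_pos[OF S_in[OF t \<omega>]] by auto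

lemma H_le: "4 * real CARD('n) * H t \<omega> \<le> 1" "4 * real CARD('n) * H t \<omega> \<le> \<epsilon> t \<omega>"
    "4 * real CARD('n) * H t \<omega> \<le> boundary_dist (S t \<omega>)"
  unfolding H_def by (auto simp: min_def)

lemma H_le1: "H t \<omega> \<le> 1" "real CARD('n) * H t \<omega> < boundary_dist (S t \<omega>)"
proof -
  have "H t \<omega> \<le> real CARD('n) * H t \<omega>" using one_le_card H_pos by simp
  then show "H t \<omega> \<le> 1" "real CARD('n) * H t \<omega> < boundary_dist (S t \<omega>)" using H_le H_pos by linarith+
qed

end

text \<open>Inside this radius \<open>\<epsilon>\<close> changes by at most half of its starting
  value, which is the threshold used in \<open>gap\<close>. The summand 1 excludes division by 0,
  and the absolute value allows any sign of \<open>L\<close>.\<close>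

definition tube_radius :: "real \<Rightarrow> 'a \<Rightarrow> real" where
  "tube_radius t \<omega> = min (H t \<omega>) (\<epsilon> t \<omega> / (2 * (1 + \<bar>L t \<omega>\<bar>)))"

lemma tube_radius_pos: "0 \<le> t \<Longrightarrow> t \<le> T \<Longrightarrow> \<omega> \<in> space M \<Longrightarrow> 0 < tube_radius t \<omega>"
  unfolding tube_radius_def using H_pos[of t \<omega>] eps_pos[of t \<omega>] by auto

lemma tube_radius_le: "tube_radius t \<omega> \<le> H t \<omega>"
  by (simp add: tube_radius_def)

text \<open>The assumed inequality for \<open>L\<close> enters the proof only here: the supremum of
  the displacement is at most the tube radius, and \<open>L\<close> is at most
  \<open>1 + \<bar>L\<bar>\<close>, the factor by which that radius was divided.\<close>

lemma eps_half:
  assumes s: "0 \<le> s" "s \<le> t" "t \<le> T" and w: "\<omega> \<in> space M"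
    and near: "\<And>u. u \<in> {s..t} \<Longrightarrow> norm (S u \<omega> - S s \<omega>) \<le> tube_radius s \<omega>"
  shows "\<epsilon> s \<omega> / 2 \<le> \<epsilon> t \<omega>"
proof -
  let ?sup = "SUP u\<in>{s..t}. norm (S u \<omega> - S s \<omega>)"
  have bdd: "bdd_above ((\<lambda>u. norm (S u \<omega> - S s \<omega>)) ` {s..t})"
    using near by (intro bdd_aboveI[of _ "tube_radius s \<omega>"]) auto
  have sup: "0 \<le> ?sup" "?sup \<le> tube_radius s \<omega>"
    using s near by (auto intro!: cSUP_least cSUP_upper2[OF bdd, of s])
  have e: "0 < \<epsilon> s \<omega>" using eps_pos s w by auto
  have "\<bar>\<epsilon> t \<omega> - \<epsilon> s \<omega>\<bar> \<le> L s \<omega> * ?sup" by (rule L_bound[OF w s])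
  also have "\<dots> \<le> (1 + \<bar>L s \<omega>\<bar>) * tube_radius s \<omega>"
    using sup by (intro mult_mono) auto
  also have "\<dots> \<le> (1 + \<bar>L s \<omega>\<bar>) * (\<epsilon> s \<omega> / (2 * (1 + \<bar>L s \<omega>\<bar>)))"
    by (intro mult_left_mono) (auto simp: tube_radius_def)
  also have "\<dots> = \<epsilon> s \<omega> / 2" by (simp add: field_simps)
  finally show ?thesis by linarith
qed

lemma S_at_measurable:
  assumes "stopping \<tau>" "0 \<le> t" "t \<le> T"
  shows "(\<lambda>\<omega>. S (min (\<tau> \<omega>) t) \<omega>) \<in> borel_measurable (F t)"
  and "(\<lambda>\<omega>. \<epsilon> (min (\<tau> \<omega>) t) \<omega>) \<in> borel_measurable (F t)"
  and "(\<lambda>\<omega>. H (min (\<tau> \<omega>) t) \<omega>) \<in> borel_measurable (F t)"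
  and "(\<lambda>\<omega>. tube_radius (min (\<tau> \<omega>) t) \<omega>) \<in> borel_measurable (F t)"
proof -
  note [measurable] = measurable_continuous_min_stopping[OF assms(1) S_adapted S_cont assms(2,3)]
    measurable_continuous_min_stopping[OF assms(1) eps_adapted eps_cont assms(2,3)]
    measurable_continuous_min_stopping[OF assms(1) H_adapted H_cont assms(2,3)]
    measurable_progressive_min_stopping[OF assms(1) L_prog assms(2,3)]
  show "(\<lambda>\<omega>. S (min (\<tau> \<omega>) t) \<omega>) \<in> borel_measurable (F t)"
    "(\<lambda>\<omega>. \<epsilon> (min (\<tau> \<omega>) t) \<omega>) \<in> borel_measurable (F t)"
    "(\<lambda>\<omega>. H (min (\<tau> \<omega>) t) \<omega>) \<in> borel_measurable (F t)"
    by measurable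
  show "(\<lambda>\<omega>. tube_radius (min (\<tau> \<omega>) t) \<omega>) \<in> borel_measurable (F t)"
    unfolding tube_radius_def by measurable
qed

section \<open>Path tubes ending in a prescribed orthant\<close>

definition tube :: "real \<Rightarrow> real \<Rightarrow> 'n set \<Rightarrow> (real \<Rightarrow> real^'n) set" where
  "tube q \<rho> \<sigma> = {g. cpath_in T U g \<and> (\<exists>e>0. (\<forall>u\<in>{q..T}. norm (g u - g q) \<le> \<rho> - e) \<and>
     (\<forall>i. if i \<in> \<sigma> then \<rho> / (4 * real CARD('n)) + e \<le> (g T - g q) $ i else (g T - g q) $ i \<le> - (\<rho> / (4 * real
         CARD('n))) - e))}"

text \<open>The margin \<open>e\<close> in the definition makes all inequalities strict uniformly in
  time. A path within e/4 of \<open>g\<close> has increments from \<open>q\<close> that differ by at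
  most e/2, so it keeps half of the margin.\<close>

lemma tube_open:
  assumes q: "0 \<le> q" "q < T"
  shows "uniformly_open T U (tube q \<rho> \<sigma>)"
  unfolding uniformly_open_def
proof (intro conjI ballI)
  fix g assume "g \<in> tube q \<rho> \<sigma>"
  then show "cpath_in T U g" by (simp add: tube_def)
next
  fix g assume "g \<in> tube q \<rho> \<sigma>"
  then obtain e where e: "0 < e" "\<forall>u\<in>{q..T}. norm (g u - g q) \<le> \<rho> - e"
    "\<forall>i. if i \<in> \<sigma> then \<rho> / (4 * real CARD('n)) + e \<le> (g T - g q) $ i else (g T - g q) $ i \<le> - (\<rho> / (4 * real
        CARD('n))) - e"
    unfolding tube_def by blast
  show "\<exists>e>0. \<forall>h. cpath_in T U h \<and> (\<forall>t\<in>{0..T}. dist (h t) (g t) < e) \<longrightarrow> h \<in> tube q \<rho> \<sigma>"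
  proof (intro exI[of _ "e/4"] conjI allI impI)
    fix h assume h: "cpath_in T U h \<and> (\<forall>t\<in>{0..T}. dist (h t) (g t) < e/4)"
    have near: "norm ((h u - h q) - (g u - g q)) \<le> e/2" if "u \<in> {q..T}" for u
    proof -
      have "norm ((h u - h q) - (g u - g q)) = norm ((h u - g u) - (h q - g q))" by (simp add: algebra_simps)
      also have "\<dots> \<le> norm (h u - g u) + norm (h q - g q)" by (rule norm_triangle_ineq4)
      also have "\<dots> \<le> e/4 + e/4"
        using h that q by (intro add_mono) (auto simp: dist_norm less_imp_le)
      finally show ?thesis by simp
    qed
    show "h \<in> tube q \<rho> \<sigma>"
      unfolding tube_def mem_Collect_eq
    proof (intro conjI exI[of _ "e/2"] ballI allI)
      show "cpath_in T U h" using h by simp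
      show "0 < e/2" using e by simp
    next
      fix u assume u: "u \<in> {q..T}"
      have "norm (h u - h q) \<le> norm (g u - g q) + norm ((h u - h q) - (g u - g q))"
        by (rule norm_triangle_sub)
      with near[OF u] e(2)[rule_format, OF u] show "norm (h u - h q) \<le> \<rho> - e/2" by linarith
    next
      fix i
      have "\<bar>(h T - h q) $ i - (g T - g q) $ i\<bar> \<le> e/2"
        using component_le_norm_cart[of "(h T - h q) - (g T - g q)" i] near[of T] q
        unfolding vector_minus_component[symmetric] by simp
      with e(3)[rule_format, of i]
      show "if i \<in> \<sigma> then \<rho> / (4 * real CARD('n)) + e/2 \<le> (h T - h q) $ i else (h T - h q) $ i
          \<le> - (\<rho> / (4 * real CARD('n))) - e/2"
        by (cases "i \<in> \<sigma>") (simp_all only: if_True if_False; linarith)+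
    qed
  qed (use e in simp)
qed

text \<open>After time \<open>q\<close> the path is continued along a straight segment to the vertex
  of a cube in the orthant \<open>\<sigma>\<close>. The coordinates of the displacement
  \<open>v\<close> are \<rho>/(2n) in absolute value, so its norm is at most \<rho>/2 and the
  orthant condition holds with margin \<rho>/(4n).\<close>

lemma tube_extension:
  assumes q: "0 \<le> q" "q < T" and w: "\<omega> \<in> space M" and \<rho>: "0 < \<rho>"
    and in_U: "\<And>x. norm (x - S q \<omega>) \<le> \<rho> / 2 \<Longrightarrow> x \<in> U"
  shows "\<exists>g\<in>tube q \<rho> \<sigma>. \<forall>u\<in>{0..q}. S u \<omega> = g u"
proof -
  define v :: "real^'n" where "v = (\<chi> i. if i \<in> \<sigma> then \<rho> / (2 * real CARD('n)) else - (\<rho> / (2 * real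
      CARD('n))))"
  define g where "g u = S (min u q) \<omega> + (max 0 (u - q) / (T - q)) *\<^sub>R v" for u
  have nv: "norm v \<le> \<rho> / 2"
  proof -
    have "norm v \<le> (\<Sum>i\<in>UNIV. \<bar>v $ i\<bar>)" by (rule norm_le_l1_cart)
    also have "\<dots> = (\<Sum>i\<in>(UNIV::'n set). \<rho> / (2 * real CARD('n)))"
      using \<rho> by (intro sum.cong) (auto simp: v_def)
    finally show ?thesis by simp
  qed
  have gq: "g q = S q \<omega>" by (simp add: g_def)
  have gu: "norm (g u - S q \<omega>) \<le> \<rho> / 2" if "q \<le> u" "u \<le> T" for u
  proof -
    have "norm (g u - S q \<omega>) = ((u - q) / (T - q)) * norm v"
      using that q by (simp add: g_def min_absorb2 max_absorb2)
    also have "\<dots> \<le> 1 * norm v" using that q by (intro mult_right_mono) auto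
    finally show ?thesis using nv by simp
  qed
  have gT: "(g T - g q) $ i = v $ i" for i
    using q by (simp add: g_def min_absorb2 max_absorb2)
  have "continuous_on {0..T} g"
    unfolding g_def using q
    by (intro continuous_intros continuous_on_compose2[OF S_cont[OF w], of _ "\<lambda>u. min u q"]) auto
  moreover have "g u \<in> U" if "u \<in> {0..T}" for u
  proof (cases "u \<le> q")
    case True
    then show ?thesis using S_in[of u \<omega>] that w by (simp add: g_def)
  next
    case False
    then show ?thesis using gu[of u] that by (intro in_U) auto
  qed
  ultimately have g_path: "cpath_in T U g" by (auto simp: cpath_in_def)
  have g_near: "norm (g u - g q) \<le> \<rho> - \<rho> / (4 * real CARD('n))" if "u \<in> {q..T}" for u
  proof -
    have "\<rho> / (4 * real CARD('n)) \<le> \<rho> / 2" by (intro divide_left_mono) (use one_le_card \<rho> in linarith)+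
    with gu[of u] that show ?thesis unfolding gq by auto
  qed
  have g_end: "if i \<in> \<sigma> then \<rho> / (4 * real CARD('n)) + \<rho> / (4 * real CARD('n)) \<le> (g T - g q) $ i else (g T - g
      q) $ i \<le> - (\<rho> / (4 * real CARD('n))) - \<rho> / (4 * real CARD('n))" for i
    unfolding gT by (auto simp: v_def)
  have "g \<in> tube q \<rho> \<sigma>"
    unfolding tube_def mem_Collect_eq
    by (intro conjI exI[of _ "\<rho> / (4 * real CARD('n))"] ballI allI g_path g_near g_end) (use \<rho> in auto)
  then show ?thesis by (rule bexI[rotated]) (auto simp: g_def)
qed

text \<open>By conditional full support the conditional probability \<open>P\<close> of following a
  tube path up to \<open>T\<close> is positive almost everywhere on \<open>B\<close>, so its
  integral over \<open>B\<close>, the mass of \<open>B \<inter> W\<close>, cannot vanish.\<close>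

lemma cfs_reaches_tube:
  assumes q: "0 \<le> q" "q < T" and B: "B \<in> sets (F q)" "emeasure M B \<noteq> 0"
    and ext: "\<And>\<omega>. \<omega> \<in> B \<Longrightarrow> \<exists>g\<in>tube q \<rho> \<sigma>. \<forall>u\<in>{0..q}. S u \<omega> = g u"
  shows "\<exists>C\<in>sets M. C \<subseteq> B \<and> emeasure M C \<noteq> 0 \<and> (\<forall>\<omega>\<in>C. \<exists>g\<in>tube q \<rho> \<sigma>. \<forall>u\<in>{0..T}. S u \<omega> = g u)"
proof -
  define W where "W = {\<omega> \<in> space M. \<exists>g\<in>tube q \<rho> \<sigma>. \<forall>u\<in>{0..T}. S u \<omega> = g u}"
  define P where "P = real_cond_exp M (F q) (indicator W)"
  have qT: "q \<in> {0..T}" using q by auto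
  interpret Fq: finite_measure_subalgebra M "F q"
    by unfold_locales (rule subalgebra_F[OF qT])
  have BM [measurable]: "B \<in> sets M" using sets_F_subset[OF qT B(1)] .
  have "AE \<omega> in M. (\<exists>g\<in>tube q \<rho> \<sigma>. \<forall>u\<in>{0..q}. S u \<omega> = g u) \<longrightarrow> 0 < P \<omega>"
    using cfs qT tube_open[OF q] unfolding cond_full_support_def P_def W_def by blast
  then have pos: "AE \<omega> in M. \<omega> \<in> B \<longrightarrow> 0 < P \<omega>"
    by eventually_elim (use ext in blast)
  have not_AE: "\<not> (AE \<omega> in M. \<omega> \<notin> B)"
    using B(2) AE_iff_null_sets[OF BM] by auto
  \<comment> \<open>The conditional expectation of a non-measurable function is 0 by convention, which \<open>pos\<close> excludes.\<close>
  have W: "W \<in> sets M"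
  proof (rule ccontr)
    assume "W \<notin> sets M"
    then have "indicat_real W \<notin> borel_measurable M"
      by (simp add: borel_measurable_indicator_iff W_def Int_absorb2 Collect_restrict)
    have *: "(\<lambda>\<omega>. ennreal (indicator W \<omega>)) \<notin> borel_measurable M"
    proof
      assume "(\<lambda>\<omega>. ennreal (indicator W \<omega>)) \<in> borel_measurable M"
      then have "(\<lambda>\<omega>. enn2real (ennreal (indicator W \<omega>))) \<in> borel_measurable M" by measurable
      with \<open>indicat_real W \<notin> borel_measurable M\<close> show False by simp
    qed
    have "P \<omega> \<le> 0" for \<omega>
      unfolding P_def real_cond_exp_def using * by (simp add: nn_cond_exp_def)
    with pos have "AE \<omega> in M. \<omega> \<notin> B"
      by (auto elim!: eventually_mono simp: not_less[symmetric])
    with not_AE show False ..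
  qed
  have "emeasure M (B \<inter> W) \<noteq> 0"
  proof
    assume "emeasure M (B \<inter> W) = 0"
    then have "(LINT \<omega>:B|M. indicator W \<omega>) = (0::real)"
      using W by (simp add: set_lebesgue_integral_def indicator_inter_arith[symmetric] measure_def)
    moreover have iW: "integrable M (indicat_real W)"
      using W by (simp add: integrable_indicator_iff emeasure_eq_measure)
    ultimately have 0: "(LINT \<omega>|M. indicator B \<omega> * P \<omega>) = 0"
      using Fq.real_cond_exp_intA[OF iW B(1)] by (simp add: P_def set_lebesgue_integral_def)
    have "integrable M P" unfolding P_def by (rule Fq.real_cond_exp_int(1)[OF iW])
    then have "integrable M (\<lambda>\<omega>. indicator B \<omega> * P \<omega>)"
      using integrable_real_mult_indicator[OF BM] by (simp add: mult.commute)
    moreover have "AE \<omega> in M. 0 \<le> indicator B \<omega> * P \<omega>"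
      using pos by eventually_elim (auto split: split_indicator)
    ultimately have "AE \<omega> in M. indicator B \<omega> * P \<omega> = 0"
      using 0 by (subst (asm) integral_nonneg_eq_0_iff_AE) auto
    with pos have "AE \<omega> in M. \<omega> \<notin> B" by eventually_elim auto
    with not_AE show False ..
  qed
  then show ?thesis
    using W by (intro bexI[of _ "B \<inter> W"]) (auto simp: W_def)
qed

text \<open>Countably many events \<open>BB q \<rho>\<close>, each known at the deterministic time
  \<open>q\<close>, cover \<open>B\<close>, so one of them is not null and
  \<open>cfs_reaches_tube\<close> applies to it. The displacement between \<open>\<tau>\<close> and
  \<open>q\<close> is so small that the tube based at time \<open>q\<close> gives the required
  bounds relative to time \<open>\<tau>\<close>.\<close>

lemma stopping_support:
  assumes st: "stopping \<tau>" and B: "B \<in> sets (F_at \<tau>)" "\<And>\<omega>. \<omega> \<in> B \<Longrightarrow> \<tau> \<omega> < T" "emeasure M B \<noteq> 0"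
  shows "\<exists>C\<in>sets M. C \<subseteq> B \<and> emeasure M C \<noteq> 0 \<and>
    (\<forall>\<omega>\<in>C. (\<forall>u\<in>{\<tau> \<omega>..T}. norm (S u \<omega> - S (\<tau> \<omega>) \<omega>) \<le> tube_radius (\<tau> \<omega>) \<omega>) \<and>
       (\<forall>i. if i \<in> \<sigma> then tube_radius (\<tau> \<omega>) \<omega> / (24 * real CARD('n)) \<le> (S T \<omega> - S (\<tau> \<omega>) \<omega>) $ i
            else (S T \<omega> - S (\<tau> \<omega>) \<omega>) $ i \<le> - (tube_radius (\<tau> \<omega>) \<omega> / (24 * real CARD('n)))))"
proof -
  have BM: "B \<in> sets M" using B(1) st by (simp add: sets_F_at)
  \<comment> \<open>The path is tested only at rational times, which keeps the intersection
    countable, and the minima make every sampled quantity known at the time of its test.\<close>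
  define BB where "BB q \<rho> = {\<omega> \<in> B. \<tau> \<omega> \<le> q} \<inter> {\<omega>\<in>space M. 2 * \<rho> \<le> tube_radius (min (\<tau> \<omega>) q) \<omega> \<and>
      tube_radius (min (\<tau> \<omega>) q) \<omega> \<le> 3 * \<rho>} \<inter>
    (\<Inter>u\<in>\<rat> \<inter> {0..q}. {\<omega>\<in>space M. \<tau> \<omega> \<le> u \<longrightarrow> norm (S u \<omega> - S (min (\<tau> \<omega>) u) \<omega>) \<le> \<rho> / (8 * real CARD('n))})" for q
        \<rho>
  have BB_sets: "BB q \<rho> \<in> sets (F q)" if q: "q \<in> \<rat>" "0 \<le> q" "q < T" for q \<rho>
    unfolding BB_def
  proof (intro sets.Int)
    have qT: "q \<le> T" using q by simp
    have sp: "space (F q) = space M" using q by (intro space_F) auto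
    show "{\<omega> \<in> B. \<tau> \<omega> \<le> q} \<in> sets (F q)" by (rule F_at_le_sets[OF st B(1) q(2) qT])
    note [measurable] = S_at_measurable[OF st q(2) qT]
    show "{\<omega>\<in>space M. 2 * \<rho> \<le> tube_radius (min (\<tau> \<omega>) q) \<omega> \<and> tube_radius (min (\<tau> \<omega>) q) \<omega> \<le> 3 * \<rho>} \<in> sets (F q)"
      unfolding sp[symmetric] by measurable
    show "(\<Inter>u\<in>\<rat> \<inter> {0..q}. {\<omega>\<in>space M. \<tau> \<omega> \<le> u \<longrightarrow> norm (S u \<omega> - S (min (\<tau> \<omega>) u) \<omega>) \<le> \<rho> / (8 * real CARD('n))}) \<in>
        sets (F q)"
    proof (rule sets.countable_INT')
      show "countable (\<rat> \<inter> {0..q})" by (rule countable_subset[OF _ countable_rat]) auto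
      show "\<rat> \<inter> {0..q} \<noteq> {}" using q by auto
      show "(\<lambda>u. {\<omega>\<in>space M. \<tau> \<omega> \<le> u \<longrightarrow> norm (S u \<omega> - S (min (\<tau> \<omega>) u) \<omega>) \<le> \<rho> / (8 * real CARD('n))}) ` (\<rat>
          \<inter> {0..q}) \<subseteq> sets (F q)"
      proof (rule image_subsetI)
        fix u assume u: "u \<in> \<rat> \<inter> {0..q}"
        then have u': "0 \<le> u" "u \<le> q" "u \<le> T" using q by auto
        have spu: "space (F u) = space M" using u' by (intro space_F) auto
        note [measurable] = S_at_measurable(1)[OF st u'(1,3)]
        have [measurable]: "S u \<in> borel_measurable (F u)" using S_adapted u' by (auto simp: adapted_on_def)
        have "{\<omega>\<in>space M. \<tau> \<omega> \<le> u \<longrightarrow> norm (S u \<omega> - S (min (\<tau> \<omega>) u) \<omega>) \<le> \<rho> / (8 * real CARD('n))} =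
          (space (F u) - {\<omega>\<in>space M. \<tau> \<omega> \<le> u}) \<union> {\<omega>\<in>space (F u). norm (S u \<omega> - S (min (\<tau> \<omega>) u) \<omega>)
              \<le> \<rho> / (8 * real CARD('n))}"
          unfolding spu by auto
        also have "\<dots> \<in> sets (F u)"
          by (intro sets.Un sets.compl_sets stopping_le_sets[OF st u'(1,3)]) measurable
        finally show "{\<omega>\<in>space M. \<tau> \<omega> \<le> u \<longrightarrow> norm (S u \<omega> - S (min (\<tau> \<omega>) u) \<omega>) \<le> \<rho> / (8 * real CARD('n))} \<in> sets
            (F q)"
          by (rule sets_F_mono[OF u'(1,2) qT])
      qed
    qed
  qed
  let ?I = "{(q, \<rho>). q \<in> \<rat> \<and> 0 \<le> q \<and> q < T \<and> \<rho> \<in> \<rat> \<and> 0 < \<rho>}"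
  have cI: "countable ?I"
    by (rule countable_subset[of _ "\<rat> \<times> \<rat>"]) (auto intro!: countable_SIGMA countable_rat)
  have cover: "B \<subseteq> (\<Union>(q, \<rho>)\<in>?I. BB q \<rho>)"
  proof
    fix \<omega> assume wB: "\<omega> \<in> B"
    then have w: "\<omega> \<in> space M" using sets.sets_into_space[OF BM] by auto
    have t: "0 \<le> \<tau> \<omega>" "\<tau> \<omega> < T" using stopping_bounds[OF st w] B(2)[OF wB] by auto
    have r0: "0 < tube_radius (\<tau> \<omega>) \<omega>" using tube_radius_pos t w by auto
    \<comment> \<open>This window yields 2\<rho> \<le> radius \<le> 3\<rho>: the factor 2 leaves
      room for the displacement before \<open>q\<close>, and the factor 3 reappears in 24 = 3 *
      8.\<close>
    obtain \<rho> where \<rho>: "\<rho> \<in> \<rat>" "tube_radius (\<tau> \<omega>) \<omega> / 3 < \<rho>" "\<rho> < tube_radius (\<tau> \<omega>) \<omega> / 2"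
      using Rats_dense_in_real[of "tube_radius (\<tau> \<omega>) \<omega> / 3" "tube_radius (\<tau> \<omega>) \<omega> / 2"] r0 by auto
    have \<rho>0: "0 < \<rho> / (8 * real CARD('n))" using \<rho> r0 by auto
    obtain d where d: "0 < d" "\<And>u. u \<in> {0..T} \<Longrightarrow> dist u (\<tau> \<omega>) < d \<Longrightarrow> dist (S u \<omega>) (S (\<tau> \<omega>) \<omega>) < \<rho> / (8 * real
        CARD('n))"
      using S_cont[OF w] \<rho>0 t unfolding continuous_on_iff by (metis atLeastAtMost_iff less_imp_le)
    obtain q where q: "q \<in> \<rat>" "\<tau> \<omega> < q" "q < min T (\<tau> \<omega> + d)"
      using Rats_dense_in_real[of "\<tau> \<omega>" "min T (\<tau> \<omega> + d)"] t d by auto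
    have "\<omega> \<in> BB q \<rho>"
      unfolding BB_def
    proof (intro IntI INT_I CollectI conjI impI w)
      show "\<omega> \<in> B" "\<tau> \<omega> \<le> q" "2 * \<rho> \<le> tube_radius (min (\<tau> \<omega>) q) \<omega>" "tube_radius (min (\<tau> \<omega>) q) \<omega> \<le> 3 * \<rho>"
        using wB q \<rho> by auto
      fix u assume "u \<in> \<rat> \<inter> {0..q}" "\<tau> \<omega> \<le> u"
      then show "norm (S u \<omega> - S (min (\<tau> \<omega>) u) \<omega>) \<le> \<rho> / (8 * real CARD('n))"
        using d(2)[of u] q by (auto simp: dist_norm min_absorb1 abs_if)
    qed
    then show "\<omega> \<in> (\<Union>(q, \<rho>)\<in>?I. BB q \<rho>)"
      using q \<rho> r0 t by (intro UN_I[of "(q, \<rho>)"]) auto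
  qed
  have "\<exists>(q, \<rho>)\<in>?I. emeasure M (BB q \<rho>) \<noteq> 0"
  proof (rule ccontr)
    assume "\<not> ?thesis"
    then have "BB q \<rho> \<in> null_sets M" if "(q, \<rho>) \<in> ?I" for q \<rho>
      using that BB_sets[of q \<rho>] sets_F_subset[of q "BB q \<rho>"] by (auto simp: null_sets_def)
    then have "(\<Union>(q, \<rho>)\<in>?I. BB q \<rho>) \<in> null_sets M"
      by (intro null_sets_UN'[OF cI]) auto
    from null_sets_subset[OF this BM cover] B(3) show False by auto
  qed
  then obtain q \<rho> where q: "q \<in> \<rat>" "0 \<le> q" "q < T" and \<rho>: "0 < \<rho>" and BB: "emeasure M (BB q \<rho>) \<noteq> 0" by auto
  have BBD: "\<omega> \<in> B" "\<omega> \<in> space M" "0 \<le> \<tau> \<omega>" "\<tau> \<omega> \<le> q" "2 * \<rho> \<le> tube_radius (\<tau> \<omega>) \<omega>"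
      "tube_radius (\<tau> \<omega>) \<omega> \<le> 3 * \<rho>"
    "\<And>u. u \<in> \<rat> \<Longrightarrow> \<tau> \<omega> \<le> u \<Longrightarrow> u \<le> q \<Longrightarrow> norm (S u \<omega> - S (\<tau> \<omega>) \<omega>) \<le> \<rho> / (8 * real CARD('n))"
    if "\<omega> \<in> BB q \<rho>" for \<omega>
  proof -
    show w: "\<omega> \<in> B" "\<omega> \<in> space M" "\<tau> \<omega> \<le> q" using that by (auto simp: BB_def)
    show t0: "0 \<le> \<tau> \<omega>" using stopping_bounds[OF st w(2)] by simp
    show "2 * \<rho> \<le> tube_radius (\<tau> \<omega>) \<omega>" "tube_radius (\<tau> \<omega>) \<omega> \<le> 3 * \<rho>" using that w(3)
        by (auto simp: BB_def min_absorb1)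
    fix u assume u: "u \<in> \<rat>" "\<tau> \<omega> \<le> u" "u \<le> q"
    then have "u \<in> \<rat> \<inter> {0..q}" using t0 by auto
    with that have "\<tau> \<omega> \<le> u \<longrightarrow> norm (S u \<omega> - S (min (\<tau> \<omega>) u) \<omega>) \<le> \<rho> / (8 * real CARD('n))"
      unfolding BB_def by blast
    with u show "norm (S u \<omega> - S (\<tau> \<omega>) \<omega>) \<le> \<rho> / (8 * real CARD('n))" by (simp add: min_absorb1)
  qed
  have small: "\<rho> / (8 * real CARD('n)) \<le> \<rho> / 8" by (intro divide_left_mono) (use one_le_card \<rho> in linarith)+
  have "\<exists>g\<in>tube q \<rho> \<sigma>. \<forall>u\<in>{0..q}. S u \<omega> = g u" if w: "\<omega> \<in> BB q \<rho>" for \<omega>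
  proof (rule tube_extension[OF q(2,3) BBD(2)[OF w] \<rho>])
    fix x assume x: "norm (x - S q \<omega>) \<le> \<rho> / 2"
    have t: "0 \<le> \<tau> \<omega>" "\<tau> \<omega> \<le> T" using BBD[OF w] q by auto
    have "norm (x - S (\<tau> \<omega>) \<omega>) \<le> norm (x - S q \<omega>) + norm (S q \<omega> - S (\<tau> \<omega>) \<omega>)"
      using norm_triangle_ineq[of "x - S q \<omega>" "S q \<omega> - S (\<tau> \<omega>) \<omega>"] by simp
    also have "\<dots> < tube_radius (\<tau> \<omega>) \<omega>" using x BBD(5)[OF w] \<rho> small BBD(7)[OF w q(1) BBD(4)[OF w] order_refl]
        by linarith
    also have "\<dots> \<le> real CARD('n) * H (\<tau> \<omega>) \<omega>" using tube_radius_le[of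
        "\<tau> \<omega>" \<omega>] one_le_card H_pos[OF t BBD(2)[OF w]]
      by (smt (verit) mult_le_cancel_right1)
    also have "\<dots> < boundary_dist (S (\<tau> \<omega>) \<omega>)" by (rule H_le1(2)[OF t BBD(2)[OF w]])
    finally show "x \<in> U" by (rule boundary_dist_ball)
  qed
  from cfs_reaches_tube[OF q(2,3) BB_sets[OF q] BB this] obtain C where
    C: "C \<in> sets M" "C \<subseteq> BB q \<rho>" "emeasure M C \<noteq> 0" "\<And>\<omega>. \<omega> \<in> C \<Longrightarrow> \<exists>g\<in>tube q \<rho> \<sigma>. \<forall>u\<in>{0..T}. S u \<omega> = g u"
    by auto
  show ?thesis
  proof (intro bexI[of _ C] conjI ballI allI)
    show "C \<subseteq> B" "emeasure M C \<noteq> 0" "C \<in> sets M" using C BBD(1) by auto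
    fix \<omega> assume wC: "\<omega> \<in> C"
    then have wB: "\<omega> \<in> BB q \<rho>" using C by auto
    note D = BBD[OF wB]
    obtain g where g: "g \<in> tube q \<rho> \<sigma>" "\<And>u. u \<in> {0..T} \<Longrightarrow> S u \<omega> = g u" using C(4)[OF wC] by auto
    have gS: "g u = S u \<omega>" if "q \<le> u" "u \<le> T" for u using g(2)[of u] that q by auto
    from g(1) obtain e where e0: "0 < e" "\<forall>u\<in>{q..T}. norm (g u - g q) \<le> \<rho> - e"
      unfolding tube_def by blast
    have e: "0 < e" "\<And>u. q \<le> u \<Longrightarrow> u \<le> T \<Longrightarrow> norm (S u \<omega> - S q \<omega>) \<le> \<rho> - e"
      using e0 gS gS[of q] q by auto
    have Sq: "norm (S q \<omega> - S (\<tau> \<omega>) \<omega>) \<le> \<rho> / (8 * real CARD('n))" using D(4) D(7)[OF q(1)] by auto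
    fix u assume u: "u \<in> {\<tau> \<omega>..T}"
    show "norm (S u \<omega> - S (\<tau> \<omega>) \<omega>) \<le> tube_radius (\<tau> \<omega>) \<omega>"
    proof (cases "u < q")
      case False
      have "norm (S u \<omega> - S (\<tau> \<omega>) \<omega>) \<le> norm (S u \<omega> - S q \<omega>) + norm (S q \<omega> - S (\<tau> \<omega>) \<omega>)"
        using norm_triangle_ineq[of "S u \<omega> - S q \<omega>" "S q \<omega> - S (\<tau> \<omega>) \<omega>"] by simp
      also have "\<dots> \<le> tube_radius (\<tau> \<omega>) \<omega>" using e(1) e(2)[of u] False u Sq small D(5) \<rho> by auto
      finally show ?thesis .
    next
      case True
      \<comment> \<open>\<open>BB\<close> controls rational times only. An excess at a real time
        \<open>u\<close> before \<open>q\<close> would persist at a rational time between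
        \<open>u\<close> and \<open>q\<close>.\<close>
      have "norm (S u \<omega> - S (\<tau> \<omega>) \<omega>) - \<rho> / 8 \<le> 0"
      proof (rule ccontr)
        assume "\<not> ?thesis"
        moreover have "continuous_on {0..T} (\<lambda>u. norm (S u \<omega> - S (\<tau> \<omega>) \<omega>) - \<rho> / 8)"
          by (intro continuous_intros S_cont D)
        ultimately obtain p where "p \<in> \<rat>" "u < p" "p < q" "0 < norm (S p \<omega> - S (\<tau> \<omega>) \<omega>) - \<rho> / 8"
          using rational_between_pos[of 0 T "\<lambda>u. norm (S u \<omega> - S (\<tau> \<omega>) \<omega>) - \<rho> / 8" u q] u True q D(3) by auto
        with D(7)[of p] u small show False by auto
      qed
      with D(5) \<rho> show ?thesis by auto
    qed
  next
    fix \<omega> i assume wC: "\<omega> \<in> C"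
    then have wB: "\<omega> \<in> BB q \<rho>" using C by auto
    note D = BBD[OF wB]
    obtain g where g: "g \<in> tube q \<rho> \<sigma>" "\<And>u. u \<in> {0..T} \<Longrightarrow> S u \<omega> = g u" using C(4)[OF wC] by auto
    have gS: "g q = S q \<omega>" "g T = S T \<omega>" using g(2)[of q] g(2)[of T] q by auto
    from g(1) obtain e where e: "0 < e"
      "if i \<in> \<sigma> then \<rho> / (4 * real CARD('n)) + e \<le> (S T \<omega> - S q \<omega>) $ i else (S T \<omega> - S q \<omega>) $ i
          \<le> - (\<rho> / (4 * real CARD('n))) - e"
      unfolding tube_def gS[symmetric] by blast
    have Sq: "\<bar>(S q \<omega> - S (\<tau> \<omega>) \<omega>) $ i\<bar> \<le> \<rho> / (8 * real CARD('n))"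
      using D(4) D(7)[OF q(1)] component_le_norm_cart[of "S q \<omega> - S (\<tau> \<omega>) \<omega>" i] by auto
    have "tube_radius (\<tau> \<omega>) \<omega> / (24 * real CARD('n)) \<le> (3 * \<rho>) / (24 * real CARD('n))"
      using D(6) one_le_card by (intro divide_right_mono) auto
    also have "\<dots> = \<rho> / (8 * real CARD('n))" by simp
    finally have 1: "tube_radius (\<tau> \<omega>) \<omega> / (24 * real CARD('n)) \<le> \<rho> / (8 * real CARD('n))" .
    \<comment> \<open>The tube gives \<rho>/(4n) relative to \<open>S q\<close>. Changing the base
      point to \<open>S (\<tau> \<omega>)\<close> costs at most one half of this, and the other half
      is at least radius/(24n).\<close>
    have 2: "\<rho> / (4 * real CARD('n)) = \<rho> / (8 * real CARD('n)) + \<rho> / (8 * real CARD('n))"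
        by (simp add: field_simps)
    show "if i \<in> \<sigma> then tube_radius (\<tau> \<omega>) \<omega> / (24 * real CARD('n)) \<le> (S T \<omega> - S (\<tau> \<omega>) \<omega>) $ i
            else (S T \<omega> - S (\<tau> \<omega>) \<omega>) $ i \<le> - (tube_radius (\<tau> \<omega>) \<omega> / (24 * real CARD('n)))"
    proof -
      have "(S T \<omega> - S (\<tau> \<omega>) \<omega>) $ i = (S T \<omega> - S q \<omega>) $ i + (S q \<omega> - S (\<tau> \<omega>) \<omega>) $ i" by simp
      then show ?thesis
        using e Sq 1 2 by (cases "i \<in> \<sigma>") (simp_all only: if_True if_False; linarith)+
    qed
  qed
qed

section \<open>The stopping times and the martingale measure\<close>

text \<open>The maximum merges the two exit criteria into one continuous function whose first
  positive time ends the step begun at \<open>s\<close>.\<close>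

definition gap :: "real \<Rightarrow> 'a \<Rightarrow> real \<Rightarrow> real" where
  "gap s \<omega> u = max (norm (S u \<omega> - S s \<omega>) - H s \<omega>) (\<epsilon> s \<omega> / 2 - \<epsilon> u \<omega>)"

primrec tau :: "nat \<Rightarrow> 'a \<Rightarrow> real" where
  "tau 0 = (\<lambda>_. 0)"
| "tau (Suc k) = (\<lambda>\<omega>. first_pos (tau k \<omega>) T (gap (tau k \<omega>) \<omega>))"

lemma gap_cont: "\<omega> \<in> space M \<Longrightarrow> continuous_on {0..T} (gap s \<omega>)"
  unfolding gap_def[abs_def] by (intro continuous_intros S_cont eps_cont)

lemma stopping_tau: "stopping (tau k)"
proof (induction k)
  case 0
  show ?case using stopping_zero by simp
next
  case (Suc k)
  show ?case
    unfolding tau.simps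
  proof (rule stopping_first_pos[OF Suc gap_cont])
    fix u assume u: "0 \<le> u" "u \<le> T"
    note [measurable] = S_at_measurable[OF Suc u]
    have [measurable]: "S u \<in> borel_measurable (F u)" "\<epsilon> u \<in> borel_measurable (F u)"
      using S_adapted eps_adapted u by (auto simp: adapted_on_def)
    have sp: "space (F u) = space M" using u by (intro space_F) auto
    have "{\<omega> \<in> space M. tau k \<omega> \<le> u \<and> 0 < gap (tau k \<omega>) \<omega> u} = {\<omega> \<in> space M. tau k \<omega> \<le> u} \<inter>
      {\<omega> \<in> space (F u). 0 < max (norm (S u \<omega> - S (min (tau k \<omega>) u) \<omega>) - H (min (tau k \<omega>) u) \<omega>) (\<epsilon> (min (tau k
          \<omega>) u) \<omega> / 2 - \<epsilon> u \<omega>)}"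
      unfolding sp gap_def by (auto simp: min_absorb1)
    also have "\<dots> \<in> sets (F u)"
      by (intro sets.Int stopping_le_sets[OF Suc u]) measurable
    finally show "{\<omega> \<in> space M. tau k \<omega> \<le> u \<and> 0 < gap (tau k \<omega>) \<omega> u} \<in> sets (F u)" .
  qed
qed

lemma tau_bounds: "\<omega> \<in> space M \<Longrightarrow> 0 \<le> tau k \<omega>" "\<omega> \<in> space M \<Longrightarrow> tau k \<omega> \<le> T"
  using stopping_bounds[OF stopping_tau] by auto

lemma tau_Suc_ge: "\<omega> \<in> space M \<Longrightarrow> tau k \<omega> \<le> tau (Suc k) \<omega>"
  using first_pos_bounds(1)[OF tau_bounds(2)] by simp

lemma tau_mono: "\<omega> \<in> space M \<Longrightarrow> j \<le> k \<Longrightarrow> tau j \<omega> \<le> tau k \<omega>"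
  by (rule lift_Suc_mono_le[of "\<lambda>k. tau k \<omega>"]) (auto intro: tau_Suc_ge simp del: tau.simps)

lemma tau_stays: "\<omega> \<in> space M \<Longrightarrow> j \<le> k \<Longrightarrow> tau j \<omega> = T \<Longrightarrow> tau k \<omega> = T"
  using tau_mono[of \<omega> j k] tau_bounds(2)[of \<omega> k] by auto

text \<open>\<open>gap\<close> is negative at the start because \<open>H\<close> and
  \<open>\<epsilon>\<close> are positive, and by continuity it has not become positive at the exit
  time itself; hence the closed interval.\<close>

lemma tau_near:
  assumes w: "\<omega> \<in> space M" and u: "tau k \<omega> \<le> u" "u \<le> tau (Suc k) \<omega>"
  shows "norm (S u \<omega> - S (tau k \<omega>) \<omega>) \<le> H (tau k \<omega>) \<omega>" "\<epsilon> (tau k \<omega>) \<omega> / 2 \<le> \<epsilon> u \<omega>"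
proof -
  note t = tau_bounds[OF w, of k]
  have "gap (tau k \<omega>) \<omega> u \<le> 0"
  proof (rule first_pos_nonpos[where f="gap (tau k \<omega>) \<omega>" and u=u, OF t(2)])
    show "continuous_on {tau k \<omega>..T} (gap (tau k \<omega>) \<omega>)"
      using t by (intro continuous_on_subset[OF gap_cont[OF w]]) auto
    show "gap (tau k \<omega>) \<omega> (tau k \<omega>) \<le> 0"
      using H_pos[OF t w] eps_pos[OF t w] by (auto simp: gap_def)
  qed (use u in auto)
  then show "norm (S u \<omega> - S (tau k \<omega>) \<omega>) \<le> H (tau k \<omega>) \<omega>" "\<epsilon> (tau k \<omega>) \<omega> / 2 \<le> \<epsilon> u \<omega>"
    by (auto simp: gap_def)
qed

text \<open>If the times never reached \<open>T\<close> they would converge to some x, and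
  \<open>gap\<close> at successive exits would converge to the maximum of - H x and - \<epsilon> x /
  2, which is negative. But at every exit before \<open>T\<close> it is nonnegative. The argument
  works on each path, without exceptional null set.\<close>

lemma tau_reaches:
  assumes w: "\<omega> \<in> space M"
  shows "\<exists>k. tau k \<omega> = T"
proof (rule ccontr)
  assume "\<not> ?thesis"
  then have less: "tau k \<omega> < T" for k using tau_bounds(2)[OF w, of k] by (auto simp: less_le)
  have inc: "incseq (\<lambda>k. tau k \<omega>)" using tau_mono[OF w] by (auto simp: incseq_def)
  obtain x where x: "(\<lambda>k. tau k \<omega>) \<longlonglongrightarrow> x" "\<And>k. tau k \<omega> \<le> x"
    using incseq_convergent[OF inc, of T] tau_bounds(2)[OF w] by auto
  have "0 \<le> x" "x \<le> T"
    using tau_bounds[OF w] x(2)[of 0] LIMSEQ_le_const2[OF x(1), of T] by (auto intro: order_trans)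
  then have xT: "x \<in> {0..T}" by simp
  have lim: "(\<lambda>k. f (tau k \<omega>)) \<longlonglongrightarrow> f x" if "continuous_on {0..T} f" for f :: "real \<Rightarrow> 'c::topological_space"
    by (rule continuous_on_tendsto_compose[OF that x(1) xT]) (use tau_bounds[OF w] in auto)
  note l = lim[OF S_cont[OF w]] lim[OF H_cont[OF w]] lim[OF eps_cont[OF w]]
  have "(\<lambda>k. gap (tau k \<omega>) \<omega> (tau (Suc k) \<omega>)) \<longlonglongrightarrow> max (norm (S x \<omega> - S x \<omega>) - H x \<omega>) (\<epsilon> x \<omega> / 2 - \<epsilon> x \<omega>)"
    unfolding gap_def
    by (intro tendsto_intros l l[THEN LIMSEQ_Suc]) simp
  moreover have "0 \<le> gap (tau k \<omega>) \<omega> (tau (Suc k) \<omega>)" for k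
  proof -
    have "continuous_on {tau k \<omega>..T} (gap (tau k \<omega>) \<omega>)"
      using tau_bounds[OF w] by (intro continuous_on_subset[OF gap_cont[OF w]]) auto
    from first_pos_nonneg[OF tau_bounds(2)[OF w] this] less[of "Suc k"] show ?thesis by simp
  qed
  ultimately have "0 \<le> max (norm (S x \<omega> - S x \<omega>) - H x \<omega>) (\<epsilon> x \<omega> / 2 - \<epsilon> x \<omega>)"
    by (intro LIMSEQ_le_const) auto
  with H_pos[of x \<omega>] eps_pos[of x \<omega>] xT w show False by auto
qed

lemma tau_interval:
  assumes w: "\<omega> \<in> space M" and t: "0 \<le> t" "t < T"
  shows "\<exists>k. tau k \<omega> \<le> t \<and> t < tau (Suc k) \<omega>"
proof -
  obtain j where j: "tau j \<omega> = T" using tau_reaches[OF w] by auto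
  define m where "m = (LEAST m. t < tau m \<omega>)"
  have m: "t < tau m \<omega>" unfolding m_def by (rule LeastI[of _ j]) (use j t in simp)
  then obtain k where k: "m = Suc k" using t by (cases m) auto
  then have "\<not> t < tau k \<omega>" unfolding m_def by (intro not_less_Least) (use k m_def in auto)
  with m k show ?thesis by (intro exI[of _ k]) auto
qed

text \<open>Neither exit criterion can be met: the displacement is at most
  \<open>tube_radius\<close>, hence at most \<open>H\<close>, and \<open>eps_half\<close> excludes a
  drop of \<open>\<epsilon>\<close> below one half.\<close>

lemma tau_retire:
  assumes w: "\<omega> \<in> space M"
    and near: "\<And>u. u \<in> {tau k \<omega>..T} \<Longrightarrow> norm (S u \<omega> - S (tau k \<omega>) \<omega>) \<le> tube_radius (tau k \<omega>) \<omega>"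
  shows "tau (Suc k) \<omega> = T"
proof (rule ccontr)
  assume "tau (Suc k) \<omega> \<noteq> T"
  then have "first_pos (tau k \<omega>) T (gap (tau k \<omega>) \<omega>) < T" using tau_bounds(2)[OF w, of "Suc k"] by simp
  then obtain u where u: "tau k \<omega> \<le> u" "u < T" "0 < gap (tau k \<omega>) \<omega> u"
    using first_pos_less_iff[OF tau_bounds(2)[OF w], of T k] by auto
  have "\<epsilon> (tau k \<omega>) \<omega> / 2 \<le> \<epsilon> u \<omega>"
    by (rule eps_half[OF tau_bounds(1)[OF w] u(1) _ w]) (use u near in auto)
  moreover have "norm (S u \<omega> - S (tau k \<omega>) \<omega>) \<le> H (tau k \<omega>) \<omega>"
    using near[of u] u tube_radius_le[of "tau k \<omega>" \<omega>] by auto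
  ultimately show False using u(3) by (auto simp: gap_def)
qed

lemma tau_measurable_F_at:
  shows "(\<lambda>\<omega>. S (tau k \<omega>) \<omega>) \<in> borel_measurable (F_at (tau k))"
    and "(\<lambda>\<omega>. tube_radius (tau k \<omega>) \<omega>) \<in> borel_measurable (F_at (tau k))"
    and "tau k \<in> borel_measurable (F_at (tau k))"
  using S_at_measurable[OF stopping_tau]
  by (auto intro!: measurable_F_at[of "tau k" S] measurable_F_at[of
      "tau k" tube_radius] stopping_measurable stopping_tau)

lemma tau_measurable:
  shows "(\<lambda>\<omega>. S (tau k \<omega>) \<omega>) \<in> borel_measurable M" and "tau k \<in> borel_measurable M"
  using tau_measurable_F_at measurable_from_subalg[OF subalgebra_F_at[OF stopping_tau]] by blast+

lemma F_at_tau_mono: "j \<le> k \<Longrightarrow> A \<in> sets (F_at (tau j)) \<Longrightarrow> A \<in> sets (F_at (tau k))"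
  by (rule sets_F_at_mono[OF stopping_tau stopping_tau]) (auto intro: tau_mono)

definition incr :: "nat \<Rightarrow> 'a \<Rightarrow> real^'n" where
  "incr k \<omega> = S (tau (Suc k) \<omega>) \<omega> - S (tau k \<omega>) \<omega>"

lemma incr_bound: "\<omega> \<in> space M \<Longrightarrow> norm (incr k \<omega>) \<le> 1"
  unfolding incr_def
  using tau_near(1)[of \<omega> k "tau (Suc k) \<omega>"] tau_Suc_ge[of \<omega> k] H_le1(1)[of "tau k \<omega>" \<omega>] tau_bounds[of \<omega> k]
  by (auto simp del: tau.simps)

lemma incr_measurable_F_at: "incr k \<in> borel_measurable (F_at (tau (Suc k)))"
proof -
  have "subalgebra (F_at (tau (Suc k))) (F_at (tau k))"
    using F_at_tau_mono[of k "Suc k"] by (auto simp: subalgebra_def space_F_at simp del: tau.simps)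
  from measurable_from_subalg[OF this tau_measurable_F_at(1)] tau_measurable_F_at(1)[of "Suc k"]
  show ?thesis unfolding incr_def[abs_def] by (intro borel_measurable_diff)
qed

lemma incr_measurable: "incr k \<in> borel_measurable M"
  unfolding incr_def[abs_def] by (intro borel_measurable_diff tau_measurable)

section \<open>Iteration of the change of measure\<close>

definition admissible :: "('a \<Rightarrow> real) \<Rightarrow> bool" where
  "admissible Z \<longleftrightarrow> Z \<in> borel_measurable M \<and> (\<forall>\<omega>\<in>space M. 0 < Z \<omega>) \<and> prob_space (density M Z)"

text \<open>The first clause freezes the density on paths that have reached \<open>T\<close>, so the
  sequence of densities is eventually constant on each path. The second preserves what was achieved
  in earlier steps, since that concerns \<open>F_at (tau k)\<close> only.\<close>

definition step :: "nat \<Rightarrow> ('a \<Rightarrow> real) \<Rightarrow> ('a \<Rightarrow> real) \<Rightarrow> bool" where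
  "step k Z Z' \<longleftrightarrow> (\<forall>\<omega>\<in>space M. tau k \<omega> = T \<longrightarrow> Z' \<omega> = Z \<omega>) \<and>
     (\<forall>B\<in>sets (F_at (tau k)). emeasure (density M Z') B = emeasure (density M Z) B) \<and>
     (\<forall>B\<in>sets (F_at (tau k)). \<forall>i. (LINT \<omega>:B|density M Z'. incr k \<omega> $ i) = 0) \<and>
     emeasure (density M Z') {\<omega>\<in>space M. tau (Suc k) \<omega> < T} \<le> ennreal (1/8) * emeasure (density M Z) {\<omega>\<in>space
         M. tau k \<omega> < T}"

text \<open>\<open>martingale_step\<close> is applied under the measure with density
  \<open>Z\<close>, with reaching \<open>T\<close> in the next step as the event \<open>E\<close>.
  Positivity of \<open>Z\<close> makes the null sets those of \<open>M\<close>, so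
  \<open>stopping_support\<close> supplies the required cells.\<close>

lemma step_exists:
  assumes Z: "admissible Z"
  shows "\<exists>Z'. admissible Z' \<and> step k Z Z'"
proof -
  have [measurable]: "Z \<in> borel_measurable M" and Z_pos: "\<And>\<omega>. \<omega> \<in> space M \<Longrightarrow> 0 < Z \<omega>"
    and "prob_space (density M Z)" using Z by (auto simp: admissible_def)
  define Q where "Q = density M (\<lambda>\<omega>. ennreal (Z \<omega>))"
  interpret Q: prob_space Q unfolding Q_def by fact
  have sQ: "sets Q = sets M" "space Q = space M" by (auto simp: Q_def)
  have null: "emeasure Q B = 0 \<longleftrightarrow> emeasure M B = 0" if "B \<in> sets M" for B
    using null_sets_density_pos[of Z M, OF _ Z_pos] that unfolding Q_def[symmetric] null_sets_def sQ
        by (auto simp: set_eq_iff)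
  note [measurable] = tau_measurable incr_measurable
  define A where "A = {\<omega>\<in>space M. tau k \<omega> < T}"
  define E where "E = {\<omega>\<in>space M. tau (Suc k) \<omega> = T}"
  define r where "r \<omega> = tube_radius (tau k \<omega>) \<omega> / (24 * real CARD('n))" for \<omega>
  have A: "A \<in> sets (F_at (tau k))"
    unfolding A_def space_F_at[of "tau k", symmetric] using tau_measurable_F_at(3)[of k] by measurable
  have E: "E \<in> sets M" unfolding E_def by measurable
  have r_meas: "r \<in> borel_measurable (F_at (tau k))"
    unfolding r_def[abs_def] using tau_measurable_F_at(2)[of k] by measurable
  have sub: "subalgebra Q (F_at (tau k))"
    using subalgebra_F_at[OF stopping_tau, of k] by (auto simp: subalgebra_def sQ)
  have BM: "B \<in> sets M" if "B \<in> sets (F_at (tau k))" for B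
    using that subalgebra_F_at[OF stopping_tau, of k] by (auto simp: subalgebra_def)
  have [measurable]: "r \<in> borel_measurable M"
    using measurable_from_subalg[OF subalgebra_F_at[OF stopping_tau] r_meas] .
  have "\<exists>\<rho>. \<rho> \<in> borel_measurable Q \<and> (\<forall>\<omega>\<in>space Q. 0 < \<rho> \<omega>) \<and> (\<forall>\<omega>. \<omega> \<notin> A \<longrightarrow> \<rho> \<omega> = (1::real)) \<and>
     (\<forall>B\<in>sets (F_at (tau k)). emeasure (density Q \<rho>) B = emeasure Q B) \<and>
     (\<forall>B\<in>sets (F_at (tau k)). \<forall>i. (LINT \<omega>:B|density Q \<rho>. incr k \<omega> $ i) = 0) \<and>
     emeasure (density Q \<rho>) (A - E) \<le> ennreal (1/8) * emeasure Q A"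
  proof (rule martingale_step[OF Q.prob_space_axioms sub A _ _ r_meas])
    show "E \<in> sets Q" using E by (simp add: sQ)
    show "incr k \<in> borel_measurable Q" unfolding Q_def by measurable
    fix \<omega> assume "\<omega> \<in> space Q"
    then have w: "\<omega> \<in> space M" by (simp add: sQ)
    note t = tau_bounds[OF w, of k]
    have "tube_radius (tau k \<omega>) \<omega> \<le> 1" using tube_radius_le[of "tau k \<omega>" \<omega>] H_le1(1)[OF t w] by linarith
    then have "tube_radius (tau k \<omega>) \<omega> \<le> 24 * real CARD('n)" using one_le_card by linarith
    then show "0 < r \<omega> \<and> r \<omega> \<le> 1" using tube_radius_pos[OF t w] unfolding r_def
      by (simp add: divide_le_eq)
    show "norm (incr k \<omega>) \<le> 1" by (rule incr_bound[OF w])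
  next
    fix \<omega> assume "\<omega> \<in> space Q - A"
    then have w: "\<omega> \<in> space M" "tau k \<omega> = T" using tau_bounds(2)[of \<omega> k] by (auto simp: A_def sQ)
    with tau_stays[of \<omega> k "Suc k"] show "incr k \<omega> = 0" by (simp add: incr_def del: tau.simps)
  next
    fix \<sigma> B assume B: "B \<in> sets (F_at (tau k))" "B \<subseteq> A" "emeasure Q B \<noteq> 0"
    have "\<And>\<omega>. \<omega> \<in> B \<Longrightarrow> tau k \<omega> < T" using B(2) by (auto simp: A_def)
    from stopping_support[OF stopping_tau B(1) this, of \<sigma>] null[OF BM[OF B(1)]] B(3)
    obtain C where C: "C \<in> sets M" "C \<subseteq> B" "emeasure M C \<noteq> 0"
      and C1: "\<forall>\<omega>\<in>C. \<forall>u\<in>{tau k \<omega>..T}. norm (S u \<omega> - S (tau k \<omega>) \<omega>) \<le> tube_radius (tau k \<omega>) \<omega>"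
      and C2: "\<forall>\<omega>\<in>C. \<forall>i. if i \<in> \<sigma> then r \<omega> \<le> (S T \<omega> - S (tau k \<omega>) \<omega>) $ i
            else (S T \<omega> - S (tau k \<omega>) \<omega>) $ i \<le> - r \<omega>"
      unfolding r_def by blast
    let ?D = "{\<omega> \<in> B \<inter> E. \<forall>i. if i \<in> \<sigma> then r \<omega> \<le> incr k \<omega> $ i else incr k \<omega> $ i \<le> - r \<omega>}"
    have CD: "C \<subseteq> ?D"
    proof
      fix \<omega> assume wC: "\<omega> \<in> C"
      then have w: "\<omega> \<in> space M" using sets.sets_into_space[OF C(1)] by auto
      \<comment> \<open>Staying in the tube makes \<open>T\<close> the end of this step, so
        \<open>incr k\<close> is the displacement at \<open>T\<close>, whose orthant is prescribed
        by \<open>C2\<close>.\<close>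
      have T: "tau (Suc k) \<omega> = T" by (rule tau_retire[OF w]) (use C1 wC in blast)
      then have "incr k \<omega> = S T \<omega> - S (tau k \<omega>) \<omega>" by (simp add: incr_def del: tau.simps)
      then show "\<omega> \<in> ?D" using T wC C(2) w C2 by (auto simp: E_def simp del: tau.simps vector_minus_component)
    qed
    have 1: "{\<omega> \<in> space M. if i \<in> \<sigma> then r \<omega> \<le> incr k \<omega> $ i else incr k \<omega> $ i \<le> - r \<omega>} \<in> sets M" for i
      by (cases "i \<in> \<sigma>") (simp, measurable)+
    have "?D = B \<inter> E \<inter> (\<Inter>i. {\<omega> \<in> space M. if i \<in> \<sigma> then r \<omega> \<le> incr k \<omega> $ i else incr k \<omega> $ i \<le> - r \<omega>})"
      using sets.sets_into_space[OF E] by auto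
    also have "\<dots> \<in> sets M"
      by (intro sets.Int sets.finite_INT 1 BM[OF B(1)] E) auto
    finally have "?D \<in> sets Q" by (simp add: sQ)
    then have "emeasure Q C \<le> emeasure Q ?D" by (intro emeasure_mono CD)
    moreover have "emeasure Q C \<noteq> 0" using null[OF C(1)] C(3) by simp
    ultimately show "emeasure Q ?D \<noteq> 0" by (metis le_zero_eq)
  qed
  then obtain \<rho> where \<rho>_meas: "\<rho> \<in> borel_measurable Q" and \<rho>_pos: "\<forall>\<omega>\<in>space Q. 0 < \<rho> \<omega>"
     and \<rho>_1: "\<forall>\<omega>. \<omega> \<notin> A \<longrightarrow> \<rho> \<omega> = (1::real)"
     and \<rho>_em: "\<forall>B\<in>sets (F_at (tau k)). emeasure (density Q \<rho>) B = emeasure Q B"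
     and \<rho>_mart: "\<forall>B\<in>sets (F_at (tau k)). \<forall>i. (LINT \<omega>:B|density Q \<rho>. incr k \<omega> $ i) = 0"
     and \<rho>_A: "emeasure (density Q \<rho>) (A - E) \<le> ennreal (1/8) * emeasure Q A"
    by blast
  define Z' where "Z' \<omega> = Z \<omega> * \<rho> \<omega>" for \<omega>
  have [measurable]: "\<rho> \<in> borel_measurable M" using \<rho>_meas by (simp add: Q_def)
  have dens: "density M (\<lambda>\<omega>. ennreal (Z' \<omega>)) = density Q (\<lambda>\<omega>. ennreal (\<rho> \<omega>))"
    unfolding Q_def Z'_def
    by (subst density_density_eq) (auto intro!: density_cong AE_I2 simp: ennreal_mult less_imp_le[OF Z_pos]
        less_imp_le \<rho>_pos sQ)
  have AE': "A - E = {\<omega>\<in>space M. tau (Suc k) \<omega> < T}"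
    using tau_Suc_ge[of _ k] tau_bounds(2)[of _ "Suc k"] unfolding A_def E_def by (force simp del: tau.simps)
  have spF: "space M \<in> sets (F_at (tau k))" using sets.top[of "F_at (tau k)"] by (simp add: space_F_at)
  have "prob_space (density M Z')"
    using \<rho>_em[rule_format, OF spF] Q.emeasure_space_1 unfolding dens by (intro prob_spaceI) (simp add: sQ)
  then have "admissible Z'"
    unfolding admissible_def using \<rho>_pos Z_pos by (auto simp: Z'_def[abs_def] sQ)
  moreover have "step k Z Z'"
    unfolding step_def dens Q_def[symmetric] AE'[symmetric] A_def[symmetric]
  proof (intro conjI \<rho>_em \<rho>_mart \<rho>_A ballI impI)
    fix \<omega> assume "\<omega> \<in> space M" "tau k \<omega> = T"
    then have "\<omega> \<notin> A" by (simp add: A_def)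
    then show "Z' \<omega> = Z \<omega>" using \<rho>_1 by (simp add: Z'_def)
  qed
  ultimately show ?thesis by blast
qed

lemma density_sequence: "\<exists>Z. \<forall>k. admissible (Z k) \<and> step k (Z k) (Z (Suc k))"
proof -
  have "admissible (\<lambda>_. 1)"
    unfolding admissible_def using prob_space_axioms by (simp add: density_1 ennreal_1)
  then show ?thesis
    using dependent_nat_choice[of "\<lambda>_. admissible" step] step_exists by blast
qed

section \<open>The limit of the densities\<close>

definition N :: "'a \<Rightarrow> nat" where
  "N \<omega> = (LEAST k. tau k \<omega> = T)"

lemma tau_N: "\<omega> \<in> space M \<Longrightarrow> tau (N \<omega>) \<omega> = T"
  unfolding N_def by (rule LeastI_ex[OF tau_reaches])

lemma tau_less_iff: "\<omega> \<in> space M \<Longrightarrow> tau k \<omega> < T \<longleftrightarrow> k < N \<omega>"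
  using tau_N[of \<omega>] tau_stays[of \<omega> "N \<omega>" k] not_less_Least[of k "\<lambda>k. tau k \<omega> = T"] tau_bounds(2)[of \<omega> k]
  unfolding N_def[symmetric] by (cases "k < N \<omega>") (auto simp: less_le)

lemma N_measurable: "N \<in> measurable M (count_space UNIV)"
  unfolding N_def[abs_def] using tau_measurable(2) by measurable

text \<open>Pointwise convergence of densities does not by itself preserve mass. Here the mass on
  which the \<open>j\<close>-th density may still change is at most (1/8)^j, so the limit measure
  agrees with the \<open>k\<close>-th one on \<open>F_at (tau k)\<close>.\<close>

lemma limit_measure:
  "\<exists>Q. prob_space Q \<and> sets Q = sets M \<and> null_sets Q = null_sets M \<and>
     (\<forall>k. \<forall>B\<in>sets (F_at (tau k)). \<forall>i. (LINT \<omega>:B|Q. incr k \<omega> $ i) = 0) \<and>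
     (\<forall>k. emeasure Q {\<omega>\<in>space M. tau k \<omega> < T} \<le> ennreal ((1/8)^k))"
proof -
  obtain Z where Z: "\<And>k. admissible (Z k)" and st: "\<And>k. step k (Z k) (Z (Suc k))"
    using density_sequence by blast
  have [measurable]: "Z k \<in> borel_measurable M" and Z_pos: "\<omega> \<in> space M \<Longrightarrow> 0 < Z k \<omega>" for k \<omega>
    using Z[of k] by (auto simp: admissible_def)
  define R where "R k = density M (\<lambda>\<omega>. ennreal (Z k \<omega>))" for k
  have R_prob: "prob_space (R k)" for k using Z[of k] by (auto simp: admissible_def R_def)
  have R_stop: "tau k \<omega> = T \<Longrightarrow> Z (Suc k) \<omega> = Z k \<omega>" if "\<omega> \<in> space M" for k \<omega>
    using st[of k] that by (auto simp: step_def)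
  have R_em: "emeasure (R (Suc k)) B = emeasure (R k) B" if "B \<in> sets (F_at (tau k))" for k B
    using st[of k] that by (auto simp: step_def R_def)
  have R_mart: "(LINT \<omega>:B|R (Suc k). incr k \<omega> $ i) = 0" if "B \<in> sets (F_at (tau k))" for k B i
    using st[of k] that by (auto simp: step_def R_def)
  have R_tail: "emeasure (R k) {\<omega>\<in>space M. tau k \<omega> < T} \<le> ennreal ((1/8)^k)" for k
  proof (induction k)
    case 0
    interpret R0: prob_space "R 0" by (rule R_prob)
    show ?case using R0.emeasure_le_1 by (simp add: one_ennreal.rep_eq)
  next
    case (Suc k)
    have "emeasure (R (Suc k)) {\<omega>\<in>space M. tau (Suc k) \<omega> < T} \<le> ennreal (1/8) * emeasure (R k) {\<omega>\<in>space M. tau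
        k \<omega> < T}"
      using st[of k] unfolding step_def R_def by blast
    also have "\<dots> \<le> ennreal (1/8) * ennreal ((1/8)^k)" by (intro mult_left_mono Suc) simp
    also have "\<dots> = ennreal ((1/8)^Suc k)" by (simp add: ennreal_mult[symmetric])
    finally show ?case .
  qed
  \<comment> \<open>From index \<open>N \<omega>\<close> on the densities are constant at
    \<open>\<omega>\<close>, so this is their pointwise limit, and it is positive.\<close>
  define Y where "Y \<omega> = Z (N \<omega>) \<omega>" for \<omega>
  have [measurable]: "Y \<in> borel_measurable M"
    unfolding Y_def[abs_def] by (rule measurable_compose_countable[OF _ N_measurable]) measurable
  have Y_pos: "\<omega> \<in> space M \<Longrightarrow> 0 < Y \<omega>" for \<omega> by (simp add: Y_def Z_pos)
  have Y_eq: "Y \<omega> = Z j \<omega>" if w: "\<omega> \<in> space M" and j: "tau j \<omega> = T" for \<omega> j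
  proof -
    have "N \<omega> \<le> j" unfolding N_def by (rule Least_le) (rule j)
    then show ?thesis
      unfolding Y_def
    proof (induction j rule: dec_induct)
      case (step m)
      then have "tau m \<omega> = T" using tau_stays[OF w _ tau_N[OF w], of m] by simp
      then show ?case using R_stop[OF w] step.IH by simp
    qed simp
  qed
  define Q where "Q = density M (\<lambda>\<omega>. ennreal (Y \<omega>))"
  have sQ: "sets Q = sets M" "space Q = space M" "sets (R k) = sets M" "space (R k) = space M" for k
    by (auto simp: Q_def R_def)
  define E where "E j = {\<omega>\<in>space M. tau j \<omega> = T}" for j
  have [measurable]: "E j \<in> sets M" for j
    unfolding E_def using tau_measurable(2)[of j] by measurable
  have agree: "emeasure Q (B \<inter> E j) = emeasure (R j) (B \<inter> E j)" if [measurable]: "B \<in> sets M" for B j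
  proof -
    have "B \<inter> E j \<in> sets M" by measurable
    then show ?thesis
      unfolding Q_def R_def
      by (subst (1 2) emeasure_density) (auto intro!: nn_integral_cong split: split_indicator simp: E_def
          Y_eq)
  qed
  have R_const: "emeasure (R j) B = emeasure (R k) B" if "B \<in> sets (F_at (tau k))" "k \<le> j" for B j k
    using that(2) by (induction j rule: dec_induct) (use that(1) F_at_tau_mono R_em in auto)
  \<comment> \<open>Both inequalities go through a large index \<open>j\<close>: on
    \<open>E j\<close> the limit density equals \<open>Z j\<close>, and outside \<open>E j\<close>
    the measure \<open>R j\<close> has mass at most (1/8)^j. With \<open>k = 0\<close> and the whole
    space this gives total mass 1.\<close>
  have Q_em: "emeasure Q B = emeasure (R k) B" if B: "B \<in> sets (F_at (tau k))" for B k
  proof (rule antisym)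
    have BM [measurable]: "B \<in> sets M"
      using B subalgebra_F_at[OF stopping_tau, of k] by (auto simp: subalgebra_def)
    have inc: "incseq (\<lambda>j. B \<inter> E j)"
      using tau_stays by (auto simp: incseq_def E_def)
    have un: "(\<Union>j. B \<inter> E j) = B"
      using sets.sets_into_space[OF BM] tau_reaches by (auto simp: E_def)
    have "(\<lambda>j. emeasure Q (B \<inter> E j)) \<longlonglongrightarrow> emeasure Q (\<Union>j. B \<inter> E j)"
      by (rule Lim_emeasure_incseq[OF _ inc]) (auto simp: sQ)
    then show "emeasure Q B \<le> emeasure (R k) B"
      unfolding un
    proof (rule LIMSEQ_le_const2, intro exI[of _ k] allI impI)
      fix j assume "k \<le> j"
      have "emeasure Q (B \<inter> E j) \<le> emeasure (R j) B"
        unfolding agree[OF BM] by (intro emeasure_mono) (auto simp: sQ)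
      with R_const[OF B \<open>k \<le> j\<close>] show "emeasure Q (B \<inter> E j) \<le> emeasure (R k) B" by simp
    qed
    have le: "emeasure (R k) B \<le> emeasure Q B + ennreal ((1/8)^j)" if "k \<le> j" for j
    proof -
      have "emeasure (R k) B = emeasure (R j) B" using R_const[OF B that] by simp
      also have "\<dots> \<le> emeasure (R j) ((B \<inter> E j) \<union> {\<omega>\<in>space M. tau j \<omega> < T})"
        using sets.sets_into_space[OF BM] tau_bounds(2)[of _ j] tau_measurable(2)[of j]
        by (intro emeasure_mono) (auto simp: E_def sQ less_le)
      also have "\<dots> \<le> emeasure (R j) (B \<inter> E j) + emeasure (R j) {\<omega>\<in>space M. tau j \<omega> < T}"
        using tau_measurable(2)[of j] by (intro emeasure_subadditive) (auto simp: sQ)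
      also have "\<dots> \<le> emeasure Q B + ennreal ((1/8)^j)"
        unfolding agree[OF BM, symmetric] by (intro add_mono R_tail emeasure_mono) (auto simp: sQ)
      finally show ?thesis .
    qed
    have "(\<lambda>j. emeasure Q B + ennreal ((1/8)^j)) \<longlonglongrightarrow> emeasure Q B + ennreal 0"
      by (intro tendsto_add tendsto_const tendsto_ennrealI LIMSEQ_power_zero) simp
    then show "emeasure (R k) B \<le> emeasure Q B"
      using le by (intro LIMSEQ_le_const[where X="\<lambda>j. emeasure Q B + ennreal ((1/8)^j)"]) auto
  qed
  have prob: "prob_space Q"
  proof (rule prob_spaceI)
    interpret R0: prob_space "R 0" by (rule R_prob)
    have "space M \<in> sets (F_at (tau 0))" using sets.top[of "F_at (tau 0)"] by (simp add: space_F_at)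
    from Q_em[OF this] R0.emeasure_space_1 show "emeasure Q (space Q) = 1" by (simp add: sQ)
  qed
  have mart: "(LINT \<omega>:B|Q. incr k \<omega> $ i) = 0" if B: "B \<in> sets (F_at (tau k))" for B k i
  proof -
    \<comment> \<open>\<open>incr k\<close> is measurable for this sigma-algebra, on which
      \<open>Q\<close> and \<open>R (Suc k)\<close> coincide, so the vanishing integrals carry over
      although the densities differ.\<close>
    let ?G = "F_at (tau (Suc k))"
    have sub: "subalgebra Q ?G" "subalgebra (R (Suc k)) ?G"
      using subalgebra_F_at[OF stopping_tau, of "Suc k"] by (auto simp: subalgebra_def sQ)
    have "B \<in> sets ?G" using F_at_tau_mono[of k "Suc k"] B by auto
    then have meas: "(\<lambda>\<omega>. indicator B \<omega> *\<^sub>R incr k \<omega> $ i) \<in> borel_measurable ?G"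
      using incr_measurable_F_at[of k] by measurable
    have "(LINT \<omega>:B|Q. incr k \<omega> $ i) = (LINT \<omega>:B|R (Suc k). incr k \<omega> $ i)"
      using integral_subalgebra2[OF sub(1) meas] integral_subalgebra2[OF sub(2) meas] restr_to_subalg_eq[OF
          sub Q_em]
      by (simp add: set_lebesgue_integral_def)
    with R_mart[OF B] show ?thesis by simp
  qed
  have tail: "emeasure Q {\<omega>\<in>space M. tau k \<omega> < T} \<le> ennreal ((1/8)^k)" for k
  proof -
    have "{\<omega>\<in>space M. tau k \<omega> < T} \<in> sets (F_at (tau k))"
      unfolding space_F_at[of "tau k", symmetric] using tau_measurable_F_at(3)[of k] by measurable
    from Q_em[OF this] R_tail[of k] show ?thesis by simp
  qed
  show ?thesis
    using prob mart tail sQ null_sets_density_pos[of Y M, OF _ Y_pos]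
        by (intro exI[of _ Q]) (auto simp: Q_def)
qed

text \<open>The events on which the norm of \<open>S 0\<close> is at most m belong to
  \<open>F 0\<close>, have probability 0 or 1 and increase to the whole space, so one of them has
  probability 1.\<close>

lemma S_initial_bound:
  assumes "trivial_initial M F"
  shows "\<exists>K\<ge>0. AE \<omega> in M. norm (S 0 \<omega>) \<le> K"
proof -
  have [measurable]: "S 0 \<in> borel_measurable (F 0)" using S_adapted T_pos by (auto simp: adapted_on_def)
  have sp: "space (F 0) = space M" using T_pos by (intro space_F) auto
  define A where "A m = {\<omega> \<in> space (F 0). norm (S 0 \<omega>) \<le> real m}" for m
  have AF: "A m \<in> sets (F 0)" for m unfolding A_def by measurable
  then have AM: "A m \<in> sets M" for m using T_pos by (intro sets_F_subset[of 0]) auto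
  have "(\<lambda>m. prob (A m)) \<longlonglongrightarrow> prob (\<Union>m. A m)"
    using AM by (intro finite_Lim_measure_incseq) (auto simp: incseq_def A_def)
  also have "(\<Union>m. A m) = space M" by (auto simp: A_def sp real_arch_simple)
  finally have "(\<lambda>m. prob (A m)) \<longlonglongrightarrow> 1" by (simp add: prob_space)
  then have "\<forall>\<^sub>F m in sequentially. 0 < prob (A m)" by (rule order_tendstoD) simp
  then obtain m where "0 < prob (A m)" by (auto simp: eventually_sequentially)
  with assms AF[of m] have "prob (A m) = 1" by (auto simp: trivial_initial_def)
  then have "AE \<omega> in M. \<omega> \<in> A m" using AM by (simp add: prob_eq_1)
  then show ?thesis by (intro exI[of _ "real m"]) (auto simp: A_def elim!: eventually_mono)
qed

text \<open>Each step moves S by at most 1, and nothing moves after step \<open>N\<close>; hence a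
  bound uniform in \<open>k\<close>.\<close>

lemma S_tau_bound: "\<omega> \<in> space M \<Longrightarrow> norm (S (tau k \<omega>) \<omega> - S 0 \<omega>) \<le> real (min k (N \<omega>))"
proof (induction k)
  case (Suc k)
  show ?case
  proof (cases "k < N \<omega>")
    case True
    have "norm (S (tau (Suc k) \<omega>) \<omega> - S 0 \<omega>) = norm (incr k \<omega> + (S (tau k \<omega>) \<omega> - S 0 \<omega>))"
        by (simp add: incr_def)
    also have "\<dots> \<le> norm (incr k \<omega>) + norm (S (tau k \<omega>) \<omega> - S 0 \<omega>)" by (rule norm_triangle_ineq)
    also have "\<dots> \<le> 1 + real (min k (N \<omega>))" using Suc incr_bound[of \<omega> k] by (intro add_mono) auto
    finally show ?thesis using True by (simp del: tau.simps)
  next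
    case False
    then have "tau k \<omega> = T" "tau (Suc k) \<omega> = T"
      using tau_less_iff[OF Suc.prems, of k] tau_bounds(2)[OF Suc.prems, of k] tau_stays[OF Suc.prems, of k
          "Suc k"] by auto
    with Suc False show ?thesis by (simp del: tau.simps)
  qed
qed simp

end

section \<open>The martingale\<close>

locale cfs_martingale_measure = cfs_process M T F U S \<epsilon> L + Q: prob_space Q
  for M :: "'a measure" and T F and U :: "(real^'n) set" and S \<epsilon> L and Q :: "'a measure" +
  fixes K :: real
  assumes sets_Q: "sets Q = sets M" and null_Q: "null_sets Q = null_sets M"
    and incr_mart: "\<And>k B i. B \<in> sets (F_at (tau k)) \<Longrightarrow> (LINT \<omega>:B|Q. incr k \<omega> $ i) = 0"
    and tail: "\<And>k. emeasure Q {\<omega>\<in>space M. tau k \<omega> < T} \<le> ennreal ((1/8)^k)"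
    and K: "0 \<le> K" "AE \<omega> in M. norm (S 0 \<omega>) \<le> K"
begin

section \<open>Moment bounds and sampling at the stopping times\<close>

lemma space_Q: "space Q = space M"
  using sets_eq_imp_space_eq[OF sets_Q] .

lemma AE_Q: "(AE \<omega> in Q. P \<omega>) \<longleftrightarrow> (AE \<omega> in M. P \<omega>)"
  unfolding eventually_ae_filter null_Q space_Q ..

lemma measurable_Q: "borel_measurable Q = borel_measurable M"
  by (rule measurable_cong_sets) (simp_all add: sets_Q)

text \<open>The square of \<open>N\<close> is the sum of the odd numbers \<open>2 * k + 1\<close>
  over k < N, and k < N means \<open>tau k \<omega> < T\<close>. Since \<open>2 * k + 1\<close> is
  at most 4^k, the tails (1/8)^k leave a geometric series of ratio 1/2.\<close>

lemma N_square: "integrable Q (\<lambda>\<omega>. (real (N \<omega>))\<^sup>2)"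
proof (rule integrableI_nonneg)
  have [measurable]: "N \<in> measurable Q (count_space UNIV)"
    using N_measurable measurable_cong_sets[OF sets_Q refl] by auto
  show "(\<lambda>\<omega>. (real (N \<omega>))\<^sup>2) \<in> borel_measurable Q" by measurable
  define A where "A k = {\<omega>\<in>space M. tau k \<omega> < T}" for k
  have [measurable]: "A k \<in> sets Q" for k
    unfolding A_def sets_Q using tau_measurable(2)[of k] by measurable
  have odd: "real (2 * k + 1) \<le> 4 ^ k" for k
    by (induction k) auto
  have "ennreal ((real (N \<omega>))\<^sup>2) = (\<Sum>k. ennreal (real (2 * k + 1)) * indicator (A k) \<omega>)" if w: "\<omega> \<in> space Q"
      for \<omega>
  proof -
    have "(\<Sum>k. ennreal (real (2 * k + 1)) * indicator (A k) \<omega>) = (\<Sum>k<N \<omega>. ennreal (real (2 * k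
        + 1)) * indicator (A k) \<omega>)"
      using w tau_less_iff[of \<omega>] by (intro suminf_finite) (auto simp: A_def space_Q)
    also have "\<dots> = (\<Sum>k<N \<omega>. ennreal (real (2 * k + 1)))"
      using w tau_less_iff[of \<omega>] by (intro sum.cong) (auto simp: A_def space_Q)
    also have "\<dots> = ennreal (\<Sum>k<N \<omega>. real (2 * k + 1))" by (rule sum_ennreal) simp
    also have "(\<Sum>k<m. real (2 * k + 1)) = (real m)\<^sup>2" for m
      by (induction m) (auto simp: power2_eq_square algebra_simps)
    finally show ?thesis by simp
  qed
  then have "(\<integral>\<^sup>+\<omega>. ennreal ((real (N \<omega>))\<^sup>2) \<partial>Q) = (\<integral>\<^sup>+\<omega>. (\<Sum>k. ennreal (real (2 * k + 1)) * indicator (A k) \<omega>)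
      \<partial>Q)"
    by (intro nn_integral_cong) auto
  also have "\<dots> = (\<Sum>k. \<integral>\<^sup>+\<omega>. ennreal (real (2 * k + 1)) * indicator (A k) \<omega> \<partial>Q)"
    by (rule nn_integral_suminf) measurable
  also have "\<dots> = (\<Sum>k. ennreal (real (2 * k + 1)) * emeasure Q (A k))"
    by (simp add: nn_integral_cmult_indicator)
  also have "\<dots> \<le> (\<Sum>k. ennreal ((1/2)^k))"
  proof (intro suminf_le summableI)
    fix k
    have "ennreal (real (2 * k + 1)) * emeasure Q (A k) \<le> ennreal (4 ^ k) * ennreal ((1/8)^k)"
      using odd[of k] tail[of k] unfolding A_def by (intro mult_mono ennreal_leI) auto
    also have "\<dots> = ennreal ((1/2)^k)"
      by (simp add: ennreal_mult[symmetric] power_mult_distrib[symmetric])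
    finally show "ennreal (real (2 * k + 1)) * emeasure Q (A k) \<le> ennreal ((1/2)^k)" .
  qed
  also have "\<dots> = ennreal (\<Sum>k. (1/2)^k)"
    by (rule suminf_ennreal2) (auto intro!: summable_geometric)
  also have "\<dots> < \<infinity>" by simp
  finally show "(\<integral>\<^sup>+\<omega>. ennreal ((real (N \<omega>))\<^sup>2) \<partial>Q) < \<infinity>" .
qed auto

text \<open>A single integrable dominating function: a natural number is at most its square, so the
  square integrability of \<open>N\<close> suffices, and the summand 1 absorbs one further step of
  size \<open>H\<close>.\<close>

definition W :: "'a \<Rightarrow> real" where
  "W \<omega> = K + 1 + (real (N \<omega>))\<^sup>2"

lemma W_int: "integrable Q W"
  unfolding W_def[abs_def] using N_square by auto

lemma W_ge: "K + 1 + real (N \<omega>) \<le> W \<omega>"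
proof -
  have "real m \<le> (real m)\<^sup>2" for m :: nat
    by (cases m) (auto simp: power2_eq_square)
  then show ?thesis by (simp add: W_def)
qed

lemma norm_W: "norm (W \<omega>) = W \<omega>"
  using K(1) by (simp add: W_def)

lemma S_tau_W: "AE \<omega> in Q. \<forall>k. norm (S (tau k \<omega>) \<omega>) \<le> K + real (N \<omega>)"
  unfolding AE_Q using K(2) AE_space
proof eventually_elim
  case (elim \<omega>)
  show ?case
  proof
    fix k
    have "norm (S (tau k \<omega>) \<omega>) \<le> norm (S 0 \<omega>) + norm (S (tau k \<omega>) \<omega> - S 0 \<omega>)" by (rule norm_triangle_sub)
    also have "\<dots> \<le> K + real (N \<omega>)"
      using S_tau_bound[OF elim(2), of k] elim(1) by linarith
    finally show "norm (S (tau k \<omega>) \<omega>) \<le> K + real (N \<omega>)" .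
  qed
qed

lemma S_tau_comp_W: "AE \<omega> in Q. \<bar>S (tau k \<omega>) \<omega> $ i\<bar> \<le> W \<omega> - 1"
  using S_tau_W
proof eventually_elim
  case (elim \<omega>)
  have "\<bar>S (tau k \<omega>) \<omega> $ i\<bar> \<le> norm (S (tau k \<omega>) \<omega>)" by (rule component_le_norm_cart)
  with elim[rule_format, of k] W_ge[of \<omega>] show ?case by linarith
qed

lemma S_tau_int: "integrable Q (\<lambda>\<omega>. S (tau k \<omega>) \<omega> $ i)"
proof (rule Bochner_Integration.integrable_bound[OF W_int])
  show "(\<lambda>\<omega>. S (tau k \<omega>) \<omega> $ i) \<in> borel_measurable Q"
    unfolding measurable_Q using tau_measurable(1)[of k] by measurable
  show "AE \<omega> in Q. norm (S (tau k \<omega>) \<omega> $ i) \<le> norm (W \<omega>)"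
    using S_tau_comp_W[of k i] by eventually_elim auto
qed

lemma S_T_measurable: "S T \<in> borel_measurable M"
proof -
  have "S T \<in> borel_measurable (F T)" using S_adapted T_pos by (auto simp: adapted_on_def)
  then show ?thesis using T_pos by (intro measurable_from_subalg[OF subalgebra_F[of T]]) auto
qed

lemma S_T_int: "integrable Q (\<lambda>\<omega>. S T \<omega> $ i)"
proof (rule Bochner_Integration.integrable_bound[OF W_int])
  show "(\<lambda>\<omega>. S T \<omega> $ i) \<in> borel_measurable Q"
    unfolding measurable_Q using S_T_measurable by measurable
  show "AE \<omega> in Q. norm (S T \<omega> $ i) \<le> norm (W \<omega>)"
    using S_tau_W AE_space
  proof eventually_elim
    case (elim \<omega>)
    have "\<bar>S T \<omega> $ i\<bar> \<le> norm (S T \<omega>)" by (rule component_le_norm_cart)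
    moreover have "norm (S T \<omega>) \<le> K + real (N \<omega>)"
      using elim(1)[rule_format, of "N \<omega>"] tau_N[of \<omega>] elim(2) by (simp add: space_Q)
    ultimately show ?case using W_ge[of \<omega>] by (simp add: norm_W)
  qed
qed

text \<open>The integrals at \<open>tau j\<close> do not depend on j \<ge> k, because the increments
  integrate to 0. On each path \<open>S (tau j \<omega>) \<omega>\<close> is eventually
  \<open>S T \<omega>\<close>, and \<open>W\<close> dominates.\<close>

lemma S_T_mart:
  assumes B: "B \<in> sets (F_at (tau k))"
  shows "(LINT \<omega>:B|Q. S T \<omega> $ i) = (LINT \<omega>:B|Q. S (tau k \<omega>) \<omega> $ i)"
proof -
  have BM: "B \<in> sets M" using B subalgebra_F_at[OF stopping_tau, of k] by (auto simp: subalgebra_def)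
  then have BQ: "B \<in> sets Q" by (simp add: sets_Q)
  have si: "set_integrable Q B (\<lambda>\<omega>. S (tau j \<omega>) \<omega> $ i)" for j
    using S_tau_int[of j i] BQ integrable_mult_indicator[of B Q] unfolding set_integrable_def by blast
  have const: "(LINT \<omega>:B|Q. S (tau j \<omega>) \<omega> $ i) = (LINT \<omega>:B|Q. S (tau k \<omega>) \<omega> $ i)" if "k \<le> j" for j
    using that
  proof (induction j rule: dec_induct)
    case (step j)
    have "(LINT \<omega>:B|Q. S (tau (Suc j) \<omega>) \<omega> $ i) - (LINT \<omega>:B|Q. S (tau j \<omega>) \<omega> $ i) = (LINT \<omega>:B|Q. incr j \<omega> $
        i)"
      using set_integral_diff(2)[OF si si, of "Suc j" j] by (simp add: incr_def del: tau.simps)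
    also have "\<dots> = 0" by (rule incr_mart) (use F_at_tau_mono step B in auto)
    finally show ?case using step.IH by simp
  qed simp
  have "(\<lambda>j. LINT \<omega>|Q. indicator B \<omega> *\<^sub>R S (tau j \<omega>) \<omega> $ i) \<longlonglongrightarrow> (LINT \<omega>|Q. indicator B \<omega> *\<^sub>R S T \<omega> $ i)"
  proof (rule integral_dominated_convergence[where w=W])
    show "(\<lambda>\<omega>. indicator B \<omega> *\<^sub>R S T \<omega> $ i) \<in> borel_measurable Q"
      unfolding measurable_Q using S_T_measurable BM by measurable
    show "(\<lambda>\<omega>. indicator B \<omega> *\<^sub>R S (tau j \<omega>) \<omega> $ i) \<in> borel_measurable Q" for j
      unfolding measurable_Q using tau_measurable(1)[of j] BM by measurable
    show "integrable Q W" by (rule W_int)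
    show "AE \<omega> in Q. (\<lambda>j. indicator B \<omega> *\<^sub>R S (tau j \<omega>) \<omega> $ i) \<longlonglongrightarrow> indicator B \<omega> *\<^sub>R S T \<omega> $ i"
    proof (rule AE_I2)
      fix \<omega> assume "\<omega> \<in> space Q"
      then have w: "\<omega> \<in> space M" by (simp add: space_Q)
      have "\<forall>\<^sub>F j in sequentially. indicator B \<omega> *\<^sub>R S (tau j \<omega>) \<omega> $ i = indicator B \<omega> *\<^sub>R S T \<omega> $ i"
        unfolding eventually_sequentially using tau_stays[OF w _ tau_N[OF w]] by (intro exI[of _ "N \<omega>"]) auto
      then show "(\<lambda>j. indicator B \<omega> *\<^sub>R S (tau j \<omega>) \<omega> $ i) \<longlonglongrightarrow> indicator B \<omega> *\<^sub>R S T \<omega> $ i"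
        by (rule tendsto_eventually)
    qed
    show "AE \<omega> in Q. norm (indicator B \<omega> *\<^sub>R S (tau j \<omega>) \<omega> $ i) \<le> W \<omega>" for j
      using S_tau_comp_W[of j i] by eventually_elim (auto split: split_indicator)
  qed
  moreover have "(\<lambda>j. LINT \<omega>|Q. indicator B \<omega> *\<^sub>R S (tau j \<omega>) \<omega> $ i) \<longlonglongrightarrow> (LINT \<omega>:B|Q. S (tau k \<omega>) \<omega> $ i)"
    unfolding set_lebesgue_integral_def[symmetric]
    by (rule tendsto_eventually, unfold eventually_sequentially) (use const in blast)
  ultimately show ?thesis
    unfolding set_lebesgue_integral_def by (rule LIMSEQ_unique)
qed

section \<open>The closed martingale and its distance from S\<close>

definition Y :: "real \<Rightarrow> 'a \<Rightarrow> real^'n" where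
  "Y t \<omega> = (\<chi> i. real_cond_exp Q (F t) (\<lambda>\<omega>. S T \<omega> $ i) \<omega>)"

lemma subalgebra_Q: "t \<in> {0..T} \<Longrightarrow> subalgebra Q (F t)"
  using subalgebra_F by (auto simp: subalgebra_def space_Q sets_Q)

lemma Y_measurable: "Y t \<in> borel_measurable (F t)"
  by (rule borel_measurable_vec) (simp add: Y_def)

text \<open>Intersecting a set of \<open>F t\<close> with {tau k \<le> t < tau (Suc k)} gives a set
  of \<open>F_at (tau (Suc k))\<close>. By \<open>S_T_mart\<close>, on that event \<open>Y t\<close>
  is therefore also the conditional expectation of S at \<open>tau (Suc k)\<close>, which lies
  within \<open>H\<close> of S at \<open>tau k\<close> in each coordinate. Both bounds are known at
  time \<open>t\<close>.\<close>

lemma Y_near: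
  assumes t: "0 \<le> t" "t < T"
  shows "AE \<omega> in Q. tau k \<omega> \<le> t \<and> t < tau (Suc k) \<omega> \<longrightarrow> \<bar>(Y t \<omega> - S (tau k \<omega>) \<omega>) $ i\<bar> \<le> H (tau k \<omega>) \<omega>"
proof -
  have tT: "t \<in> {0..T}" "t \<le> T" using t by auto
  interpret Ft: finite_measure_subalgebra Q "F t"
    by unfold_locales (rule subalgebra_Q[OF tT(1)])
  have sp: "space (F t) = space M" by (rule space_F[OF tT(1)])
  define E where "E = {\<omega>\<in>{\<omega>\<in>space M. tau k \<omega> \<le> t}. t < tau (Suc k) \<omega>}"
  have E1: "{\<omega>\<in>space M. tau k \<omega> \<le> t} \<in> sets (F t)" by (rule stopping_le_sets[OF stopping_tau t(1) tT(2)])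
  have "E = {\<omega>\<in>space M. tau k \<omega> \<le> t} - {\<omega>\<in>space M. tau (Suc k) \<omega> \<le> t}" unfolding E_def by auto
  then have EF [measurable]: "E \<in> sets (F t)"
    using E1 stopping_le_sets[OF stopping_tau t(1) tT(2), of "Suc k"] by auto
  then have EM [measurable]: "E \<in> sets M" "E \<in> sets Q" using sets_F_subset[OF tT(1)] sets_Q by auto
  \<comment> \<open>The minimum makes \<open>a\<close> and \<open>h\<close> measurable for
    \<open>F t\<close> on the whole space; on \<open>E\<close> it has no effect.\<close>
  define a where "a \<omega> = S (min (tau k \<omega>) t) \<omega> $ i" for \<omega>
  define h where "h \<omega> = H (min (tau k \<omega>) t) \<omega>" for \<omega>
  have [measurable]: "a \<in> borel_measurable (F t)" "h \<in> borel_measurable (F t)"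
    unfolding a_def[abs_def] h_def[abs_def] using S_at_measurable[OF stopping_tau t(1) tT(2), of k]
        by measurable
  define f where "f \<omega> = indicator E \<omega> * S T \<omega> $ i" for \<omega>
  define g where "g \<omega> = indicator E \<omega> * S (tau (Suc k) \<omega>) \<omega> $ i" for \<omega>
  have f_int: "integrable Q f" unfolding f_def[abs_def] using integrable_mult_indicator[OF EM(2) S_T_int]
      by simp
  have g_int: "integrable Q g" unfolding g_def[abs_def] using integrable_mult_indicator[OF EM(2) S_tau_int, of
      "Suc k"] by (simp del: tau.simps)
  have Eh: "h \<omega> \<le> 1 \<and> 0 \<le> h \<omega>" "a \<omega> = S (tau k \<omega>) \<omega> $ i" "\<bar>S (tau (Suc k) \<omega>) \<omega> $ i - a \<omega>\<bar> \<le> h \<omega>" if "\<omega> \<in> E"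
      for \<omega>
  proof -
    have w: "\<omega> \<in> space M" "tau k \<omega> \<le> t" using that by (auto simp: E_def)
    note tb = tau_bounds[OF w(1), of k]
    show "h \<omega> \<le> 1 \<and> 0 \<le> h \<omega>" using H_le1(1)[OF tb w(1)] H_pos[OF tb w(1)] w(2)
        by (simp add: h_def min_absorb1)
    show a: "a \<omega> = S (tau k \<omega>) \<omega> $ i" using w(2) by (simp add: a_def min_absorb1)
    show "\<bar>S (tau (Suc k) \<omega>) \<omega> $ i - a \<omega>\<bar> \<le> h \<omega>"
      using tau_near(1)[OF w(1), of k "tau (Suc k) \<omega>"] tau_Suc_ge[OF w(1), of k] w(2)
        component_le_norm_cart[of "S (tau (Suc k) \<omega>) \<omega> - S (tau k \<omega>) \<omega>" i]
      unfolding a h_def by (simp add: min_absorb1 del: tau.simps)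
  qed
  have hm: "(\<lambda>\<omega>. indicator E \<omega> * (a \<omega> + h \<omega>)) \<in> borel_measurable (F t)"
      "(\<lambda>\<omega>. indicator E \<omega> * (a \<omega> - h \<omega>)) \<in> borel_measurable (F t)"
    by measurable
  have bd: "AE \<omega> in Q. indicator E \<omega> * (\<bar>a \<omega>\<bar> + h \<omega>) \<le> W \<omega>"
    using S_tau_comp_W[of k i]
  proof eventually_elim
    case (elim \<omega>)
    then show ?case using Eh(1,2)[of \<omega>] K(1) by (cases "\<omega> \<in> E") (auto simp: W_def)
  qed
  have ih: "integrable Q (\<lambda>\<omega>. indicator E \<omega> * (a \<omega> + h \<omega>))" "integrable Q (\<lambda>\<omega>. indicator E \<omega> * (a \<omega> - h \<omega>))"
  proof -
    have "AE \<omega> in Q. norm (indicator E \<omega> * (a \<omega> + h \<omega>)) \<le> norm (W \<omega>)"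
        "AE \<omega> in Q. norm (indicator E \<omega> * (a \<omega> - h \<omega>)) \<le> norm (W \<omega>)"
      using bd by (eventually_elim; use Eh(1) in \<open>force split: split_indicator\<close>)+
    then show "integrable Q (\<lambda>\<omega>. indicator E \<omega> * (a \<omega> + h \<omega>))"
        "integrable Q (\<lambda>\<omega>. indicator E \<omega> * (a \<omega> - h \<omega>))"
      using measurable_from_subalg[OF subalgebra_Q[OF tT(1)] hm(1)] measurable_from_subalg[OF subalgebra_Q[OF
          tT(1)] hm(2)]
      by (auto intro: Bochner_Integration.integrable_bound[OF W_int])
  qed
  have 1: "AE \<omega> in Q. real_cond_exp Q (F t) f \<omega> = indicator E \<omega> * Y t \<omega> $ i"
    unfolding f_def[abs_def] Y_def vec_lambda_beta
    using f_int S_T_int[of i] by (intro Ft.real_cond_exp_mult) (auto simp: f_def[abs_def])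
  have 2: "AE \<omega> in Q. real_cond_exp Q (F t) f \<omega> = real_cond_exp Q (F t) g \<omega>"
  proof (rule Ft.real_cond_exp_charact[OF _ f_int Ft.real_cond_exp_int(1)[OF g_int]])
    fix B assume B: "B \<in> sets (F t)"
    have "B \<inter> E = {\<omega>\<in>B \<inter> {\<omega>\<in>space M. tau k \<omega> \<le> t}. t < tau (Suc k) \<omega>}"
      unfolding E_def by auto
    also have "\<dots> \<in> sets (F_at (tau (Suc k)))"
      by (rule F_at_greaterI[OF stopping_tau t(1) tT(2)]) (use B E1 in auto)
    finally have BE: "B \<inter> E \<in> sets (F_at (tau (Suc k)))" .
    have "(LINT \<omega>:B|Q. f \<omega>) = (LINT \<omega>:B \<inter> E|Q. S T \<omega> $ i)"
      unfolding set_lebesgue_integral_def f_def by (intro Bochner_Integration.integral_cong) (auto split: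
          split_indicator)
    also have "\<dots> = (LINT \<omega>:B \<inter> E|Q. S (tau (Suc k) \<omega>) \<omega> $ i)" by (rule S_T_mart[OF BE])
    also have "\<dots> = (LINT \<omega>:B|Q. g \<omega>)"
      unfolding set_lebesgue_integral_def g_def by (intro Bochner_Integration.integral_cong) (auto split:
          split_indicator simp del: tau.simps)
    also have "\<dots> = (LINT \<omega>:B|Q. real_cond_exp Q (F t) g \<omega>)" by (rule Ft.real_cond_exp_intA[OF g_int B])
    finally show "(LINT \<omega>:B|Q. f \<omega>) = (LINT \<omega>:B|Q. real_cond_exp Q (F t) g \<omega>)" .
  qed auto
  have 3: "AE \<omega> in Q. real_cond_exp Q (F t) g \<omega> \<le> real_cond_exp Q (F t) (\<lambda>\<omega>. indicator E \<omega> * (a \<omega> + h \<omega>)) \<omega>"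
    by (rule Ft.real_cond_exp_mono[OF _ g_int ih(1)]) (use Eh(3) in \<open>force simp: g_def abs_le_iff split:
        split_indicator\<close>)
  have 4: "AE \<omega> in Q. real_cond_exp Q (F t) (\<lambda>\<omega>. indicator E \<omega> * (a \<omega> - h \<omega>)) \<omega> \<le> real_cond_exp Q (F t) g \<omega>"
    by (rule Ft.real_cond_exp_mono[OF _ ih(2) g_int]) (use Eh(3) in \<open>force simp: g_def abs_le_iff split:
        split_indicator\<close>)
  show ?thesis
    using 1 2 3 4 Ft.real_cond_exp_F_meas[OF ih(1) hm(1)] Ft.real_cond_exp_F_meas[OF ih(2) hm(2)] AE_space
  proof eventually_elim
    case (elim \<omega>)
    show ?case
    proof
      assume "tau k \<omega> \<le> t \<and> t < tau (Suc k) \<omega>"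
      with elim(7) have "\<omega> \<in> E" by (simp add: E_def space_Q del: tau.simps)
      with elim(1-6) Eh(2)[OF this] have "a \<omega> - h \<omega> \<le> Y t \<omega> $ i" "Y t \<omega> $ i \<le> a \<omega> + h \<omega>"
          "a \<omega> = S (tau k \<omega>) \<omega> $ i" by simp_all
      moreover have "h \<omega> = H (tau k \<omega>) \<omega>" using \<open>\<omega> \<in> E\<close> by (simp add: h_def E_def min_absorb1)
      ultimately show "\<bar>(Y t \<omega> - S (tau k \<omega>) \<omega>) $ i\<bar> \<le> H (tau k \<omega>) \<omega>" by (simp add: abs_le_iff)
    qed
  qed
qed

lemma Y_good:
  assumes t: "t \<in> {0..T}"
  shows "AE \<omega> in Q. norm (S t \<omega> - Y t \<omega>) \<le> \<epsilon> t \<omega> \<and> Y t \<omega> \<in> U \<and> norm (Y t \<omega>) \<le> K + 1 + real (N \<omega>)"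
proof (cases "t = T")
  case True
  interpret Ft: finite_measure_subalgebra Q "F t"
    by unfold_locales (rule subalgebra_Q[OF t])
  have m: "(\<lambda>\<omega>. S T \<omega> $ i) \<in> borel_measurable (F t)" for i
    using S_adapted t True by (auto simp: adapted_on_def intro!: borel_measurable_vec_nth)
  have "AE \<omega> in Q. \<forall>i\<in>UNIV. real_cond_exp Q (F t) (\<lambda>\<omega>. S T \<omega> $ i) \<omega> = S T \<omega> $ i"
    by (intro AE_finite_allI finite Ft.real_cond_exp_F_meas S_T_int m)
  then show ?thesis using S_tau_W AE_space
  proof eventually_elim
    case (elim \<omega>)
    then have w: "\<omega> \<in> space M" by (simp add: space_Q)
    have "Y t \<omega> = S t \<omega>" using elim(1) True by (simp add: Y_def vec_eq_iff)
    moreover have "norm (S T \<omega>) \<le> K + real (N \<omega>)" using elim(2)[rule_format, of "N \<omega>"] tau_N[OF w] by simp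
    ultimately show ?case using eps_pos[of t \<omega>] S_in[of t \<omega>] t w True by auto
  qed
next
  case False
  with t have t': "0 \<le> t" "t < T" by auto
  \<comment> \<open>One null set serves all \<open>k\<close> and \<open>i\<close>, so the step that
    contains \<open>t\<close> may be chosen path by path.\<close>
  have "AE \<omega> in Q. \<forall>k. \<forall>i\<in>UNIV. tau k \<omega> \<le> t \<and> t < tau (Suc k) \<omega> \<longrightarrow> \<bar>(Y t \<omega> - S (tau k \<omega>) \<omega>) $ i\<bar>
      \<le> H (tau k \<omega>) \<omega>"
    unfolding AE_all_countable by (intro allI AE_finite_allI finite Y_near[OF t'])
  then show ?thesis using S_tau_W AE_space
  proof eventually_elim
    case (elim \<omega>)
    then have w: "\<omega> \<in> space M" by (simp add: space_Q)
    obtain k where k: "tau k \<omega> \<le> t" "t < tau (Suc k) \<omega>" using tau_interval[OF w t'] by auto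
    note tb = tau_bounds[OF w, of k]
    let ?s = "S (tau k \<omega>) \<omega>" and ?h = "H (tau k \<omega>) \<omega>" and ?n = "real CARD('n)"
    have "norm (Y t \<omega> - ?s) \<le> (\<Sum>i\<in>UNIV. \<bar>(Y t \<omega> - ?s) $ i\<bar>)" by (rule norm_le_l1_cart)
    also have "\<dots> \<le> (\<Sum>i\<in>(UNIV::'n set). ?h)" using elim(1) k by (intro sum_mono) blast
    finally have 1: "norm (Y t \<omega> - ?s) \<le> ?n * ?h" by simp
    have hn: "?h \<le> ?n * ?h" using one_le_card H_pos[OF tb w] by simp
    have 2: "norm (S t \<omega> - ?s) \<le> ?h" and 3: "\<epsilon> (tau k \<omega>) \<omega> / 2 \<le> \<epsilon> t \<omega>"
      using tau_near[OF w k(1) less_imp_le[OF k(2)]] by auto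
    have "norm (S t \<omega> - Y t \<omega>) \<le> norm (S t \<omega> - ?s) + norm (Y t \<omega> - ?s)"
      using norm_triangle_ineq4[of "S t \<omega> - ?s" "Y t \<omega> - ?s"] by simp
    then have "norm (S t \<omega> - Y t \<omega>) \<le> \<epsilon> t \<omega>" using 1 2 3 hn H_le(2)[OF tb w] by linarith
    moreover have "Y t \<omega> \<in> U" by (rule boundary_dist_ball[OF le_less_trans[OF 1 H_le1(2)[OF tb w]]])
    moreover have "norm (Y t \<omega>) \<le> norm ?s + norm (Y t \<omega> - ?s)" by (rule norm_triangle_sub)
    then have "norm (Y t \<omega>) \<le> K + 1 + real (N \<omega>)"
      using 1 H_le(1)[OF tb w] elim(2)[rule_format, of k] H_pos[OF tb w] hn by linarith
    ultimately show ?case by simp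
  qed
qed

text \<open>Almost surely \<open>S' t = Y t\<close>; the modification makes the constraints hold for every \<open>\<omega>\<close>.\<close>

definition S' :: "real \<Rightarrow> 'a \<Rightarrow> real^'n" where
  "S' t \<omega> = (if norm (S t \<omega> - Y t \<omega>) \<le> \<epsilon> t \<omega> \<and> Y t \<omega> \<in> U then Y t \<omega> else S t \<omega>)"

lemma S'_AE: "t \<in> {0..T} \<Longrightarrow> AE \<omega> in Q. S' t \<omega> = Y t \<omega>"
  by (rule eventually_mono[OF Y_good]) (auto simp: S'_def)

lemma S'_in: "t \<in> {0..T} \<Longrightarrow> \<omega> \<in> space M \<Longrightarrow> S' t \<omega> \<in> U"
  using S_in[of t \<omega>] by (simp add: S'_def)

lemma S'_close: "t \<in> {0..T} \<Longrightarrow> \<omega> \<in> space M \<Longrightarrow> norm (S t \<omega> - S' t \<omega>) \<le> \<epsilon> t \<omega>"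
  using eps_pos[of t \<omega>] by (auto simp: S'_def)

lemma S'_measurable:
  assumes t: "t \<in> {0..T}"
  shows "S' t \<in> borel_measurable (F t)"
proof -
  have [measurable]: "S t \<in> borel_measurable (F t)" "\<epsilon> t \<in> borel_measurable (F t)" "U \<in> sets borel"
    using S_adapted eps_adapted U_open t by (auto simp: adapted_on_def)
  note Y_measurable[measurable]
  show ?thesis unfolding S'_def[abs_def] by measurable
qed

lemma S'_bound:
  assumes t: "t \<in> {0..T}"
  shows "AE \<omega> in Q. norm (S' t \<omega>) \<le> K + 1 + real (N \<omega>)"
  using Y_good[OF t] by eventually_elim (simp add: S'_def)

lemma S'_martingale: "martingale_on Q T F S'"
  unfolding martingale_on_def
proof (intro conjI ballI allI impI)
  show "adapted_on T F S'" unfolding adapted_on_def using S'_measurable by blast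
next
  fix t assume t: "t \<in> {0..T}"
  show "integrable Q (S' t)"
  proof (rule Bochner_Integration.integrable_bound[OF W_int])
    show "S' t \<in> borel_measurable Q" by (rule measurable_from_subalg[OF subalgebra_Q[OF t] S'_measurable[OF
        t]])
    show "AE \<omega> in Q. norm (S' t \<omega>) \<le> norm (W \<omega>)"
      using S'_bound[OF t]
    proof eventually_elim
      case (elim \<omega>)
      then show ?case using W_ge[of \<omega>] by (simp add: norm_W)
    qed
  qed
next
  fix s t :: real and i :: 'n assume st: "0 \<le> s \<and> s \<le> t \<and> t \<le> T"
  then have s: "s \<in> {0..T}" and t: "t \<in> {0..T}" by auto
  interpret Fs: finite_measure_subalgebra Q "F s"
    by unfold_locales (rule subalgebra_Q[OF s])
  have "S' t \<in> borel_measurable Q" by (rule measurable_from_subalg[OF subalgebra_Q[OF t] S'_measurable[OF t]])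
  then have m: "(\<lambda>\<omega>. S' t \<omega> $ i) \<in> borel_measurable Q" by measurable
  have "AE \<omega> in Q. real_cond_exp Q (F s) (\<lambda>\<omega>. S' t \<omega> $ i) \<omega> = real_cond_exp Q (F s) (real_cond_exp Q (F t)
      (\<lambda>\<omega>. S T \<omega> $ i)) \<omega>"
  proof (rule Fs.real_cond_exp_cong[OF _ m])
    show "AE \<omega> in Q. S' t \<omega> $ i = real_cond_exp Q (F t) (\<lambda>\<omega>. S T \<omega> $ i) \<omega>"
      using S'_AE[OF t] by eventually_elim (simp add: Y_def)
  qed auto
  moreover have "AE \<omega> in Q. real_cond_exp Q (F s) (real_cond_exp Q (F t) (\<lambda>\<omega>. S T \<omega> $ i)) \<omega> = real_cond_exp Q
      (F s) (\<lambda>\<omega>. S T \<omega> $ i) \<omega>"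
    using st by (intro Fs.real_cond_exp_nested_subalg[OF subalgebra_Q[OF t]] subalgebra_F_F S_T_int) auto
  ultimately show "AE \<omega> in Q. real_cond_exp Q (F s) (\<lambda>\<omega>. S' t \<omega> $ i) \<omega> = S' s \<omega> $ i"
    using S'_AE[OF s] by eventually_elim (simp add: Y_def)
qed

lemma S'_L2: "bounded_L2 Q T S'"
  unfolding bounded_L2_def
proof (intro conjI ballI)
  fix t assume t: "t \<in> {0..T}"
  show "S' t \<in> borel_measurable Q" by (rule measurable_from_subalg[OF subalgebra_Q[OF t] S'_measurable[OF t]])
next
  \<comment> \<open>From (a + b)^2 \<le> 2 a^2 + 2 b^2; the bound does not depend on t, so it bounds
    the supremum.\<close>
  let ?D = "\<lambda>\<omega>. 2 * (K + 1)\<^sup>2 + 2 * (real (N \<omega>))\<^sup>2"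
  have int: "integrable Q ?D" using N_square by auto
  have "(SUP t\<in>{0..T}. \<integral>\<^sup>+ \<omega>. ennreal ((norm (S' t \<omega>))\<^sup>2) \<partial>Q) \<le> (\<integral>\<^sup>+ \<omega>. ennreal (?D \<omega>) \<partial>Q)"
  proof (rule SUP_least, rule nn_integral_mono_AE)
    fix t assume t: "t \<in> {0..T}"
    show "AE \<omega> in Q. ennreal ((norm (S' t \<omega>))\<^sup>2) \<le> ennreal (?D \<omega>)"
      using S'_bound[OF t]
    proof eventually_elim
      case (elim \<omega>)
      then have "(norm (S' t \<omega>))\<^sup>2 \<le> (K + 1 + real (N \<omega>))\<^sup>2" by (intro power_mono) auto
      also have "\<dots> \<le> ?D \<omega>"
        using sum_squares_ge_zero[of "K + 1 - real (N \<omega>)" 0] by (simp add: power2_eq_square algebra_simps)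
      finally show ?case by (rule ennreal_leI)
    qed
  qed
  also have "\<dots> < \<infinity>" using integrableD(2)[OF int] by (simp add: less_top)
  finally show "(SUP t\<in>{0..T}. \<integral>\<^sup>+ \<omega>. ennreal ((norm (S' t \<omega>))\<^sup>2) \<partial>Q) < \<infinity>" .
qed

end

theorem theorem3:
  fixes M :: "'a measure" and T :: real and F :: "real \<Rightarrow> 'a measure"
    and U :: "(real^'n) set" and S :: "real \<Rightarrow> 'a \<Rightarrow> real^'n"
    and \<epsilon> :: "real \<Rightarrow> 'a \<Rightarrow> real" and L :: "real \<Rightarrow> 'a \<Rightarrow> real"
  assumes "T > 0"
    and "prob_space M"
    and "filtration_on M T F"
    and "usual_conditions M T F"
    and "trivial_initial M F"
    and "open U"
    and "\<forall>t\<in>{0..T}. \<forall>\<omega>\<in>space M. S t \<omega> \<in> U"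
    and "\<forall>\<omega>\<in>space M. continuous_on {0..T} (\<lambda>t. S t \<omega>)"
    and "adapted_on T F S"
    and "cond_full_support M T F U S"
    and "adapted_on T F \<epsilon>"
    and "\<forall>\<omega>\<in>space M. continuous_on {0..T} (\<lambda>t. \<epsilon> t \<omega>)"
    and "\<forall>t\<in>{0..T}. \<forall>\<omega>\<in>space M. \<epsilon> t \<omega> > 0"
    and "progressive_on T F L"
    and "\<forall>\<omega>\<in>space M. \<forall>s t. 0 \<le> s \<and> s \<le> t \<and> t \<le> T \<longrightarrow>
           \<bar>\<epsilon> t \<omega> - \<epsilon> s \<omega>\<bar> \<le> L s \<omega> * (SUP u\<in>{s..t}. norm (S u \<omega> - S s \<omega>))"
  shows "\<exists>Q :: 'a measure. \<exists>S' :: real \<Rightarrow> 'a \<Rightarrow> real^'n.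
           prob_space Q \<and> space Q = space M \<and> equivalent_measures Q M \<and>
           (\<forall>t\<in>{0..T}. \<forall>\<omega>\<in>space M. S' t \<omega> \<in> U) \<and>
           martingale_on Q T F S' \<and>
           bounded_L2 Q T S' \<and>
           (\<forall>t\<in>{0..T}. AE \<omega> in M. norm (S t \<omega> - S' t \<omega>) \<le> \<epsilon> t \<omega>)"
proof -
  interpret prob_space M by fact
  interpret cfs_process M T F U S \<epsilon> L
    by unfold_locales (use assms in auto)
  obtain Q where Q: "prob_space Q" "sets Q = sets M" "null_sets Q = null_sets M"
    "\<And>k B i. B \<in> sets (F_at (tau k)) \<Longrightarrow> (LINT \<omega>:B|Q. incr k \<omega> $ i) = 0"
    "\<And>k. emeasure Q {\<omega>\<in>space M. tau k \<omega> < T} \<le> ennreal ((1/8)^k)"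
    using limit_measure by blast
  obtain K where K: "0 \<le> K" "AE \<omega> in M. norm (S 0 \<omega>) \<le> K"
    using S_initial_bound[OF assms(5)] by blast
  interpret Q: prob_space Q by fact
  interpret R: cfs_martingale_measure M T F U S \<epsilon> L Q K
    by unfold_locales (fact Q K)+
  show ?thesis
    using Q(1,2,3) R.space_Q R.S'_in R.S'_martingale R.S'_L2 R.S'_close
    by (intro exI[of _ Q] exI[of _ R.S']) (auto simp: equivalent_measures_def intro!: AE_I2)
qed

end
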